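(* Let $\mathcal{M}$ be a II$_1$ factor, let $\mathcal{A},\mathcal{B}\subseteq\mathcal{M}$ be separable abelian $C^*$-subalgebras, and let $T:\mathcal{M}\to\mathcal{M}$ be a doubly stochastic map. Let $\mathcal{S}=T^{-1}(\mathcal{A})\cap\mathcal{B}=\{b\in\mathcal{B}: T(b)\in\mathcal{A}\}$ (an operator subsystem of $\mathcal{B}$). Then there exists a sequence $(\rho_r)_{r\in\mathbb{N}}\subseteq\mathcal{D}(\mathcal{M})$ such that $\lim_{r\to\infty}\|T(b)-\rho_r(b)\|=0$ for every $b\in\mathcal{S}$.
   Context: $\tau$ denotes the normalized faithful normal trace of $\mathcal{M}$. All $C^*$-subalgebras of $\mathcal{M}$ are unital (they contain the unit of $\mathcal{M}$). A linear map $T:\mathcal{M}\to\mathcal{M}$ is doubly stochastic if it is unital, positive, and trace preserving ($\tau\circ T=\tau$). $\mathcal{D}(\mathcal{M})$ is the convex hull of the inner automorphisms $\mathrm{Ad}\,u: x\mapsto uxu^*$, $u$ ranging over the unitary group of $\mathcal{M}$. The norm is the operator norm. *)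

theory Defs
  imports "HOL-Analysis.Analysis"
begin

text \<open>
  Complex vector spaces and complex Hilbert spaces are type classes over the corresponding real
  ones. A bounded operator on a complex Hilbert space is an element of the library type
  \<open>'h \<Rightarrow>\<^sub>L 'h\<close> (whose norm is the operator norm) that is in addition complex linear.
\<close>

class scaleC =
  fixes scaleC :: "complex \<Rightarrow> 'a \<Rightarrow> 'a"  (infixr \<open>*\<^sub>C\<close> 75)

class complex_vector = real_vector + scaleC +
  assumes scaleC_add_right: "a *\<^sub>C (x + y) = a *\<^sub>C x + a *\<^sub>C y"
    and scaleC_add_left: "(a + b) *\<^sub>C x = a *\<^sub>C x + b *\<^sub>C x"
    and scaleC_scaleC: "a *\<^sub>C b *\<^sub>C x = (a * b) *\<^sub>C x"
    and scaleR_scaleC: "r *\<^sub>R x = complex_of_real r *\<^sub>C x"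

class complex_inner = complex_vector + real_inner +
  fixes cinner :: "'a \<Rightarrow> 'a \<Rightarrow> complex"
  assumes cinner_commute: "cinner x y = cnj (cinner y x)"
    and cinner_add_left: "cinner (x + y) z = cinner x z + cinner y z"
    and cinner_scaleC_left: "cinner (a *\<^sub>C x) y = a * cinner x y"
    and inner_Re_cinner: "inner x y = Re (cinner x y)"

class chilbert_space = complex_inner + complete_space

lemma scaleC_one: "1 *\<^sub>C x = (x :: 'a :: complex_vector)"
  using scaleR_scaleC[of 1 x] by simp

lemma norm_scaleC: "norm (c *\<^sub>C x) = cmod c * norm (x :: 'a :: complex_inner)"
proof -
  have "cinner (c *\<^sub>C x) (c *\<^sub>C x) = c * cnj c * cinner x x"
    by (metis cinner_commute cinner_scaleC_left complex_cnj_mult mult.assoc)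
  also have "\<dots> = of_real ((cmod c)\<^sup>2) * cinner x x"
    by (simp only: complex_norm_square)
  finally have "inner (c *\<^sub>C x) (c *\<^sub>C x) = (cmod c)\<^sup>2 * inner x x"
    unfolding inner_Re_cinner by simp
  then show ?thesis
    by (simp add: norm_eq_sqrt_inner real_sqrt_mult)
qed

lemma bounded_linear_scaleC: "bounded_linear (\<lambda>x :: 'a :: complex_inner. c *\<^sub>C x)"
proof (rule bounded_linear_intro)
  show "c *\<^sub>C (x + y) = c *\<^sub>C x + c *\<^sub>C y" for x y :: 'a
    by (rule scaleC_add_right)
  show "c *\<^sub>C r *\<^sub>R x = r *\<^sub>R c *\<^sub>C x" for r and x :: 'a
    by (simp add: scaleR_scaleC scaleC_scaleC mult.commute)
  show "norm (c *\<^sub>C x) \<le> norm x * cmod c" for x :: 'a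
    by (simp add: norm_scaleC mult.commute)
qed

instantiation complex :: chilbert_space
begin
definition "scaleC a (x :: complex) = a * x"
definition "cinner x (y :: complex) = x * cnj y"
instance
  by standard (simp_all add: scaleC_complex_def cinner_complex_def algebra_simps
      scaleR_conv_of_real inner_complex_def)
end

instantiation blinfun :: (real_normed_vector, complex_inner) complex_vector
begin
lift_definition scaleC_blinfun :: "complex \<Rightarrow> 'a \<Rightarrow>\<^sub>L 'b \<Rightarrow> 'a \<Rightarrow>\<^sub>L 'b"
  is "\<lambda>c f x. c *\<^sub>C f x"
  by (rule bounded_linear_compose[OF bounded_linear_scaleC])
instance
  by standard (transfer, simp add: scaleC_add_right scaleC_add_left scaleC_scaleC scaleR_scaleC)+
end

global_interpretation complex_vector: vector_space "scaleC :: complex \<Rightarrow> 'a \<Rightarrow> 'a :: complex_vector"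
  defines csubspace = complex_vector.subspace
  by standard (simp_all add: scaleC_add_right scaleC_add_left scaleC_scaleC scaleC_one)


definition clinear_on :: "'a :: complex_vector set \<Rightarrow> ('a \<Rightarrow> 'b :: complex_vector) \<Rightarrow> bool" where
  "clinear_on V f \<longleftrightarrow>
     (\<forall>x\<in>V. \<forall>y\<in>V. f (x + y) = f x + f y) \<and> (\<forall>c. \<forall>x\<in>V. f (c *\<^sub>C x) = c *\<^sub>C f x)"

definition bounded_operators :: "('h :: chilbert_space \<Rightarrow>\<^sub>L 'h) set" where
  "bounded_operators = {A. clinear_on UNIV (blinfun_apply A)}"

text \<open>On \<^const>\<open>bounded_operators\<close> the adjoint exists by the Riesz representation theorem;
  it is never used outside this set, except inertly inside the total function \<open>Ad\<close> below.\<close>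

definition adj :: "('h :: chilbert_space \<Rightarrow>\<^sub>L 'h) \<Rightarrow> 'h \<Rightarrow>\<^sub>L 'h" where
  "adj A = (THE B. \<forall>x y. cinner (blinfun_apply A x) y = cinner x (blinfun_apply B y))"

definition pos_op :: "('h :: chilbert_space \<Rightarrow>\<^sub>L 'h) \<Rightarrow> bool" where
  "pos_op A \<longleftrightarrow> A \<in> bounded_operators \<and> (\<forall>x. cinner (blinfun_apply A x) x \<in> \<real>\<^sub>\<ge>\<^sub>0)"

definition op_le :: "('h :: chilbert_space \<Rightarrow>\<^sub>L 'h) \<Rightarrow> ('h \<Rightarrow>\<^sub>L 'h) \<Rightarrow> bool" where
  "op_le A B \<longleftrightarrow> pos_op (B - A)"

definition unital_star_subalgebra :: "('h :: chilbert_space \<Rightarrow>\<^sub>L 'h) set \<Rightarrow> bool" where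
  "unital_star_subalgebra A \<longleftrightarrow>
     A \<subseteq> bounded_operators \<and> csubspace A \<and> id_blinfun \<in> A \<and>
     (\<forall>x\<in>A. \<forall>y\<in>A. x o\<^sub>L y \<in> A) \<and> (\<forall>x\<in>A. adj x \<in> A)"

definition unital_cstar_algebra :: "('h :: chilbert_space \<Rightarrow>\<^sub>L 'h) set \<Rightarrow> bool" where
  "unital_cstar_algebra A \<longleftrightarrow> unital_star_subalgebra A \<and> closed A"

definition abelian :: "('h :: chilbert_space \<Rightarrow>\<^sub>L 'h) set \<Rightarrow> bool" where
  "abelian A \<longleftrightarrow> (\<forall>x\<in>A. \<forall>y\<in>A. x o\<^sub>L y = y o\<^sub>L x)"

definition von_neumann_algebra :: "('h :: chilbert_space \<Rightarrow>\<^sub>L 'h) set \<Rightarrow> bool" where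
  "von_neumann_algebra M \<longleftrightarrow> unital_star_subalgebra M \<and> closedin strong_operator_topology M"

definition commutant :: "('h :: chilbert_space \<Rightarrow>\<^sub>L 'h) set \<Rightarrow> ('h \<Rightarrow>\<^sub>L 'h) set" where
  "commutant M = {x \<in> bounded_operators. \<forall>y\<in>M. x o\<^sub>L y = y o\<^sub>L x}"

definition vn_factor :: "('h :: chilbert_space \<Rightarrow>\<^sub>L 'h) set \<Rightarrow> bool" where
  "vn_factor M \<longleftrightarrow> von_neumann_algebra M \<and> (id_blinfun :: 'h \<Rightarrow>\<^sub>L 'h) \<noteq> 0 \<and>
     M \<inter> commutant M = range (\<lambda>c. c *\<^sub>C id_blinfun)"

definition projections :: "('h :: chilbert_space \<Rightarrow>\<^sub>L 'h) set \<Rightarrow> ('h \<Rightarrow>\<^sub>L 'h) set" where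
  "projections M = {p \<in> M. p o\<^sub>L p = p \<and> adj p = p}"

definition minimal_projection :: "('h :: chilbert_space \<Rightarrow>\<^sub>L 'h) set \<Rightarrow> ('h \<Rightarrow>\<^sub>L 'h) \<Rightarrow> bool" where
  "minimal_projection M p \<longleftrightarrow>
     p \<in> projections M \<and> p \<noteq> 0 \<and> (\<forall>q\<in>projections M. op_le q p \<longrightarrow> q = 0 \<or> q = p)"

text \<open>Finiteness: the unit is not equivalent to a proper subprojection.\<close>

definition finite_vna :: "('h :: chilbert_space \<Rightarrow>\<^sub>L 'h) set \<Rightarrow> bool" where
  "finite_vna M \<longleftrightarrow> (\<forall>v\<in>M. adj v o\<^sub>L v = id_blinfun \<longrightarrow> v o\<^sub>L adj v = id_blinfun)"

text \<open>Type \<open>II\<^sub>1\<close> in the Murray--von Neumann classification of factors: finite, and not of type I.\<close>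

definition II1_factor :: "('h :: chilbert_space \<Rightarrow>\<^sub>L 'h) set \<Rightarrow> bool" where
  "II1_factor M \<longleftrightarrow> vn_factor M \<and> finite_vna M \<and> (\<nexists>p. minimal_projection M p)"

text \<open>Normality: suprema of upward directed families of positive elements are preserved.\<close>

definition is_sup_in :: "('h :: chilbert_space \<Rightarrow>\<^sub>L 'h) set \<Rightarrow> ('h \<Rightarrow>\<^sub>L 'h) set \<Rightarrow> ('h \<Rightarrow>\<^sub>L 'h) \<Rightarrow> bool" where
  "is_sup_in M D s \<longleftrightarrow>
     s \<in> M \<and> (\<forall>x\<in>D. op_le x s) \<and> (\<forall>t\<in>M. (\<forall>x\<in>D. op_le x t) \<longrightarrow> op_le s t)"

definition normal_on :: "('h :: chilbert_space \<Rightarrow>\<^sub>L 'h) set \<Rightarrow> (('h \<Rightarrow>\<^sub>L 'h) \<Rightarrow> complex) \<Rightarrow> bool" where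
  "normal_on M \<phi> \<longleftrightarrow>
     (\<forall>D s. D \<subseteq> {x \<in> M. pos_op x} \<and> D \<noteq> {} \<and>
        (\<forall>x\<in>D. \<forall>y\<in>D. \<exists>z\<in>D. op_le x z \<and> op_le y z) \<and> is_sup_in M D s \<longrightarrow>
        Re (\<phi> s) = (SUP x\<in>D. Re (\<phi> x)))"

definition normalized_faithful_normal_trace ::
    "('h :: chilbert_space \<Rightarrow>\<^sub>L 'h) set \<Rightarrow> (('h \<Rightarrow>\<^sub>L 'h) \<Rightarrow> complex) \<Rightarrow> bool" where
  "normalized_faithful_normal_trace M \<tau> \<longleftrightarrow>
     clinear_on M \<tau> \<and>
     (\<forall>x\<in>M. pos_op x \<longrightarrow> \<tau> x \<in> \<real>\<^sub>\<ge>\<^sub>0) \<and>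
     \<tau> id_blinfun = 1 \<and>
     (\<forall>x\<in>M. \<forall>y\<in>M. \<tau> (x o\<^sub>L y) = \<tau> (y o\<^sub>L x)) \<and>
     (\<forall>x\<in>M. \<tau> (adj x o\<^sub>L x) = 0 \<longrightarrow> x = 0) \<and>
     normal_on M \<tau>"

definition doubly_stochastic ::
    "('h :: chilbert_space \<Rightarrow>\<^sub>L 'h) set \<Rightarrow> (('h \<Rightarrow>\<^sub>L 'h) \<Rightarrow> complex) \<Rightarrow> (('h \<Rightarrow>\<^sub>L 'h) \<Rightarrow> ('h \<Rightarrow>\<^sub>L 'h)) \<Rightarrow> bool" where
  "doubly_stochastic M \<tau> T \<longleftrightarrow>
     T ` M \<subseteq> M \<and> clinear_on M T \<and>
     T id_blinfun = id_blinfun \<and>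
     (\<forall>x\<in>M. pos_op x \<longrightarrow> pos_op (T x)) \<and>
     (\<forall>x\<in>M. \<tau> (T x) = \<tau> x)"

definition unitaries :: "('h :: chilbert_space \<Rightarrow>\<^sub>L 'h) set \<Rightarrow> ('h \<Rightarrow>\<^sub>L 'h) set" where
  "unitaries M = {u \<in> M. adj u o\<^sub>L u = id_blinfun \<and> u o\<^sub>L adj u = id_blinfun}"

text \<open>\<open>Ad u\<close> and its convex combinations are bounded linear maps on the whole operator space, so that
  the library's convex hull applies; only their restrictions to \<open>M\<close> matter.\<close>

lift_definition Ad :: "('h :: chilbert_space \<Rightarrow>\<^sub>L 'h) \<Rightarrow> ('h \<Rightarrow>\<^sub>L 'h) \<Rightarrow>\<^sub>L ('h \<Rightarrow>\<^sub>L 'h)"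
  is "\<lambda>u x. u o\<^sub>L x o\<^sub>L adj u"
  by (intro bounded_linear_intros)

definition inner_hull ::
    "('h :: chilbert_space \<Rightarrow>\<^sub>L 'h) set \<Rightarrow> (('h \<Rightarrow>\<^sub>L 'h) \<Rightarrow>\<^sub>L ('h \<Rightarrow>\<^sub>L 'h)) set" where
  "inner_hull M = convex hull (Ad ` unitaries M)"

end

theory Submission
  imports Defs
begin

text \<open>
  Why the theorem is true.  Consider finitely many self-adjoint \<open>b\<close> in \<open>S\<close>.  By the spectral theorem the
  von Neumann algebra generated by \<open>B\<close> contains a partition \<open>P\<close> of the unit into projections such that
  each \<open>b\<close> is close in norm to some \<open>\<Sum>\<^sub>p \<beta>(p) p\<close>; likewise the one generated by \<open>A\<close> contains a partition
  \<open>Q\<close> such that each \<open>T b\<close> is close to some \<open>\<Sum>\<^sub>q \<alpha>(q) q\<close> (lemma \<open>simultaneous_approximation\<close>).  Put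
  \<open>d(q,p) = \<tau>(q T(p)) / \<tau>(q)\<close>.  Because \<open>T\<close> is positive, unital and trace preserving, \<open>d\<close> is nonnegative,
  its rows sum to \<open>1\<close>, and \<open>\<Sum>\<^sub>q \<tau>(q) d(q,p) = \<tau>(p)\<close>.  Moreover \<open>\<Sum>\<^sub>p \<beta>(p) d(q,p)\<close> is
  \<open>\<tau>(q T(\<Sum>\<^sub>p \<beta>(p) p)) / \<tau>(q)\<close>, which is close to \<open>\<tau>(q T(b)) / \<tau>(q)\<close> and hence to \<open>\<alpha>(q)\<close>.  So it is enough to
  find one \<open>\<rho>\<close> in the convex hull of the inner automorphisms with \<open>\<rho>(p)\<close> close in norm to \<open>\<Sum>\<^sub>q d(q,p) q\<close>
  for every \<open>p\<close> (lemmas \<open>averaging\<close> and \<open>finite_approximation\<close>).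

  To build \<open>\<rho>\<close>, cut every \<open>q\<close> into \<open>n\<close> pieces of equal trace, reserve about \<open>n d(q,p)\<close> of them for \<open>p\<close>, and
  choose disjoint subprojections of \<open>p\<close> with the traces of the pieces reserved for \<open>p\<close>.  For each \<open>s < n\<close> let
  a unitary carry these subprojections onto the reserved pieces shifted cyclically by \<open>s\<close>.  Averaged over
  \<open>s\<close>, every piece of \<open>q\<close> becomes \<open>q/n\<close>, so the matched part of \<open>p\<close> becomes \<open>\<Sum>\<^sub>q d(q,p) q\<close> up to \<open>1/n\<close>.
  The unmatched part of \<open>p\<close> has small trace, which says nothing about its norm; but the unitaries place
  it under the sum of the unreserved pieces, whose average is at most \<open>card P / n\<close>, and by positivity
  this bounds the average of the unmatched part as well.

  The construction uses that a \<open>II\<^sub>1\<close> factor has subprojections of every smaller trace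
  (\<open>subprojection_of_trace\<close>) and that projections of equal trace are equivalent
  (\<open>equal_trace_equivalent\<close>).  Both are maximality arguments, and since the trace is bounded and faithful
  they only need upper bounds of sequences (\<open>maximal_element_countable_chains\<close>).  The nonzero partial
  isometry which drives the second one comes from the triviality of the centre (\<open>corner_nonzero\<close>) and
  from the polar decomposition of an operator cut off away from \<open>0\<close> (\<open>polar_partial_isometry\<close>).

  Adjoint, positivity, projections and unitaries of complex linear operators can all be expressed by
  the real inner product \<open>Re \<langle>x, y\<rangle>\<close>.  The argument above is therefore carried out over real Hilbert spaces
  for the real trace \<open>Re \<tau>\<close>; complex scalars enter at the end, where the elements of \<open>S\<close> are split
  into self-adjoint real and imaginary parts.  The sequence \<open>\<rho>\<^sub>r\<close> is obtained by approximating \<open>T\<close> on the first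
  \<open>r\<close> members of a dense sequence of \<open>S\<close>, all maps involved being uniformly bounded.
\<close>

section \<open>Composition of bounded operators\<close>

notation blinfun_compose (infixl "\<cdot>" 70)

lemma blinfun_compose_assoc: "(a \<cdot> b) \<cdot> c = a \<cdot> (b \<cdot> c)"
  by (rule blinfun_eqI) simp

lemma blinfun_compose_id [simp]: "id_blinfun \<cdot> a = a" "a \<cdot> id_blinfun = a"
  by (auto intro: blinfun_eqI)

lemmas compose_algebra =
  blinfun_compose_assoc
  bounded_bilinear.add_left[OF bounded_bilinear_blinfun_compose]
  bounded_bilinear.add_right[OF bounded_bilinear_blinfun_compose]
  bounded_bilinear.diff_left[OF bounded_bilinear_blinfun_compose]
  bounded_bilinear.diff_right[OF bounded_bilinear_blinfun_compose]
  bounded_bilinear.minus_left[OF bounded_bilinear_blinfun_compose]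
  bounded_bilinear.minus_right[OF bounded_bilinear_blinfun_compose]
  bounded_bilinear.scaleR_left[OF bounded_bilinear_blinfun_compose]
  bounded_bilinear.scaleR_right[OF bounded_bilinear_blinfun_compose]

lemmas compose_sum_left = bounded_bilinear.sum_left[OF bounded_bilinear_blinfun_compose]
lemmas compose_sum_right = bounded_bilinear.sum_right[OF bounded_bilinear_blinfun_compose]

lemma blinfun_apply_sum: "blinfun_apply (\<Sum>i\<in>I. f i) x = (\<Sum>i\<in>I. blinfun_apply (f i) x)"
  by (rule blinfun.sum_left)

section \<open>Real adjoints of operators on a Hilbert space\<close>

text \<open>
  A minimiser \<open>z\<close> of the functional \<open>\<langle>x, x\<rangle> - 2 f x\<close> represents \<open>f\<close>; it exists by completeness.
\<close>

lemma riesz_representation: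
  fixes f :: "'a :: {real_inner, complete_space} \<Rightarrow> real"
  assumes f: "bounded_linear f"
  shows "\<exists>z. \<forall>x. f x = inner x z"
proof -
  interpret f: bounded_linear f by (rule f)
  define J where "J x = inner x x - 2 * f x" for x
  obtain K where K: "\<And>x. norm (f x) \<le> norm x * K" using f.bounded by blast
  have low: "- K\<^sup>2 \<le> J x" for x
  proof -
    have "f x \<le> norm x * K" using K[of x] by simp
    moreover have "2 * (norm x * K) \<le> (norm x)\<^sup>2 + K\<^sup>2"
      using sum_squares_bound[of "norm x" K] by (simp add: mult.assoc)
    ultimately show ?thesis by (simp add: J_def power2_norm_eq_inner)
  qed
  define m where "m = (INF x. J x)"
  have bdd: "bdd_below (range J)" using low by (auto intro!: bdd_belowI)
  have mle: "m \<le> J x" for x unfolding m_def using bdd by (rule cINF_lower) simp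
  have "\<exists>x. J x < m + 1 / real (Suc n)" for n
  proof -
    have "(INF x. J x) < m + 1 / real (Suc n)" by (simp add: m_def)
    then show ?thesis using cINF_less_iff[OF _ bdd, of "m + 1 / real (Suc n)"] by auto
  qed
  then obtain X where X: "\<And>n. J (X n) < m + 1 / real (Suc n)" by metis
  \<comment> \<open>By the parallelogram law a minimising sequence of a quadratic functional is Cauchy.\<close>
  have par: "(norm (X n - X k))\<^sup>2 \<le> 2 / real (Suc n) + 2 / real (Suc k)" for n k
  proof -
    define a b where "a = 1 / real (Suc n)" and "b = 1 / real (Suc k)"
    have "inner (X n - X k) (X n - X k) = 2 * J (X n) + 2 * J (X k) - 4 * J ((1/2) *\<^sub>R (X n + X k))"
      unfolding J_def f.add f.scaleR inner_diff_left inner_diff_right inner_add_left inner_add_right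
        inner_scaleR_left inner_scaleR_right inner_commute[of "X k" "X n"]
      by (simp add: algebra_simps)
    also have "\<dots> \<le> 2 * (m + a) + 2 * (m + b) - 4 * m"
    proof -
      have "2 * r + 2 * s - 4 * t \<le> 2 * (m + a) + 2 * (m + b) - 4 * m"
        if "r < m + a" "s < m + b" "m \<le> t" for r s t using that by simp
      then show ?thesis using X[of n, folded a_def] X[of k, folded b_def] mle by blast
    qed
    also have "\<dots> = 2 / real (Suc n) + 2 / real (Suc k)" by (simp add: a_def b_def)
    finally show ?thesis by (simp only: power2_norm_eq_inner)
  qed
  have "Cauchy X"
  proof (rule CauchyI)
    fix e :: real assume e: "0 < e"
    obtain N where N: "inverse (real (Suc N)) < e\<^sup>2 / 4"
      using reals_Archimedean[of "e\<^sup>2/4"] e by auto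
    show "\<exists>M. \<forall>m\<ge>M. \<forall>n\<ge>M. norm (X m - X n) < e"
    proof (intro exI[of _ N] allI impI)
      fix n k assume "N \<le> n" "N \<le> k"
      then have "1 / real (Suc n) \<le> 1 / real (Suc N)" "1 / real (Suc k) \<le> 1 / real (Suc N)"
        by (simp_all add: frac_le)
      then have "(norm (X n - X k))\<^sup>2 < e\<^sup>2"
        using par[of n k] N by (simp add: inverse_eq_divide)
      then show "norm (X n - X k) < e" using e by (simp add: power2_less_imp_less)
    qed
  qed
  then obtain z where z: "X \<longlonglongrightarrow> z" by (auto simp: Cauchy_convergent_iff convergent_def)
  have "(\<lambda>n. J (X n)) \<longlonglongrightarrow> J z"
    unfolding J_def by (intro tendsto_intros z f.tendsto)
  moreover have "(\<lambda>n. m + 1 / real (Suc n)) \<longlonglongrightarrow> m + 0"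
    by (intro tendsto_intros LIMSEQ_Suc[OF lim_1_over_n])
  ultimately have Jz: "J z \<le> m"
    using LIMSEQ_le[of "\<lambda>n. J (X n)" "J z" "\<lambda>n. m + 1 / real (Suc n)"] X
    by (auto intro: less_imp_le)
  have "f x = inner x z" for x
  proof -
    define d where "d = inner x z - f x"
    define c where "c = inner x x"
    have quad: "0 \<le> 2 * t * d + t\<^sup>2 * c" for t
      using mle[of "z + t *\<^sub>R x"] Jz
      by (simp add: J_def f.add f.scaleR inner_add_left inner_add_right inner_commute[of x z] d_def c_def
          algebra_simps power2_eq_square)
    have c0: "0 \<le> c" by (simp add: c_def)
    \<comment> \<open>The parameter \<open>t = - d / (c + 1)\<close> minimises \<open>2 t d + t\<^sup>2 (c + 1)\<close>; the shift by \<open>1\<close> allows \<open>c = 0\<close>.\<close>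
    define e where "e = d / (c + 1)"
    have de: "d = e * (c + 1)" using c0 by (simp add: e_def)
    have "0 \<le> 2 * (- e) * d + (- e)\<^sup>2 * c" by (rule quad)
    also have "\<dots> = - (e\<^sup>2 * (c + 2))" unfolding de by (simp add: algebra_simps power2_eq_square)
    finally have "e\<^sup>2 * (c + 2) \<le> 0" by simp
    then have "e = 0" using c0 by (simp add: mult_le_0_iff)
    then have "d = 0" using de by simp
    then show ?thesis by (simp add: d_def)
  qed
  then show ?thesis by blast
qed

text \<open>
  The adjoint with respect to the real inner product exists for every bounded real linear operator, so
  that its calculus carries no side conditions.  On complex linear operators it is the usual adjoint.
\<close>

definition hadj :: "('a :: {real_inner, banach} \<Rightarrow>\<^sub>L 'a) \<Rightarrow> 'a \<Rightarrow>\<^sub>L 'a" where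
  "hadj A = (THE B. \<forall>x y. inner (blinfun_apply A x) y = inner x (blinfun_apply B y))"

lemma inner_eq_all_imp_eq: "(\<And>x. inner x y = inner x z) \<Longrightarrow> y = z"
  by (metis inner_eq_zero_iff inner_diff_right right_minus_eq)

lemma hadj_eqI:
  assumes "\<And>x y. inner (blinfun_apply A x) y = inner x (blinfun_apply B y)"
  shows "hadj A = B"
  unfolding hadj_def
proof (rule the_equality)
  show "\<forall>x y. inner (blinfun_apply A x) y = inner x (blinfun_apply B y)" using assms by blast
  fix C assume C: "\<forall>x y. inner (blinfun_apply A x) y = inner x (blinfun_apply C y)"
  show "C = B"
  proof (rule blinfun_eqI, rule inner_eq_all_imp_eq)
    show "inner x (C y) = inner x (B y)" for x y using C assms[of x y] by simp
  qed
qed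

lemma hadj_inner: "inner (blinfun_apply A x) y = inner x (blinfun_apply (hadj A) y)"
proof -
  have "\<exists>z. \<forall>x. inner (blinfun_apply A x) y = inner x z" for y
    by (intro riesz_representation bounded_linear_intros)
  then obtain g where g: "\<And>x y. inner (blinfun_apply A x) y = inner x (g y)" by metis
  have "bounded_linear g"
  proof (rule bounded_linear_intro)
    show "g (x + y) = g x + g y" for x y
      by (rule inner_eq_all_imp_eq) (simp add: g[symmetric] inner_add_right)
    show "g (r *\<^sub>R x) = r *\<^sub>R g x" for r x
      by (rule inner_eq_all_imp_eq) (simp add: g[symmetric])
    show "norm (g x) \<le> norm x * norm A" for x
    proof (cases "g x = 0")
      case False
      have "norm (g x) * norm (g x) = inner (blinfun_apply A (g x)) x"
        by (simp add: g power2_norm_eq_inner[symmetric] power2_eq_square)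
      also have "\<dots> \<le> norm (blinfun_apply A (g x)) * norm x" by (rule norm_cauchy_schwarz)
      also have "\<dots> \<le> norm A * norm (g x) * norm x" by (intro mult_right_mono norm_blinfun) simp
      finally show ?thesis using False by (simp add: mult.commute mult.left_commute)
    qed simp
  qed
  then have "blinfun_apply (Blinfun g) = g" by (rule bounded_linear_Blinfun_apply)
  then have "hadj A = Blinfun g" by (intro hadj_eqI) (simp add: g)
  with \<open>blinfun_apply (Blinfun g) = g\<close> show ?thesis by (simp add: g)
qed

lemma hadj_inner': "inner (blinfun_apply (hadj A) x) y = inner x (blinfun_apply A y)"
  using hadj_inner[of A y x] by (simp add: inner_commute)

lemma hadj_simps [simp]:
  shows "hadj (hadj A) = A" and "hadj (A \<cdot> B) = hadj B \<cdot> hadj A" and "hadj (A + B) = hadj A + hadj B"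
    and "hadj (A - B) = hadj A - hadj B" and "hadj (- A) = - hadj A" and "hadj (c *\<^sub>R A) = c *\<^sub>R hadj A"
    and "hadj id_blinfun = (id_blinfun :: 'z :: {real_inner, banach} \<Rightarrow>\<^sub>L 'z)"
    and "hadj 0 = (0 :: 'z \<Rightarrow>\<^sub>L 'z)"
proof -
  show "hadj (hadj A) = A" by (rule hadj_eqI) (rule hadj_inner')
  show "hadj (A \<cdot> B) = hadj B \<cdot> hadj A" by (rule hadj_eqI) (simp add: hadj_inner)
  show "hadj (A + B) = hadj A + hadj B"
    by (rule hadj_eqI) (simp add: blinfun.add_left inner_add_left inner_add_right hadj_inner)
  show "hadj (A - B) = hadj A - hadj B"
    by (rule hadj_eqI) (simp add: blinfun.diff_left inner_diff_left inner_diff_right hadj_inner)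
  show "hadj (- A) = - hadj A" by (rule hadj_eqI) (simp add: blinfun.minus_left hadj_inner)
  show "hadj (c *\<^sub>R A) = c *\<^sub>R hadj A" by (rule hadj_eqI) (simp add: blinfun.scaleR_left hadj_inner)
  show "hadj id_blinfun = (id_blinfun :: 'z :: {real_inner, banach} \<Rightarrow>\<^sub>L 'z)" by (rule hadj_eqI) simp
  show "hadj 0 = (0 :: 'z :: {real_inner, banach} \<Rightarrow>\<^sub>L 'z)" by (rule hadj_eqI) simp
qed

lemma hadj_sum [simp]: "hadj (\<Sum>i\<in>I. f i) = (\<Sum>i\<in>I. hadj (f i))"
  by (induction I rule: infinite_finite_induct) auto

lemma norm_hadj_le: "norm (hadj A) \<le> norm A"
proof (rule norm_blinfun_bound)
  fix x
  have "(norm (hadj A x))\<^sup>2 = inner (A (hadj A x)) x"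
    by (simp add: hadj_inner power2_norm_eq_inner)
  also have "\<dots> \<le> norm (A (hadj A x)) * norm x" by (rule norm_cauchy_schwarz)
  also have "\<dots> \<le> norm A * norm (hadj A x) * norm x" by (intro mult_right_mono norm_blinfun) simp
  finally show "norm (hadj A x) \<le> norm A * norm x"
    by (cases "hadj A x = 0") (auto simp: power2_eq_square mult.commute mult.left_commute)
qed simp

lemma bounded_linear_hadj: "bounded_linear hadj"
  by (rule bounded_linear_intro[where K = 1]) (simp_all add: norm_hadj_le)

lemma norm_hadj_sq:
  fixes A :: "'a :: {real_inner, banach} \<Rightarrow>\<^sub>L 'a"
  shows "(norm (A x))\<^sup>2 = inner ((hadj A \<cdot> A) x) x"
  by (simp add: hadj_inner' power2_norm_eq_inner)

lemma hadj_compose_self_eq_0: "hadj A \<cdot> A = 0 \<Longrightarrow> A = 0"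
  using norm_hadj_sq[of A] by (intro blinfun_eqI) simp

section \<open>Positive operators and projections\<close>

definition psd :: "('a :: {real_inner, banach} \<Rightarrow>\<^sub>L 'a) \<Rightarrow> bool" where
  "psd A \<longleftrightarrow> hadj A = A \<and> (\<forall>x. 0 \<le> inner (A x) x)"

lemma psdD: "psd A \<Longrightarrow> 0 \<le> inner (A x) x" "psd A \<Longrightarrow> hadj A = A"
  by (auto simp: psd_def)

lemma psd_add: "psd A \<Longrightarrow> psd B \<Longrightarrow> psd (A + B)"
  by (simp add: psd_def blinfun.bilinear_simps inner_add_left)

lemma psd_scaleR: "0 \<le> c \<Longrightarrow> psd A \<Longrightarrow> psd (c *\<^sub>R A)"
  by (simp add: psd_def blinfun.bilinear_simps)

lemma psd_hadj_self: "psd (hadj A \<cdot> A)"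
  by (simp add: psd_def hadj_inner')

lemma psd_conj: "psd A \<Longrightarrow> psd (U \<cdot> A \<cdot> hadj U)"
  by (simp add: psd_def blinfun_compose_assoc hadj_inner[of U])

lemma psd_0 [simp]: "psd 0" by (simp add: psd_def)

lemma psd_sum: "(\<And>i. i \<in> I \<Longrightarrow> psd (f i)) \<Longrightarrow> psd (\<Sum>i\<in>I. f i)"
  by (induction I rule: infinite_finite_induct) (auto intro: psd_add)

text \<open>
  Polarisation: \<open>4 \<langle>A x, y\<rangle>\<close> is the difference of the quadratic form at \<open>x + y\<close> and at \<open>x - y\<close>, and the
  parallelogram law bounds it by \<open>4 c \<parallel>x\<parallel>\<^sup>2\<close> when \<open>y\<close> is the multiple of \<open>A x\<close> of norm \<open>\<parallel>x\<parallel>\<close>.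
\<close>

lemma norm_hermitian_le:
  fixes A :: "'a :: {real_inner, banach} \<Rightarrow>\<^sub>L 'a"
  assumes sym: "hadj A = A" and b: "\<And>x. \<bar>inner (A x) x\<bar> \<le> c * (norm x)\<^sup>2" and c: "0 \<le> c"
  shows "norm A \<le> c"
proof (rule norm_blinfun_bound[OF c])
  fix x
  show "norm (A x) \<le> c * norm x"
  proof (cases "A x = 0 \<or> x = 0")
    case True
    then show ?thesis using c by auto
  next
    case False
    define y where "y = (norm x / norm (A x)) *\<^sub>R A x"
    have ny: "norm y = norm x" using False by (simp add: y_def)
    have "4 * inner (A x) y = inner (A (x + y)) (x + y) - inner (A (x - y)) (x - y)"
    proof -
      have "inner (A y) x = inner (A x) y"
        using hadj_inner[of A x y] sym inner_commute[of x "A y"] by simp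
      then show ?thesis
        by (simp add: blinfun.bilinear_simps inner_add_left inner_add_right inner_diff_left
          inner_diff_right)
    qed
    also have "\<dots> \<le> c * (norm (x + y))\<^sup>2 + c * (norm (x - y))\<^sup>2"
      using b[of "x + y"] b[of "x - y"] by linarith
    also have "\<dots> = c * (2 * (norm x)\<^sup>2 + 2 * (norm y)\<^sup>2)"
      by (simp add: power2_norm_eq_inner inner_add_left inner_add_right inner_diff_left
          inner_diff_right inner_commute[of y x] algebra_simps)
    finally have "4 * inner (A x) y \<le> 4 * c * (norm x)\<^sup>2" using ny by simp
    moreover have "inner (A x) y = norm x * norm (A x)"
      using False by (simp add: y_def power2_norm_eq_inner[symmetric] power2_eq_square)
    ultimately have "norm x * norm (A x) \<le> norm x * (c * norm x)"
      by (simp add: power2_eq_square mult.commute mult.left_commute)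
    then show ?thesis using False by (simp add: mult_le_cancel_left)
  qed
qed

lemma norm_hermitian_le_psd:
  assumes "psd (c *\<^sub>R id_blinfun - A)" "psd (c *\<^sub>R id_blinfun + A)" "0 \<le> c"
  shows "norm A \<le> c"
proof (rule norm_hermitian_le)
  show "hadj A = A" using psdD(2)[OF assms(2)] by simp
  show "\<bar>inner (A x) x\<bar> \<le> c * (norm x)\<^sup>2" for x
    using psdD(1)[OF assms(1), of x] psdD(1)[OF assms(2), of x]
    by (simp add: blinfun.bilinear_simps inner_diff_left inner_add_left power2_norm_eq_inner)
qed fact

lemma inner_le_norm:
  fixes A :: "'a :: {real_inner, banach} \<Rightarrow>\<^sub>L 'a"
  shows "\<bar>inner (A x) x\<bar> \<le> norm A * (norm x)\<^sup>2"
  using Cauchy_Schwarz_ineq2[of "A x" x] mult_right_mono[OF norm_blinfun[of A x], of "norm x"]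
  by (simp add: power2_eq_square mult.assoc)

lemma psd_norm_minus:
  assumes "hadj A = A" "norm A \<le> c"
  shows "psd (c *\<^sub>R id_blinfun - A)" "psd (c *\<^sub>R id_blinfun + A)"
proof -
  have "\<bar>inner (A x) x\<bar> \<le> c * inner x x" for x
    using inner_le_norm[of A x] mult_right_mono[OF assms(2), of "(norm x)\<^sup>2"]
    by (simp add: power2_norm_eq_inner)
  note b = this
  have "inner (A x) x \<le> c * inner x x" "0 \<le> c * inner x x + inner (A x) x" for x
    using b[of x] by (simp_all add: abs_le_iff)
  then show "psd (c *\<^sub>R id_blinfun - A)" "psd (c *\<^sub>R id_blinfun + A)"
    using assms(1) by (simp_all add: psd_def blinfun.bilinear_simps inner_diff_left inner_add_left)
qed

abbreviation is_unitary :: "('a :: {real_inner, banach} \<Rightarrow>\<^sub>L 'a) \<Rightarrow> bool" where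
  "is_unitary u \<equiv> hadj u \<cdot> u = id_blinfun \<and> u \<cdot> hadj u = id_blinfun"

definition is_proj :: "('a :: {real_inner, banach} \<Rightarrow>\<^sub>L 'a) \<Rightarrow> bool" where
  "is_proj p \<longleftrightarrow> p \<cdot> p = p \<and> hadj p = p"

lemma is_projD: "is_proj p \<Longrightarrow> p \<cdot> p = p" "is_proj p \<Longrightarrow> hadj p = p"
  by (auto simp: is_proj_def)

lemma is_proj_assoc: "is_proj p \<Longrightarrow> p \<cdot> (p \<cdot> x) = p \<cdot> x"
  by (metis blinfun_compose_assoc is_projD(1))

lemma proj_inner: "is_proj p \<Longrightarrow> inner (p x) x = (norm (p x))\<^sup>2"
  using norm_hadj_sq[of p x] by (simp add: is_proj_def)

lemma psd_proj: "is_proj p \<Longrightarrow> psd p"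
  by (simp add: psd_def proj_inner is_projD)

lemma is_proj_id [simp]: "is_proj id_blinfun" and is_proj_0 [simp]: "is_proj 0"
  by (simp_all add: is_proj_def)

lemma proj_sub_commute: "is_proj p \<Longrightarrow> is_proj q \<Longrightarrow> p \<cdot> q = q \<Longrightarrow> q \<cdot> p = q"
  by (metis hadj_simps(2) is_proj_def)

lemma is_proj_diff:
  assumes "is_proj p" "is_proj q" "p \<cdot> q = q"
  shows "is_proj (p - q)"
  using assms proj_sub_commute[OF assms] by (simp add: is_proj_def compose_algebra)

lemma is_proj_minus_id: "is_proj p \<Longrightarrow> is_proj (id_blinfun - p)"
  by (simp add: is_proj_diff)

lemma is_proj_add:
  assumes "is_proj p" "is_proj q" "p \<cdot> q = 0"
  shows "is_proj (p + q)"
proof -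
  have "q \<cdot> p = 0" using assms by (metis hadj_simps(2,8) is_proj_def)
  then show ?thesis using assms by (simp add: is_proj_def compose_algebra)
qed

lemma proj_orth_commute: "is_proj p \<Longrightarrow> is_proj q \<Longrightarrow> p \<cdot> q = 0 \<Longrightarrow> q \<cdot> p = 0"
  by (metis hadj_simps(2,8) is_proj_def)

lemma is_proj_sum:
  assumes "finite I" "\<And>i. i \<in> I \<Longrightarrow> is_proj (f i)"
    "\<And>i j. i \<in> I \<Longrightarrow> j \<in> I \<Longrightarrow> i \<noteq> j \<Longrightarrow> f i \<cdot> f j = 0"
  shows "is_proj (\<Sum>i\<in>I. f i)"
  using assms
proof (induction I)
  case (insert i I)
  have "f i \<cdot> (\<Sum>i\<in>I. f i) = 0" 
    unfolding compose_sum_right using insert by (intro sum.neutral) auto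
  then show ?case using insert by (auto intro!: is_proj_add)
qed simp

lemma proj_norm_le: "is_proj p \<Longrightarrow> norm (p x) \<le> norm x"
proof -
  assume p: "is_proj p"
  have "(norm (p x))\<^sup>2 \<le> norm (p x) * norm x"
    using norm_cauchy_schwarz[of "p x" x] by (simp add: proj_inner[OF p])
  then show ?thesis by (cases "p x = 0") (auto simp: power2_eq_square)
qed

lemma norm_proj_le: "is_proj p \<Longrightarrow> norm p \<le> 1"
  by (rule norm_blinfun_bound) (auto simp: proj_norm_le)

text \<open>
  On the kernel of \<open>p\<close> the quadratic form of \<open>p - q\<close> is \<open>- \<parallel>q y\<parallel>\<^sup>2\<close>, so \<open>q\<close> vanishes there.
\<close>

lemma proj_hereditary:
  assumes p: "is_proj p" and q: "is_proj q" and "psd (p - q)"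
  shows "p \<cdot> q = q"
proof -
  have "q \<cdot> (id_blinfun - p) = 0"
  proof (rule blinfun_eqI)
    fix x
    define y where "y = (id_blinfun - p) x"
    have "p y = 0" unfolding y_def
      by (metis blinfun_apply_blinfun_compose blinfun.zero_left blinfun_compose_id(2) cancel_comm_monoid_add_class.diff_cancel
          compose_algebra(5) is_projD(1) p)
    then have "(norm (q y))\<^sup>2 \<le> 0"
      using psdD(1)[OF assms(3), of y]
      by (simp add: blinfun.bilinear_simps proj_inner[OF q, symmetric])
    then show "(q \<cdot> (id_blinfun - p)) x = blinfun_apply 0 x" by (simp add: y_def)
  qed
  then have "q \<cdot> p = q" by (simp add: compose_algebra)
  then show ?thesis using p q by (metis hadj_simps(2) is_proj_def)
qed

section \<open>Strongly closed operator algebras\<close>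

lemma strong_limit_blinfun:
  fixes f :: "nat \<Rightarrow> 'a :: real_normed_vector \<Rightarrow>\<^sub>L 'b :: real_normed_vector"
  assumes C: "\<And>n. norm (f n) \<le> C" and conv: "\<And>x. convergent (\<lambda>n. f n x)"
  obtains g where "\<And>x. (\<lambda>n. f n x) \<longlonglongrightarrow> blinfun_apply g x" "norm g \<le> C"
proof -
  define G where "G x = lim (\<lambda>n. f n x)" for x
  have lim: "(\<lambda>n. f n x) \<longlonglongrightarrow> G x" for x
    using conv[of x] by (simp add: G_def convergent_LIMSEQ_iff)
  have bnd: "norm (G x) \<le> norm x * C" for x
  proof (rule Lim_bounded[OF tendsto_norm[OF lim]])
    show "\<forall>n\<ge>0. norm (f n x) \<le> norm x * C"
      proof (intro allI impI)
      fix n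
      have "norm (f n) * norm x \<le> C * norm x" by (intro mult_right_mono C) simp
      then show "norm (f n x) \<le> norm x * C" using norm_blinfun[of "f n" x] by (simp add: mult.commute)
    qed
  qed
  have "bounded_linear G"
  proof (rule bounded_linear_intro[OF _ _ bnd])
    show "G (x + y) = G x + G y" for x y
      using LIMSEQ_unique[OF lim[of "x + y"]] tendsto_add[OF lim[of x] lim[of y]]
      by (simp add: blinfun.add_right)
    show "G (r *\<^sub>R x) = r *\<^sub>R G x" for r x
      using LIMSEQ_unique[OF lim[of "r *\<^sub>R x"]] tendsto_scaleR[OF tendsto_const lim[of x], of r]
      by (simp add: blinfun.scaleR_right)
  qed
  then have a: "blinfun_apply (Blinfun G) = G" by (rule bounded_linear_Blinfun_apply)
  have "0 \<le> C" using C[of 0] norm_ge_zero order_trans by blast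
  show thesis
  proof (rule that)
    show "(\<lambda>n. f n x) \<longlonglongrightarrow> Blinfun G x" for x by (simp add: a lim)
    show "norm (Blinfun G) \<le> C"
      using bnd by (intro norm_blinfun_bound \<open>0 \<le> C\<close>) (simp add: a mult.commute)
  qed
qed

lemma strong_limit_compose:
  fixes f :: "nat \<Rightarrow> 'b :: real_normed_vector \<Rightarrow>\<^sub>L 'c :: real_normed_vector"
    and g :: "nat \<Rightarrow> 'a :: real_normed_vector \<Rightarrow>\<^sub>L 'b"
  assumes f: "\<And>x. (\<lambda>n. f n x) \<longlonglongrightarrow> blinfun_apply F x" and g: "\<And>x. (\<lambda>n. g n x) \<longlonglongrightarrow> blinfun_apply G x"
    and C: "\<And>n. norm (f n) \<le> C"
  shows "(\<lambda>n. (f n o\<^sub>L g n) x) \<longlonglongrightarrow> (F o\<^sub>L G) x"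
proof -
  have lim: "(\<lambda>n. C * norm (g n x - G x)) \<longlonglongrightarrow> 0"
    by (intro tendsto_mult_right_zero tendsto_norm_zero) (rule LIM_zero[OF g])
  have "\<forall>n. norm (f n (g n x - G x)) \<le> C * norm (g n x - G x)"
    by (intro allI order_trans[OF norm_blinfun mult_right_mono[OF C]]) simp
  then have "(\<lambda>n. f n (g n x - G x)) \<longlonglongrightarrow> 0"
    by (rule Lim_null_comparison[OF always_eventually lim])
  from tendsto_add[OF this f[of "G x"]] show ?thesis by (simp add: blinfun.diff_right)
qed

lemma strong_limit_hadj:
  fixes f :: "nat \<Rightarrow> 'a :: {real_inner, banach} \<Rightarrow>\<^sub>L 'a"
  assumes f: "\<And>x. (\<lambda>n. f n x) \<longlonglongrightarrow> blinfun_apply F x" and g: "\<And>x. (\<lambda>n. hadj (f n) x) \<longlonglongrightarrow> blinfun_apply G x"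
  shows "hadj F = G"
proof (rule hadj_eqI)
  fix x y
  have "(\<lambda>n. inner (f n x) y) \<longlonglongrightarrow> inner (F x) y" by (intro tendsto_intros f)
  moreover have "(\<lambda>n. inner (f n x) y) \<longlonglongrightarrow> inner x (G y)"
    unfolding hadj_inner by (intro tendsto_intros g)
  ultimately show "inner (F x) y = inner x (G y)" by (rule LIMSEQ_unique)
qed

lemma strong_limit_unique:
  assumes "\<And>x. (\<lambda>n. blinfun_apply (f n) x) \<longlonglongrightarrow> blinfun_apply F x" "\<And>x. (\<lambda>n. blinfun_apply (f n) x) \<longlonglongrightarrow> blinfun_apply G x"
  shows "F = G"
  using assms by (intro blinfun_eqI) (blast intro: LIMSEQ_unique)

lemma norm_limit_strong_limit:
  assumes "f \<longlonglongrightarrow> F" shows "(\<lambda>n. blinfun_apply (f n) x) \<longlonglongrightarrow> blinfun_apply F x"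
  by (intro tendsto_intros assms)

text \<open>
  Closure under strong limits of sequences suffices for all constructions below, and for a von Neumann
  algebra it follows from closure in the strong operator topology.
\<close>

locale strongly_closed_algebra =
  fixes N :: "('a :: {real_inner, banach} \<Rightarrow>\<^sub>L 'a) set"
  assumes id_mem: "id_blinfun \<in> N"
    and add_mem: "a \<in> N \<Longrightarrow> b \<in> N \<Longrightarrow> a + b \<in> N"
    and scaleR_mem: "a \<in> N \<Longrightarrow> c *\<^sub>R a \<in> N"
    and compose_mem: "a \<in> N \<Longrightarrow> b \<in> N \<Longrightarrow> a \<cdot> b \<in> N"
    and strong_limit_mem: "(\<And>n. f n \<in> N) \<Longrightarrow> (\<And>x. (\<lambda>n. blinfun_apply (f n) x) \<longlonglongrightarrow> blinfun_apply g x) \<Longrightarrow> g \<in> N"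
begin

lemma minus_mem: "a \<in> N \<Longrightarrow> - a \<in> N"
  using scaleR_mem[of a "-1"] by simp

lemma diff_mem: "a \<in> N \<Longrightarrow> b \<in> N \<Longrightarrow> a - b \<in> N"
  using add_mem[of a "- b"] minus_mem[of b] by simp

lemma zero_mem: "0 \<in> N"
  using scaleR_mem[OF id_mem, of 0] by simp

lemma sum_mem: "(\<And>i. i \<in> I \<Longrightarrow> f i \<in> N) \<Longrightarrow> (\<Sum>i\<in>I. f i) \<in> N"
  by (induction I rule: infinite_finite_induct) (auto intro: zero_mem add_mem)

lemmas mem = id_mem add_mem scaleR_mem compose_mem minus_mem diff_mem zero_mem sum_mem

lemma closed_N: "closed N"
  unfolding closed_sequential_limits
  by (auto intro: strong_limit_mem norm_limit_strong_limit)

lemma limit_mem: "(\<And>n. f n \<in> N) \<Longrightarrow> f \<longlonglongrightarrow> g \<Longrightarrow> g \<in> N"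
  by (rule strong_limit_mem[OF _ norm_limit_strong_limit])

text \<open>
  The projection onto the kernel of \<open>x\<close> is the strong limit of \<open>c\<^sup>2\<^sup>n\<close> for the contraction \<open>c = 1 - x\<^sup>2\<close>.  Since
  \<open>c\<close> is self-adjoint, \<open>\<langle>c\<^sup>i h, c\<^sup>j h\<rangle>\<close> depends only on \<open>i + j\<close>, and the decreasing sequence \<open>\<parallel>c\<^sup>n h\<parallel>\<^sup>2\<close> controls
  all distances between the \<open>c\<^sup>2\<^sup>n h\<close>.  The sequence \<open>w\<close> records that the complementary projection is a strong limit
  of elements of the right ideal generated by \<open>x\<close>, which is how it is located in ideals and annihilators.
\<close>

lemma kernel_projection_contraction:
  assumes x: "x \<in> N" "hadj x = x" "norm x \<le> 1"
  obtains e w where "e \<in> N" "is_proj e" "x \<cdot> e = 0" "\<And>h. blinfun_apply x h = 0 \<Longrightarrow> blinfun_apply e h = h"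
    "\<And>n. w n \<in> N" "\<And>h. (\<lambda>n. (x \<cdot> w n) h) \<longlonglongrightarrow> h - e h"
proof -
  define c where "c = id_blinfun - x \<cdot> x"
  have c_sym: "hadj c = c" by (simp add: c_def x)
  have cN: "c \<in> N" using x by (auto simp: c_def intro: mem)
  have norm_c: "(norm (c h))\<^sup>2 \<le> (norm h)\<^sup>2 - (norm (x h))\<^sup>2" for h
  proof -
    have "inner (x (x h)) h = inner (x h) (x h)" using hadj_inner[of x "x h" h] x by simp
    then have "(norm (c h))\<^sup>2 = (norm h)\<^sup>2 - 2 * (norm (x h))\<^sup>2 + (norm (x (x h)))\<^sup>2"
      by (simp add: c_def blinfun.bilinear_simps power2_norm_eq_inner inner_diff_left inner_diff_right
          inner_commute[of h "x (x h)"])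
    moreover have "norm (x (x h)) \<le> norm (x h)"
      using norm_blinfun[of x "x h"] mult_right_mono[OF x(3), of "norm (x h)"] by simp
    then have "(norm (x (x h)))\<^sup>2 \<le> (norm (x h))\<^sup>2" by (simp add: power_mono)
    ultimately show ?thesis by linarith
  qed
  have c_le: "norm (c h) \<le> norm h" for h
  proof (rule power2_le_imp_le)
    show "(norm (c h))\<^sup>2 \<le> (norm h)\<^sup>2" using norm_c[of h] zero_le_power2[of "norm (x h)"] by linarith
  qed simp
  have c_fix: "x h = 0" if "c (c h) = h" for h
  proof -
    have "norm (c h) = norm h" using c_le[of h] c_le[of "c h"] that by simp
    then have "(norm (x h))\<^sup>2 \<le> 0" using norm_c[of h] by simp
    then show ?thesis by simp
  qed
  define P where "P n = ((\<cdot>) c ^^ n) id_blinfun" for n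
  have P0: "P 0 = id_blinfun" and PS: "P (Suc n) = c \<cdot> P n" for n by (simp_all add: P_def)
  have Padd: "P (m + n) = P m \<cdot> P n" for m n
    by (induction m) (simp_all add: P0 PS blinfun_compose_assoc)
  have P_sym: "hadj (P n) = P n" for n
  proof (induction n)
    case (Suc n)
    have "P (Suc n) = P n \<cdot> c" using Padd[of n 1] by (simp add: P0 PS)
    then show ?case using Suc c_sym by (simp add: PS)
  qed (simp add: P0)
  have PN: "P n \<in> N" for n by (induction n) (auto simp: P0 PS intro: mem cN)
  have P_le: "norm (P n h) \<le> norm h" for n h
  proof (induction n)
    case (Suc n)
    then show ?case using c_le[of "P n h"] by (simp add: PS)
  qed (simp add: P0)
  have inner_P: "inner (P m h) (P n h) = inner (P (m + n) h) h" for m n h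
    using hadj_inner[of "P m" "P n h" h] hadj_inner[of "P n" h "P m h"] P_sym
    by (simp add: Padd inner_commute)
  define a where "a h n = (norm (P n h))\<^sup>2" for h n
  have a_conv: "convergent (a h)" for h
  proof -
    have "decseq (a h)" unfolding decseq_Suc_iff using c_le by (simp add: a_def PS power_mono)
    moreover have "\<forall>n. 0 \<le> a h n" by (simp add: a_def)
    ultimately obtain L where "a h \<longlonglongrightarrow> L" by (rule decseq_convergent)
    then show ?thesis by (auto simp: convergent_def)
  qed
  have a_diff: "(norm (P (2*n) h - P (2*m) h))\<^sup>2 = a h (2*n) - 2 * a h (n + m) + a h (2*m)" for n m h
  proof -
    have "inner (P (2*n) h) (P (2*m) h) = a h (n + m)"
    proof -
      have "2 * n + 2 * m = (n + m) + (n + m)" by simp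
      then show ?thesis unfolding a_def power2_norm_eq_inner inner_P by (simp only:)
    qed
    then show ?thesis
      by (simp add: a_def power2_norm_eq_inner inner_diff_left inner_diff_right
          inner_commute[of "P (2*m) h" "P (2*n) h"])
  qed
  have "Cauchy (\<lambda>n. P (2*n) h)" for h
  proof (rule CauchyI)
    fix e :: real assume e: "0 < e"
    obtain L where L: "a h \<longlonglongrightarrow> L" using a_conv by (auto simp: convergent_def)
    then obtain k where k: "\<And>n. n \<ge> k \<Longrightarrow> \<bar>a h n - L\<bar> < e\<^sup>2 / 4"
      using e unfolding LIMSEQ_def dist_real_def by (metis divide_pos_pos zero_less_numeral zero_less_power)
    show "\<exists>M. \<forall>m\<ge>M. \<forall>n\<ge>M. norm (P (2*m) h - P (2*n) h) < e"
    proof (intro exI[of _ k] allI impI)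
      fix m n assume "k \<le> m" "k \<le> n"
      then have "\<bar>a h (2*m) - L\<bar> < e\<^sup>2 / 4" "\<bar>a h (m + n) - L\<bar> < e\<^sup>2 / 4" "\<bar>a h (2*n) - L\<bar> < e\<^sup>2 / 4"
        using k by simp_all
      then have "(norm (P (2*m) h - P (2*n) h))\<^sup>2 < e\<^sup>2"
        unfolding a_diff by argo
      then show "norm (P (2*m) h - P (2*n) h) < e" using e by (simp add: power2_less_imp_less)
    qed
  qed
  then have "convergent (\<lambda>n. P (2*n) h)" for h by (simp add: Cauchy_convergent_iff)
  moreover have "norm (P (2*n)) \<le> 1" for n by (rule norm_blinfun_bound) (auto simp: P_le)
  ultimately obtain e where e: "\<And>h. (\<lambda>n. P (2*n) h) \<longlonglongrightarrow> blinfun_apply e h"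
    using strong_limit_blinfun[of "\<lambda>n. P (2*n)" 1] by metis
  have eN: "e \<in> N" by (rule strong_limit_mem[OF PN e])
  have ce: "c (c (e h)) = e h" for h
  proof (rule LIMSEQ_unique)
    show "(\<lambda>n. P (2 * Suc n) h) \<longlonglongrightarrow> e h" by (rule LIMSEQ_Suc[OF e])
    have "(\<lambda>n. c (c (P (2*n) h))) \<longlonglongrightarrow> c (c (e h))" by (intro tendsto_intros e)
    then show "(\<lambda>n. P (2 * Suc n) h) \<longlonglongrightarrow> c (c (e h))" by (simp add: PS)
  qed
  have fixed: "e h = h" if "x h = 0" for h
  proof -
    have ch: "c h = h" using that by (simp add: c_def blinfun.bilinear_simps)
    have "P n h = h" for n by (induction n) (simp_all add: P0 PS ch)
    then have "(\<lambda>n. P (2*n) h) \<longlonglongrightarrow> h" by simp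
    then show ?thesis by (rule LIMSEQ_unique[OF e])
  qed
  have xe: "x (e h) = 0" for h using ce c_fix by blast
  have "is_proj e"
    unfolding is_proj_def
  proof
    show "e \<cdot> e = e" by (rule blinfun_eqI) (simp add: fixed xe)
    show "hadj e = e" using strong_limit_hadj[OF e, of e] e P_sym by simp
  qed
  have "\<exists>w\<in>N. id_blinfun - P n = x \<cdot> w" for n
  proof (induction n)
    case (Suc n)
    then obtain w where "w \<in> N" "id_blinfun - P n = x \<cdot> w" by blast
    then show ?case using x PN
      by (intro bexI[of _ "w + x \<cdot> P n"]) (auto simp: PS c_def compose_algebra intro: mem)
  qed (auto simp: P0 intro!: bexI[of _ 0] mem)
  then obtain w where w: "\<And>n. w n \<in> N" "\<And>n. id_blinfun - P n = x \<cdot> w n" by metis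
  show thesis
  proof (rule that[of e "\<lambda>n. w (2*n)"])
    show "(\<lambda>n. (x \<cdot> w (2*n)) h) \<longlonglongrightarrow> h - e h" for h
      unfolding w(2)[symmetric] blinfun.diff_left blinfun_apply_id_blinfun id_apply
      by (intro tendsto_intros e)
  qed (use eN \<open>is_proj e\<close> xe fixed w in \<open>auto intro: blinfun_eqI\<close>)
qed

lemma kernel_projection:
  assumes x: "x \<in> N" "hadj x = x"
  obtains e w where "e \<in> N" "is_proj e" "x \<cdot> e = 0" "\<And>h. blinfun_apply x h = 0 \<Longrightarrow> blinfun_apply e h = h"
    "\<And>n. w n \<in> N" "\<And>h. (\<lambda>n. (x \<cdot> w n) h) \<longlonglongrightarrow> h - e h"
proof -
  define r where "r = 1 / (norm x + 1)"
  have r: "r > 0" by (simp add: r_def add_nonneg_pos)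
  have "norm (r *\<^sub>R x) = norm x / (norm x + 1)" by (simp add: r_def)
  also have "\<dots> \<le> 1" by (simp add: divide_le_eq add_nonneg_pos not_less)
  finally obtain e w where e: "e \<in> N" "is_proj e" "(r *\<^sub>R x) \<cdot> e = 0" "\<And>h. (r *\<^sub>R x) h = 0 \<Longrightarrow> blinfun_apply e h = h"
    "\<And>n. w n \<in> N" "\<And>h. (\<lambda>n. ((r *\<^sub>R x) \<cdot> w n) h) \<longlonglongrightarrow> h - e h"
    using kernel_projection_contraction[of "r *\<^sub>R x"] x by (auto intro: mem)
  show thesis
  proof (rule that[of e "\<lambda>n. r *\<^sub>R w n"])
    show "(\<lambda>n. (x \<cdot> (r *\<^sub>R w n)) h) \<longlonglongrightarrow> h - e h" for h
      using e(6)[of h] by (simp add: compose_algebra)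
  qed (use e r in \<open>auto simp: compose_algebra blinfun.scaleR_left intro: mem\<close>)
qed

text \<open>
  With \<open>x = 1 - k\<close>, a fixed point \<open>y\<close> of \<open>y \<mapsto> (x + y\<^sup>2) / 2\<close> satisfies \<open>(1 - y)\<^sup>2 = k\<close>.  This map is a contraction of
  the ball of radius \<open>\<rho> = 1 - sqrt (1 - r)\<close>, the smaller root of \<open>r + \<rho>\<^sup>2 = 2 \<rho>\<close>.
\<close>

lemma sqrt_near_id:
  assumes k: "k \<in> N" "hadj k = k" "norm (id_blinfun - k) \<le> r" "0 \<le> r" "r < 1"
  obtains s where "s \<in> N" "hadj s = s" "s \<cdot> s = k" "\<And>h. sqrt (1 - r) * (norm h)\<^sup>2 \<le> inner (blinfun_apply s h) h"
proof -
  define \<rho> where "\<rho> = 1 - sqrt (1 - r)"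
  have \<rho>: "0 \<le> \<rho>" "\<rho> < 1" "r + \<rho>\<^sup>2 = 2 * \<rho>"
    using k(4,5) by (auto simp: \<rho>_def power2_eq_square algebra_simps)
  define x where "x = id_blinfun - k"
  define f where "f y = (1/2) *\<^sub>R (x + y \<cdot> y)" for y
  define X where "X = {y \<in> N. hadj y = y \<and> norm y \<le> \<rho>}"
  have "\<exists>!y\<in>X. f y = y"
  proof (rule Banach_fix[of _ \<rho>])
    have "closed {y :: 'a \<Rightarrow>\<^sub>L 'a. hadj y = y}"
      using linear_continuous_on[OF bounded_linear_hadj]
      by (intro closed_Collect_eq continuous_on_id) auto
    moreover have "closed {y :: 'a \<Rightarrow>\<^sub>L 'a. norm y \<le> \<rho>}"
      by (intro closed_Collect_le continuous_intros)
    ultimately have "closed (N \<inter> ({y. hadj y = y} \<inter> {y. norm y \<le> \<rho>}))"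
      using closed_N by (intro closed_Int)
    moreover have "X = N \<inter> ({y. hadj y = y} \<inter> {y. norm y \<le> \<rho>})" by (auto simp: X_def)
    ultimately show "complete X" by (simp add: complete_eq_closed)
    show "X \<noteq> {}" using \<rho> by (auto simp: X_def intro!: exI[of _ 0] mem)
    show "f ` X \<subseteq> X"
    proof (intro image_subsetI)
      fix y assume y: "y \<in> X"
      have "norm (y \<cdot> y) \<le> \<rho>\<^sup>2"
        using norm_blinfun_compose[of y y] y mult_mono[of "norm y" \<rho> "norm y" \<rho>] \<rho>
        by (auto simp: X_def power2_eq_square)
      then have "norm (x + y \<cdot> y) \<le> 2 * \<rho>"
        using norm_triangle_ineq[of x "y \<cdot> y"] k(3) \<rho>(3) unfolding x_def by argo
      then show "f y \<in> X" using y k by (auto simp: X_def f_def x_def intro!: mem)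
    qed
    show "dist (f y) (f z) \<le> \<rho> * dist y z" if "y \<in> X" "z \<in> X" for y z
    proof -
      have "f y - f z = (1/2) *\<^sub>R (y \<cdot> (y - z) + (y - z) \<cdot> z)"
        by (simp add: f_def compose_algebra algebra_simps)
      moreover have "norm (y \<cdot> (y - z)) \<le> \<rho> * norm (y - z)"
        by (rule order_trans[OF norm_blinfun_compose mult_right_mono]) (use that in \<open>auto simp: X_def\<close>)
      moreover have "norm ((y - z) \<cdot> z) \<le> norm (y - z) * \<rho>"
        by (rule order_trans[OF norm_blinfun_compose mult_left_mono]) (use that in \<open>auto simp: X_def\<close>)
      ultimately show ?thesis
        using norm_triangle_ineq[of "y \<cdot> (y - z)" "(y - z) \<cdot> z"] by (simp add: dist_norm mult.commute)
    qed
  qed (use \<rho> in auto)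
  then obtain y where y: "y \<in> N" "hadj y = y" "norm y \<le> \<rho>" "f y = y" by (auto simp: X_def)
  have yy: "y \<cdot> y = 2 *\<^sub>R y - x"
  proof -
    have "2 *\<^sub>R f y = x + y \<cdot> y" by (simp add: f_def)
    then show ?thesis using y(4) by (simp add: algebra_simps)
  qed
  show thesis
  proof (rule that[of "id_blinfun - y"])
    show "(id_blinfun - y) \<cdot> (id_blinfun - y) = k"
      by (simp add: compose_algebra yy x_def scaleR_2)
    fix h
    have "inner (y h) h \<le> \<rho> * (norm h)\<^sup>2"
      using inner_le_norm[of y h] mult_right_mono[OF y(3), of "(norm h)\<^sup>2"] by simp
    then show "sqrt (1 - r) * (norm h)\<^sup>2 \<le> inner ((id_blinfun - y) h) h"
      by (simp add: blinfun.bilinear_simps inner_diff_left power2_norm_eq_inner \<rho>_def algebra_simps)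
  qed (use y in \<open>auto intro: mem\<close>)
qed

end

section \<open>Spectral projections\<close>

locale abelian_algebra = strongly_closed_algebra +
  assumes commute: "a \<in> N \<Longrightarrow> b \<in> N \<Longrightarrow> a \<cdot> b = b \<cdot> a"
begin

lemma left_commute: "a \<in> N \<Longrightarrow> b \<in> N \<Longrightarrow> a \<cdot> (b \<cdot> c) = b \<cdot> (a \<cdot> c)"
  by (metis blinfun_compose_assoc commute)

lemma hermitian_compose: "a \<in> N \<Longrightarrow> b \<in> N \<Longrightarrow> hadj a = a \<Longrightarrow> hadj b = b \<Longrightarrow> hadj (a \<cdot> b) = a \<cdot> b"
  using commute[of a b] by simp

text \<open>
  In a commutative algebra \<open>a e = e a e\<close>.
\<close>

lemma psd_compose_proj:
  assumes a: "a \<in> N" "psd a" and e: "e \<in> N" "is_proj e"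
  shows "psd (a \<cdot> e)"
proof -
  have "inner ((a \<cdot> e) x) x = inner (a (e x)) (e x)" for x
  proof -
    have "a \<cdot> e = e \<cdot> (a \<cdot> e)" using left_commute[OF a(1) e(1)] a e by (metis commute is_proj_assoc)
    then have "inner ((a \<cdot> e) x) x = inner (e (a (e x))) x" by (metis blinfun_apply_blinfun_compose)
    then show ?thesis using e by (simp add: hadj_inner is_projD)
  qed
  moreover have "hadj (a \<cdot> e) = a \<cdot> e" by (rule hermitian_compose) (use a e in \<open>auto simp: psdD is_projD\<close>)
  ultimately show ?thesis using psdD(1)[OF a(2)] by (simp add: psd_def)
qed

text \<open>
  Adding \<open>\<epsilon>\<close> keeps the operator away from \<open>0\<close>, so that the contraction argument for square roots applies.
\<close>

lemma sqrt_of_square_plus: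
  assumes a: "a \<in> N" "hadj a = a" "norm a \<le> 1/2" and \<epsilon>: "0 < \<epsilon>" "\<epsilon> \<le> 1/2"
  obtains s where "s \<in> N" "hadj s = s" "s \<cdot> s = a \<cdot> a + \<epsilon> *\<^sub>R id_blinfun"
    "\<And>h. sqrt \<epsilon> * (norm h)\<^sup>2 \<le> inner (blinfun_apply s h) h"
proof -
  define k where "k = a \<cdot> a + \<epsilon> *\<^sub>R id_blinfun"
  have "norm (id_blinfun - k) \<le> 1 - \<epsilon>"
  proof (rule norm_hermitian_le)
    show "hadj (id_blinfun - k) = id_blinfun - k" using a by (simp add: k_def)
    fix x
    have "inner (a (a x)) x = (norm (a x))\<^sup>2" using hadj_inner[of a "a x" x] a by (simp add: power2_norm_eq_inner)
    then have eq: "inner ((id_blinfun - k) x) x = (1 - \<epsilon>) * (norm x)\<^sup>2 - (norm (a x))\<^sup>2"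
      by (simp add: k_def blinfun.bilinear_simps inner_diff_left inner_add_left power2_norm_eq_inner algebra_simps)
    have "norm (a x) \<le> 1/2 * norm x"
      by (rule order_trans[OF norm_blinfun mult_right_mono[OF a(3)]]) simp
    then have "(norm (a x))\<^sup>2 \<le> (1/2 * norm x)\<^sup>2" by (rule power_mono) simp
    also have "\<dots> \<le> 1/2 * (norm x)\<^sup>2" by (simp add: power_mult_distrib power2_eq_square)
    also have "\<dots> \<le> (1 - \<epsilon>) * (norm x)\<^sup>2" using \<epsilon> by (intro mult_right_mono) auto
    finally show "\<bar>inner ((id_blinfun - k) x) x\<bar> \<le> (1 - \<epsilon>) * (norm x)\<^sup>2"
      unfolding eq by simp
  qed (use \<epsilon> in auto)
  moreover have "k \<in> N" "hadj k = k" using a by (auto simp: k_def intro: mem)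
  ultimately show thesis
    using sqrt_near_id[of k "1 - \<epsilon>"] that \<epsilon> by (auto simp: k_def)
qed

text \<open>
  The square roots \<open>s\<^sub>n\<close> of \<open>a\<^sup>2 + \<epsilon>\<^sub>n\<close> converge in norm: \<open>(s\<^sub>n + s\<^sub>m) (s\<^sub>n - s\<^sub>m) = \<epsilon>\<^sub>n - \<epsilon>\<^sub>m\<close> and
  \<open>s\<^sub>n + s\<^sub>m\<close> is bounded below by \<open>sqrt \<epsilon>\<^sub>n\<close>.
\<close>

lemma absolute_value:
  assumes a: "a \<in> N" "hadj a = a" "norm a \<le> 1/2"
  obtains s where "s \<in> N" "psd s" "s \<cdot> s = a \<cdot> a"
proof -
  define \<epsilon> where "\<epsilon> n = 1 / real (n + 2)" for n
  have \<epsilon>: "0 < \<epsilon> n" "\<epsilon> n \<le> 1/2" for n by (auto simp: \<epsilon>_def field_simps)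
  have \<epsilon>_mono: "\<epsilon> m \<le> \<epsilon> n" if "n \<le> m" for m n using that by (simp add: \<epsilon>_def frac_le)
  have \<epsilon>_lim: "\<epsilon> \<longlonglongrightarrow> 0"
    unfolding \<epsilon>_def using LIMSEQ_ignore_initial_segment[OF lim_1_over_n, of 2] by simp
  have "\<exists>s. s \<in> N \<and> hadj s = s \<and> s \<cdot> s = a \<cdot> a + \<epsilon> n *\<^sub>R id_blinfun \<and>
      (\<forall>h. sqrt (\<epsilon> n) * (norm h)\<^sup>2 \<le> inner (blinfun_apply s h) h)" for n
    using sqrt_of_square_plus[OF a \<epsilon>] by metis
  then obtain s where s: "\<And>n. s n \<in> N" "\<And>n. hadj (s n) = s n"
      "\<And>n. s n \<cdot> s n = a \<cdot> a + \<epsilon> n *\<^sub>R id_blinfun"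
      "\<And>n h. sqrt (\<epsilon> n) * (norm h)\<^sup>2 \<le> inner (blinfun_apply (s n) h) h"
    by metis
  have diff: "norm (s n - s m) \<le> sqrt (\<epsilon> n)" if "n \<le> m" for n m
  proof (rule norm_blinfun_bound)
    fix h
    define g where "g = (s n - s m) h"
    have "sqrt (\<epsilon> n) * (norm g)\<^sup>2 \<le> inner ((s n + s m) g) g"
    proof -
      have "0 \<le> sqrt (\<epsilon> m) * (norm g)\<^sup>2" using \<epsilon>[of m] by simp
      then show ?thesis using s(4)[of n g] s(4)[of m g]
        by (simp add: blinfun.bilinear_simps inner_add_left)
    qed
    also have "\<dots> \<le> norm ((s n + s m) g) * norm g" by (rule norm_cauchy_schwarz)
    finally have "sqrt (\<epsilon> n) * norm g \<le> norm ((s n + s m) g)"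
      by (cases "g = 0") (auto simp: power2_eq_square mult.assoc[symmetric])
    also have "(s n + s m) g = ((s n + s m) \<cdot> (s n - s m)) h" by (simp add: g_def)
    also have "(s n + s m) \<cdot> (s n - s m) = (\<epsilon> n - \<epsilon> m) *\<^sub>R id_blinfun"
      using commute[OF s(1)[of n] s(1)[of m]] by (simp add: compose_algebra s(3) algebra_simps)
    also have "norm (((\<epsilon> n - \<epsilon> m) *\<^sub>R id_blinfun) h) = (\<epsilon> n - \<epsilon> m) * norm h"
      using \<epsilon>_mono[OF that] by (simp add: blinfun.bilinear_simps)
    also have "\<dots> \<le> \<epsilon> n * norm h" using \<epsilon>[of m] by (intro mult_right_mono) auto
    also have "\<dots> = sqrt (\<epsilon> n) * (sqrt (\<epsilon> n) * norm h)" using \<epsilon>[of n] by simp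
    finally show "norm ((s n - s m) h) \<le> sqrt (\<epsilon> n) * norm h"
      using \<epsilon>[of n] by (simp add: g_def)
  qed (use \<epsilon>[of n] in simp)
  have "Cauchy s"
  proof (rule CauchyI')
    fix e :: real assume "0 < e"
    then have "\<forall>\<^sub>F n in sequentially. \<epsilon> n < e\<^sup>2"
      by (intro order_tendstoD(2)[OF \<epsilon>_lim]) simp
    then obtain k where "\<epsilon> k < e\<^sup>2" by (auto simp: eventually_sequentially)
    then have k: "sqrt (\<epsilon> k) < e" using \<open>0 < e\<close> real_sqrt_less_mono[of "\<epsilon> k" "e\<^sup>2"] by simp
    show "\<exists>M. \<forall>m\<ge>M. \<forall>n>m. dist (s m) (s n) < e"
    proof (intro exI[of _ k] allI impI)
      fix m n assume "k \<le> m" "m < n"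
      then have "norm (s m - s n) \<le> sqrt (\<epsilon> m)" by (intro diff) simp
      also have "\<dots> \<le> sqrt (\<epsilon> k)" using \<epsilon>_mono[OF \<open>k \<le> m\<close>] by simp
      finally show "dist (s m) (s n) < e" using k by (simp add: dist_norm)
    qed
  qed
  then obtain S where S: "s \<longlonglongrightarrow> S" by (auto simp: Cauchy_convergent_iff convergent_def)
  show thesis
  proof (rule that)
    show "S \<in> N" using limit_mem[OF s(1) S] .
    have "hadj S = S"
      using LIMSEQ_unique[OF bounded_linear.tendsto[OF bounded_linear_hadj S]] S s(2) by simp
    moreover have "0 \<le> inner (S h) h" for h
    proof (rule LIMSEQ_le_const)
      show "(\<lambda>n. inner (s n h) h) \<longlonglongrightarrow> inner (S h) h" by (intro tendsto_intros S)
      have "0 \<le> sqrt (\<epsilon> n) * (norm h)\<^sup>2" for n using \<epsilon>[of n] by simp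
      then show "\<exists>N. \<forall>n\<ge>N. 0 \<le> inner (s n h) h" using s(4)[of _ h] order_trans by blast
    qed
    ultimately show "psd S" by (simp add: psd_def)
    show "S \<cdot> S = a \<cdot> a"
    proof (rule LIMSEQ_unique)
      show "(\<lambda>n. s n \<cdot> s n) \<longlonglongrightarrow> S \<cdot> S"
        by (rule bounded_bilinear.tendsto[OF bounded_bilinear_blinfun_compose S S])
      show "(\<lambda>n. s n \<cdot> s n) \<longlonglongrightarrow> a \<cdot> a"
        unfolding s(3) using tendsto_add[OF tendsto_const[of "a \<cdot> a"] tendsto_scaleR[OF \<epsilon>_lim tendsto_const[of id_blinfun]]]
        by simp
    qed
  qed
qed

text \<open>
  Take for \<open>e\<close> the kernel projection of \<open>\<bar>a\<bar> - a\<close>.  On \<open>e\<close> we have \<open>a = \<bar>a\<bar>\<close>; the complement of \<open>e\<close> is approximated by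
  multiples of \<open>\<bar>a\<bar> - a\<close>, and \<open>(\<bar>a\<bar> + a) (\<bar>a\<bar> - a) = 0\<close>, so there \<open>a = - \<bar>a\<bar>\<close>.
\<close>

lemma spectral_projection_0:
  assumes a: "a \<in> N" "hadj a = a"
  obtains e where "e \<in> N" "is_proj e" "psd (a \<cdot> e)" "psd (- (a \<cdot> (id_blinfun - e)))"
proof -
  define r where "r = 1 / (2 * (norm a + 1))"
  have r: "r > 0" by (simp add: r_def add_nonneg_pos)
  define b where "b = r *\<^sub>R a"
  have b: "b \<in> N" "hadj b = b" using a by (auto simp: b_def intro: mem)
  have "norm b = norm a / (2 * (norm a + 1))" by (simp add: b_def r_def)
  also have "\<dots> \<le> 1/2" by (simp add: divide_le_eq add_nonneg_pos not_less)
  finally obtain s where s: "s \<in> N" "psd s" "s \<cdot> s = b \<cdot> b" using absolute_value b by metis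
  have "s - b \<in> N" "hadj (s - b) = s - b" using b s by (auto simp: psdD intro: mem)
  then obtain e w where e: "e \<in> N" "is_proj e" "(s - b) \<cdot> e = 0"
      and w: "\<And>n. w n \<in> N" "\<And>h. (\<lambda>n. ((s - b) \<cdot> w n) h) \<longlonglongrightarrow> h - e h"
    using kernel_projection by metis
  have be: "b \<cdot> e = s \<cdot> e" using e(3) by (simp add: compose_algebra)
  have zero: "(s + b) \<cdot> (id_blinfun - e) = 0"
  proof (rule blinfun_eqI)
    fix h
    have z: "(s + b) \<cdot> ((s - b) \<cdot> w n) = 0" for n
      using commute[OF s(1) b(1)] s(3)
      by (simp add: compose_algebra) (metis blinfun_compose_assoc diff_add_cancel cancel_comm_monoid_add_class.diff_cancel add_diff_cancel_left')
    have "(\<lambda>n. (s + b) (((s - b) \<cdot> w n) h)) \<longlonglongrightarrow> (s + b) (h - e h)"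
      by (intro tendsto_intros w)
    moreover have "(s + b) (((s - b) \<cdot> w n) h) = 0" for n
      using z[of n] by (metis blinfun_apply_blinfun_compose blinfun.zero_left)
    ultimately have "(s + b) (h - e h) = 0" by (simp add: LIMSEQ_const_iff)
    then show "((s + b) \<cdot> (id_blinfun - e)) h = blinfun_apply 0 h" by (simp add: blinfun.bilinear_simps)
  qed
  have bne: "- (b \<cdot> (id_blinfun - e)) = s \<cdot> (id_blinfun - e)"
    using zero by (simp add: compose_algebra algebra_simps eq_neg_iff_add_eq_0)
  have scale: "a = (1 / r) *\<^sub>R b" using r by (simp add: b_def)
  show thesis
  proof (rule that[OF e(1,2)])
    have "psd (s \<cdot> e)" using psd_compose_proj s e by blast
    then show "psd (a \<cdot> e)" using r by (simp add: scale compose_algebra be psd_scaleR)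
    have "psd (s \<cdot> (id_blinfun - e))" using s e by (intro psd_compose_proj is_proj_minus_id mem)
    then have "psd ((1/r) *\<^sub>R (s \<cdot> (id_blinfun - e)))" using r by (intro psd_scaleR) auto
    then show "psd (- (a \<cdot> (id_blinfun - e)))"
      unfolding bne[symmetric] scale by (simp add: compose_algebra algebra_simps)
  qed
qed

lemma spectral_projection:
  assumes a: "a \<in> N" "hadj a = a"
  obtains e where "e \<in> N" "is_proj e" "psd (a \<cdot> e - c *\<^sub>R e)"
    "psd (c *\<^sub>R (id_blinfun - e) - a \<cdot> (id_blinfun - e))"
proof -
  have "a - c *\<^sub>R id_blinfun \<in> N" "hadj (a - c *\<^sub>R id_blinfun) = a - c *\<^sub>R id_blinfun"
    using a by (auto intro: mem)
  then obtain e where "e \<in> N" "is_proj e" "psd ((a - c *\<^sub>R id_blinfun) \<cdot> e)"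
     "psd (- ((a - c *\<^sub>R id_blinfun) \<cdot> (id_blinfun - e)))"
    using spectral_projection_0 by blast
  then show thesis by (intro that[of e]) (simp_all add: compose_algebra algebra_simps)
qed

end

section \<open>Commuting self-adjoint operators and partitions of the unit\<close>

definition bicommutant_in ::
    "('a :: {real_inner, banach} \<Rightarrow>\<^sub>L 'a) set \<Rightarrow> ('a \<Rightarrow>\<^sub>L 'a) set \<Rightarrow> ('a \<Rightarrow>\<^sub>L 'a) set" where
  "bicommutant_in N B = {y \<in> N. \<forall>z. (\<forall>b\<in>B. z \<cdot> b = b \<cdot> z) \<longrightarrow> y \<cdot> z = z \<cdot> y}"

lemma (in strongly_closed_algebra) bicommutant_in_sub: "bicommutant_in N B \<subseteq> N"
  by (auto simp: bicommutant_in_def)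

lemma (in strongly_closed_algebra) sub_bicommutant_in: "B \<subseteq> N \<Longrightarrow> B \<subseteq> bicommutant_in N B"
  by (auto simp: bicommutant_in_def)

text \<open>
  The bicommutant commutes with the commutant of \<open>B\<close>, which contains \<open>B\<close>; so it commutes with \<open>B\<close>, lies
  in the commutant itself, and therefore commutes with the bicommutant.
\<close>

lemma (in strongly_closed_algebra) abelian_bicommutant_in:
  assumes B: "B \<subseteq> N" "\<And>a b. a \<in> B \<Longrightarrow> b \<in> B \<Longrightarrow> a \<cdot> b = b \<cdot> a"
  shows "abelian_algebra (bicommutant_in N B)"
proof
  show "id_blinfun \<in> bicommutant_in N B" by (auto simp: bicommutant_in_def intro: mem)
  show "a + b \<in> bicommutant_in N B" if "a \<in> bicommutant_in N B" "b \<in> bicommutant_in N B" for a b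
    using that by (auto simp: bicommutant_in_def compose_algebra intro: mem)
  show "c *\<^sub>R a \<in> bicommutant_in N B" if "a \<in> bicommutant_in N B" for a c
    using that by (auto simp: bicommutant_in_def compose_algebra intro: mem)
  show "a \<cdot> b \<in> bicommutant_in N B" if "a \<in> bicommutant_in N B" "b \<in> bicommutant_in N B" for a b
    using that by (auto simp: bicommutant_in_def intro: mem) (metis blinfun_compose_assoc)
  show "g \<in> bicommutant_in N B"
    if f: "\<And>n. f n \<in> bicommutant_in N B" and g: "\<And>x. (\<lambda>n. blinfun_apply (f n) x) \<longlonglongrightarrow> blinfun_apply g x" for f g
    unfolding bicommutant_in_def
  proof (intro CollectI conjI allI impI)
    show "g \<in> N" by (rule strong_limit_mem[OF _ g]) (use f in \<open>auto simp: bicommutant_in_def\<close>)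
    fix z assume z: "\<forall>b\<in>B. z \<cdot> b = b \<cdot> z"
    show "g \<cdot> z = z \<cdot> g"
    proof (rule blinfun_eqI)
      fix h
      have "(\<lambda>n. f n (z h)) \<longlonglongrightarrow> g (z h)" by (rule g)
      moreover have "f n (z h) = z (f n h)" for n
      proof -
        have "f n \<cdot> z = z \<cdot> f n" using f[of n] z by (simp add: bicommutant_in_def)
        from arg_cong[OF this, of "\<lambda>a. a h"] show ?thesis by simp
      qed
      moreover have "(\<lambda>n. z (f n h)) \<longlonglongrightarrow> z (g h)" by (intro tendsto_intros g)
      ultimately show "(g \<cdot> z) h = (z \<cdot> g) h" using LIMSEQ_unique by fastforce
    qed
  qed
  show "a \<cdot> b = b \<cdot> a" if a: "a \<in> bicommutant_in N B" and b: "b \<in> bicommutant_in N B" for a b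
  proof -
    have "\<forall>c\<in>B. b \<cdot> c = c \<cdot> b"
    proof
      fix c assume "c \<in> B"
      then have "\<forall>d\<in>B. c \<cdot> d = d \<cdot> c" using B(2) by blast
      then show "b \<cdot> c = c \<cdot> b" using b by (simp add: bicommutant_in_def)
    qed
    then show ?thesis using a by (simp add: bicommutant_in_def)
  qed
qed

text \<open>
  Partitions are sets of nonzero projections, so that the trace of each member can be divided by.
\<close>

definition proj_partition :: "('a :: {real_inner, banach} \<Rightarrow>\<^sub>L 'a) set \<Rightarrow> ('a \<Rightarrow>\<^sub>L 'a) set \<Rightarrow> bool" where
  "proj_partition N Q \<longleftrightarrow> finite Q \<and> (\<forall>q\<in>Q. q \<in> N \<and> is_proj q \<and> q \<noteq> 0) \<and>
     (\<forall>p\<in>Q. \<forall>q\<in>Q. p \<noteq> q \<longrightarrow> p \<cdot> q = 0) \<and> \<Sum>Q = id_blinfun"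

lemma proj_partitionD:
  assumes "proj_partition N Q"
  shows "finite Q" "q \<in> Q \<Longrightarrow> q \<in> N" "q \<in> Q \<Longrightarrow> is_proj q" "q \<in> Q \<Longrightarrow> q \<noteq> 0"
    "p \<in> Q \<Longrightarrow> q \<in> Q \<Longrightarrow> p \<noteq> q \<Longrightarrow> p \<cdot> q = 0" "\<Sum>Q = id_blinfun"
  using assms by (auto simp: proj_partition_def)

lemma proj_partition_compose_sum:
  assumes Q: "proj_partition N Q" and q: "q \<in> Q"
  shows "q \<cdot> (\<Sum>p\<in>Q. \<beta> p *\<^sub>R p) = \<beta> q *\<^sub>R q"
proof -
  have "q \<cdot> (\<beta> p *\<^sub>R p) = (if p = q then \<beta> q *\<^sub>R q else 0)" if "p \<in> Q" for p
    using proj_partitionD[OF Q] that q by (auto simp: compose_algebra is_projD)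
  then show ?thesis
    unfolding compose_sum_right using proj_partitionD(1)[OF Q] q by (simp add: sum.delta' cong: sum.cong)
qed

lemma proj_partition_mono: "proj_partition N Q \<Longrightarrow> N \<subseteq> M \<Longrightarrow> proj_partition M Q"
  by (auto simp: proj_partition_def)

lemma norm_le_blockwise:
  assumes Q: "proj_partition N Q"
    and up: "\<And>q. q \<in> Q \<Longrightarrow> psd (\<delta> *\<^sub>R q - a \<cdot> q)" and lo: "\<And>q. q \<in> Q \<Longrightarrow> psd (\<delta> *\<^sub>R q + a \<cdot> q)"
    and \<delta>: "0 \<le> \<delta>"
  shows "norm a \<le> \<delta>"
proof (rule norm_hermitian_le_psd[OF _ _ \<delta>])
  have "a = (\<Sum>q\<in>Q. a \<cdot> q)" using proj_partitionD(6)[OF Q] by (simp add: compose_sum_right[symmetric])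
  moreover have "\<delta> *\<^sub>R id_blinfun = (\<Sum>q\<in>Q. \<delta> *\<^sub>R q)"
    using proj_partitionD(6)[OF Q] by (simp add: scaleR_right.sum[symmetric])
  ultimately have "\<delta> *\<^sub>R id_blinfun - a = (\<Sum>q\<in>Q. \<delta> *\<^sub>R q - a \<cdot> q)"
    "\<delta> *\<^sub>R id_blinfun + a = (\<Sum>q\<in>Q. \<delta> *\<^sub>R q + a \<cdot> q)"
    by (simp_all add: sum_subtractf sum.distrib)
  then show "psd (\<delta> *\<^sub>R id_blinfun - a)" "psd (\<delta> *\<^sub>R id_blinfun + a)"
    using up lo by (auto intro: psd_sum)
qed

lemma norm_block_sum_le:
  assumes Q: "proj_partition N Q" and \<gamma>: "\<And>q. q \<in> Q \<Longrightarrow> \<bar>\<gamma> q\<bar> \<le> \<delta>" and \<delta>: "0 \<le> \<delta>"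
  shows "norm (\<Sum>q\<in>Q. \<gamma> q *\<^sub>R q) \<le> \<delta>"
proof (rule norm_le_blockwise[OF Q _ _ \<delta>])
  fix q assume q: "q \<in> Q"
  have "hadj (\<Sum>q\<in>Q. \<gamma> q *\<^sub>R q) = (\<Sum>q\<in>Q. \<gamma> q *\<^sub>R q)"
    using proj_partitionD(3)[OF Q] by (simp add: is_projD cong: sum.cong)
  moreover have "hadj q = q" using proj_partitionD(3)[OF Q q] by (rule is_projD)
  ultimately have "(\<Sum>q\<in>Q. \<gamma> q *\<^sub>R q) \<cdot> q = \<gamma> q *\<^sub>R q"
    using arg_cong[OF proj_partition_compose_sum[OF Q q, of \<gamma>], of hadj] by (simp only: hadj_simps)
  moreover have "psd ((\<delta> - \<gamma> q) *\<^sub>R q)" "psd ((\<delta> + \<gamma> q) *\<^sub>R q)"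
    using \<gamma>[OF q] proj_partitionD(3)[OF Q q] by (auto intro!: psd_scaleR intro: psd_proj)
  ultimately show "psd (\<delta> *\<^sub>R q - (\<Sum>q\<in>Q. \<gamma> q *\<^sub>R q) \<cdot> q)" "psd (\<delta> *\<^sub>R q + (\<Sum>q\<in>Q. \<gamma> q *\<^sub>R q) \<cdot> q)"
    by (simp_all add: algebra_simps)
qed

context abelian_algebra
begin

lemma is_proj_compose: "p \<in> N \<Longrightarrow> q \<in> N \<Longrightarrow> is_proj p \<Longrightarrow> is_proj q \<Longrightarrow> is_proj (p \<cdot> q)"
  using left_commute[of q p q] commute[of q p] by (simp add: is_proj_def blinfun_compose_assoc is_proj_assoc)

text \<open>
  Distinct members of \<open>Q\<close> have the same product with \<open>e\<close> only if that product is \<open>0\<close>, so passing to sets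
  of products does not change their sum.
\<close>

lemma proj_partition_split:
  assumes Q: "proj_partition N Q" and e: "e \<in> N" "is_proj e"
  shows "proj_partition N (((\<lambda>q. q \<cdot> e) ` Q \<union> (\<lambda>q. q \<cdot> (id_blinfun - e)) ` Q) - {0})"
proof -
  note QD = proj_partitionD[OF Q]
  define f where "f = id_blinfun - e"
  have f: "f \<in> N" "is_proj f" "e \<cdot> f = 0" "f \<cdot> e = 0" "e + f = id_blinfun"
    using e by (auto simp: f_def compose_algebra is_projD intro: mem is_proj_minus_id)
  define X Y where "X = (\<lambda>q. q \<cdot> e) ` Q" and "Y = (\<lambda>q. q \<cdot> f) ` Q"
  have orth: "(p \<cdot> g) \<cdot> (q \<cdot> h) = 0" if "p \<in> Q" "q \<in> Q" "g \<in> N" "p \<noteq> q" for p q g h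
  proof -
    have "(p \<cdot> g) \<cdot> (q \<cdot> h) = (p \<cdot> q) \<cdot> (g \<cdot> h)"
      using QD(2) that by (simp add: blinfun_compose_assoc left_commute[of g q])
    then show ?thesis using QD that by simp
  qed
  have orth': "(p \<cdot> e) \<cdot> (q \<cdot> f) = 0" "(p \<cdot> f) \<cdot> (q \<cdot> e) = 0" if "p \<in> Q" "q \<in> Q" for p q
    using that QD(2) e f by (simp_all add: blinfun_compose_assoc left_commute[of e q] left_commute[of f q])
  have self: "p \<cdot> g = 0" if "p \<in> Q" "q \<in> Q" "p \<noteq> q" "p \<cdot> g = q \<cdot> g" "g \<in> N" "is_proj g" for p q g
  proof -
    have "is_proj (p \<cdot> g)" using that QD by (intro is_proj_compose) auto
    then have "p \<cdot> g = (p \<cdot> g) \<cdot> (p \<cdot> g)" by (simp add: is_projD)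
    also have "\<dots> = (p \<cdot> g) \<cdot> (q \<cdot> g)" using that by simp
    also have "\<dots> = 0" using that by (intro orth)
    finally show ?thesis .
  qed
  have sX: "\<Sum>X = (\<Sum>q\<in>Q. q \<cdot> e)"
    unfolding X_def using sum.reindex_nontrivial[of Q "\<lambda>q. q \<cdot> e" "\<lambda>x. x"] QD self e by (simp add: o_def)
  have sY: "\<Sum>Y = (\<Sum>q\<in>Q. q \<cdot> f)"
    unfolding Y_def using sum.reindex_nontrivial[of Q "\<lambda>q. q \<cdot> f" "\<lambda>x. x"] QD self f by (simp add: o_def)
  have "x = 0" if "x \<in> X \<inter> Y" for x
  proof -
    obtain p q where pq: "p \<in> Q" "q \<in> Q" "x = p \<cdot> e" "x = q \<cdot> f" using \<open>x \<in> X \<inter> Y\<close> by (auto simp: X_def Y_def)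
    have "is_proj x" using pq QD e by (auto intro: is_proj_compose)
    then have "x = (p \<cdot> e) \<cdot> (q \<cdot> f)" using pq by (metis is_projD(1))
    then show ?thesis using orth' pq by simp
  qed
  then have "\<Sum>(X \<union> Y) = \<Sum>X + \<Sum>Y"
    using sum.union_inter_neutral[of X Y "\<lambda>x. x"] QD(1) by (auto simp: X_def Y_def)
  also have "\<dots> = (\<Sum>Q) \<cdot> (e + f)"
    by (simp add: sX sY compose_sum_left sum.distrib[symmetric] compose_algebra)
  finally have "\<Sum>(X \<union> Y) = id_blinfun" using QD(6) f(5) by simp
  moreover have "\<Sum>(X \<union> Y - {0}) = \<Sum>(X \<union> Y)"
    using QD(1) by (intro sum.mono_neutral_left) (auto simp: X_def Y_def)
  ultimately have "\<Sum>(X \<union> Y - {0}) = id_blinfun" by simp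
  moreover have "x \<cdot> y = 0" if "x \<in> X \<union> Y" "y \<in> X \<union> Y" "x \<noteq> y" for x y
    using that orth orth' e f by (auto simp: X_def Y_def)
  moreover have "x \<in> N \<and> is_proj x" if "x \<in> X \<union> Y" for x
    using that QD e f by (auto simp: X_def Y_def intro: is_proj_compose mem)
  moreover have "finite (X \<union> Y)" using QD(1) by (simp add: X_def Y_def)
  ultimately have "proj_partition N (X \<union> Y - {0})" unfolding proj_partition_def by simp
  then show ?thesis by (simp only: X_def Y_def f_def)
qed

text \<open>
  The atoms of the Boolean algebra generated by \<open>E\<close>.
\<close>

lemma atoms_of_projections:
  assumes "finite E" "\<And>e. e \<in> E \<Longrightarrow> e \<in> N" "\<And>e. e \<in> E \<Longrightarrow> is_proj e"
  shows "\<exists>Q. proj_partition N Q \<and> (\<forall>q\<in>Q. \<forall>e\<in>E. q \<cdot> e = q \<or> q \<cdot> e = 0)"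
  using assms
proof (induction E)
  case empty
  show ?case
    by (intro exI[of _ "{id_blinfun} - {0}"], cases "(id_blinfun :: 'a \<Rightarrow>\<^sub>L 'a) = 0")
      (auto simp: proj_partition_def intro: mem)
next
  case (insert e E)
  then obtain Q where Q: "proj_partition N Q" "\<forall>q\<in>Q. \<forall>e\<in>E. q \<cdot> e = q \<or> q \<cdot> e = 0" by auto
  have e: "e \<in> N" "is_proj e" using insert by auto
  define Q' where "Q' = ((\<lambda>q. q \<cdot> e) ` Q \<union> (\<lambda>q. q \<cdot> (id_blinfun - e)) ` Q) - {0}"
  have "q \<cdot> e' = q \<or> q \<cdot> e' = 0" if "q \<in> Q'" "e' \<in> insert e E" for q e'
  proof (cases "e' = e")
    case True
    then show ?thesis using that(1) e by (auto simp: Q'_def compose_algebra is_projD)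
  next
    case False
    then have e': "e' \<in> E" "e' \<in> N" using that insert by auto
    note q = that(1)
    obtain p g where p: "p \<in> Q" "g \<in> N" "q = p \<cdot> g"
    proof -
      have "id_blinfun - e \<in> N" using e by (intro mem)
      moreover have "\<exists>p\<in>Q. q = p \<cdot> e \<or> q = p \<cdot> (id_blinfun - e)" using q by (auto simp: Q'_def)
      ultimately show thesis using that e by blast
    qed
    have "q \<cdot> e' = (p \<cdot> e') \<cdot> g" using p e' commute[of g e'] by (simp add: blinfun_compose_assoc)
    moreover have "p \<cdot> e' = p \<or> p \<cdot> e' = 0" using Q(2) p e' by blast
    ultimately show ?thesis using p by (elim disjE) simp_all
  qed
  then show ?case using proj_partition_split[OF Q(1) e] unfolding Q'_def[symmetric] by blast
qed

text \<open>
  Consider the atoms for the spectral projections of all \<open>b\<close> at the points \<open>l i\<close> of a grid of mesh \<open>\<delta>\<close>.  On each atom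
  every \<open>b\<close> lies below or above each grid point, hence between two neighbouring ones.
\<close>

lemma simultaneous_approximation:
  assumes F: "finite F" "\<And>b. b \<in> F \<Longrightarrow> b \<in> N" "\<And>b. b \<in> F \<Longrightarrow> hadj b = b" and \<delta>: "0 < \<delta>"
  shows "\<exists>Q. proj_partition N Q \<and> (\<forall>b\<in>F. \<exists>\<beta>. norm (b - (\<Sum>q\<in>Q. \<beta> q *\<^sub>R q)) \<le> \<delta>)"
proof -
  define K where "K = (\<Sum>b\<in>F. norm b)"
  have K: "norm b \<le> K" if "b \<in> F" for b unfolding K_def using F(1) that by (intro member_le_sum) auto
  define l where "l i = - K + real i * \<delta>" for i
  define m where "m = nat \<lceil>2 * K / \<delta>\<rceil>"
  have lm: "K \<le> l m"
  proof -
    have "2 * K / \<delta> \<le> real m" unfolding m_def by linarith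
    then show ?thesis using \<delta> by (simp add: l_def field_simps)
  qed
  have "\<exists>e. e \<in> N \<and> is_proj e \<and> psd (b \<cdot> e - c *\<^sub>R e) \<and>
      psd (c *\<^sub>R (id_blinfun - e) - b \<cdot> (id_blinfun - e))" if "b \<in> F" for b c
    using spectral_projection[of b c] F that by metis
  then obtain e where e: "\<And>b c. b \<in> F \<Longrightarrow> e b c \<in> N" "\<And>b c. b \<in> F \<Longrightarrow> is_proj (e b c)"
    "\<And>b c. b \<in> F \<Longrightarrow> psd (b \<cdot> e b c - c *\<^sub>R e b c)"
    "\<And>b c. b \<in> F \<Longrightarrow> psd (c *\<^sub>R (id_blinfun - e b c) - b \<cdot> (id_blinfun - e b c))"
    by metis
  define E where "E = (\<lambda>(b, i). e b (l i)) ` (F \<times> {..m})"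
  have "finite E" using F by (simp add: E_def)
  moreover have "x \<in> N" "is_proj x" if "x \<in> E" for x using that e by (auto simp: E_def)
  ultimately obtain Q where Q: "proj_partition N Q" "\<forall>q\<in>Q. \<forall>x\<in>E. q \<cdot> x = q \<or> q \<cdot> x = 0"
    using atoms_of_projections[of E] by blast
  note QD = proj_partitionD[OF Q(1)]
  have blk: "\<exists>\<beta>. psd (\<delta> *\<^sub>R q - (b \<cdot> q - \<beta> *\<^sub>R q)) \<and> psd (\<delta> *\<^sub>R q + (b \<cdot> q - \<beta> *\<^sub>R q))"
    if b: "b \<in> F" and q: "q \<in> Q" for b q
  proof -
    define P where "P i \<longleftrightarrow> psd (l i *\<^sub>R q - b \<cdot> q)" for i
    have qN: "q \<in> N" "is_proj q" using QD q by auto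
    have dq: "psd (\<delta> *\<^sub>R q)" using \<delta> qN by (simp add: psd_scaleR psd_proj)
    have "norm b \<le> l m" using K[OF b] lm by simp
    then have "psd ((l m *\<^sub>R id_blinfun - b) \<cdot> q)"
      using F b qN by (intro psd_compose_proj psd_norm_minus) (auto intro: mem)
    then have "P m" by (simp add: P_def compose_algebra)
    \<comment> \<open>The first grid point above \<open>b\<close> on the atom \<open>q\<close>.\<close>
    define i where "i = (LEAST i. P i)"
    have Pi: "P i" unfolding i_def using \<open>P m\<close> by (rule LeastI)
    have im: "i \<le> m" unfolding i_def using \<open>P m\<close> by (rule Least_le)
    show ?thesis
    proof (cases i)
      case 0
      have "psd ((K *\<^sub>R id_blinfun + b) \<cdot> q)"
        using F b qN K by (intro psd_compose_proj psd_norm_minus) (auto intro: mem)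
      then have "psd (b \<cdot> q - l 0 *\<^sub>R q)" by (simp add: l_def compose_algebra add.commute)
      moreover have "psd (l 0 *\<^sub>R q - b \<cdot> q)" using Pi 0 by (simp add: P_def)
      ultimately show ?thesis
        using psd_add[OF dq] by (intro exI[of _ "l 0"]) (metis add_diff_eq diff_diff_eq2)
    next
      case (Suc j)
      define g where "g = e b (l j)"
      have "g \<in> E" using b im Suc by (auto simp: E_def g_def)
      then have "q \<cdot> g = q \<or> q \<cdot> g = 0" using Q(2) q by blast
      moreover have gq: "q \<cdot> g = g \<cdot> q" using e(1) b qN by (simp add: g_def commute)
      ultimately consider "g \<cdot> q = q" | "g \<cdot> q = 0" by auto
      then show ?thesis
      proof cases
        case 1
        have "psd ((b \<cdot> g - l j *\<^sub>R g) \<cdot> q)"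
          unfolding g_def using e b F qN by (intro psd_compose_proj) (auto intro!: mem)
        then have "psd (b \<cdot> q - l j *\<^sub>R q)" by (simp add: compose_algebra 1)
        from psd_add[OF dq this] have "psd (\<delta> *\<^sub>R q + (b \<cdot> q - l j *\<^sub>R q))" .
        moreover have "psd (\<delta> *\<^sub>R q - (b \<cdot> q - l j *\<^sub>R q))"
          using Pi unfolding P_def Suc l_def by (simp add: algebra_simps)
        ultimately show ?thesis by blast
      next
        case 2
        have "psd ((l j *\<^sub>R (id_blinfun - g) - b \<cdot> (id_blinfun - g)) \<cdot> q)"
          unfolding g_def using e b F qN by (intro psd_compose_proj) (auto intro!: mem)
        then have "P j" by (simp add: P_def compose_algebra 2)
        then have "i \<le> j" unfolding i_def by (rule Least_le)
        then show ?thesis using Suc by simp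
      qed
    qed
  qed
  have "\<exists>\<beta>. norm (b - (\<Sum>q\<in>Q. \<beta> q *\<^sub>R q)) \<le> \<delta>" if b: "b \<in> F" for b
  proof -
    obtain \<beta> where \<beta>: "\<And>q. q \<in> Q \<Longrightarrow> psd (\<delta> *\<^sub>R q - (b \<cdot> q - \<beta> q *\<^sub>R q))"
      "\<And>q. q \<in> Q \<Longrightarrow> psd (\<delta> *\<^sub>R q + (b \<cdot> q - \<beta> q *\<^sub>R q))"
      using blk[OF b] by metis
    have "(b - (\<Sum>q\<in>Q. \<beta> q *\<^sub>R q)) \<cdot> q = b \<cdot> q - \<beta> q *\<^sub>R q" if q: "q \<in> Q" for q
    proof -
      have "(\<Sum>q\<in>Q. \<beta> q *\<^sub>R q) \<cdot> q = q \<cdot> (\<Sum>q\<in>Q. \<beta> q *\<^sub>R q)"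
        using QD q by (intro commute) (auto intro!: mem)
      then show ?thesis by (simp add: compose_algebra proj_partition_compose_sum[OF Q(1) q])
    qed
    then have "norm (b - (\<Sum>q\<in>Q. \<beta> q *\<^sub>R q)) \<le> \<delta>"
      using \<beta> \<delta> by (intro norm_le_blockwise[OF Q(1)]) auto
    then show ?thesis by blast
  qed
  then show ?thesis using Q(1) by blast
qed

end

section \<open>Increasing sequences and maximal elements\<close>

text \<open>
  The Brezis--Browder principle, which replaces Zorn's lemma when a bounded real functional measures size.
  Choosing each member of the sequence \<open>f\<close> so as to realise at least half of the gain that is still
  possible, no gain is left at an upper bound of \<open>f\<close>.
\<close>

lemma maximal_element_countable_chains:
  fixes R :: "'b \<Rightarrow> 'b \<Rightarrow> bool" and \<phi> :: "'b \<Rightarrow> real"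
  assumes x0: "x0 \<in> X"
    and refl: "\<And>x. x \<in> X \<Longrightarrow> R x x"
    and trans: "\<And>x y z. x \<in> X \<Longrightarrow> y \<in> X \<Longrightarrow> z \<in> X \<Longrightarrow> R x y \<Longrightarrow> R y z \<Longrightarrow> R x z"
    and mono: "\<And>x y. x \<in> X \<Longrightarrow> y \<in> X \<Longrightarrow> R x y \<Longrightarrow> \<phi> x \<le> \<phi> y"
    and bdd: "\<And>x. x \<in> X \<Longrightarrow> \<phi> x \<le> C"
    and chain: "\<And>f :: nat \<Rightarrow> 'b. (\<And>n. f n \<in> X) \<Longrightarrow> (\<And>n. R (f n) (f (Suc n))) \<Longrightarrow> \<exists>u\<in>X. \<forall>n. R (f n) u"
  shows "\<exists>x\<in>X. \<forall>y\<in>X. R x y \<longrightarrow> \<phi> y = \<phi> x"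
proof -
  define s where "s x = (SUP y\<in>{y\<in>X. R x y}. \<phi> y)" for x
  have s_ge: "\<phi> y \<le> s x" if "x \<in> X" "y \<in> X" "R x y" for x y
    unfolding s_def by (rule cSUP_upper) (use that bdd in \<open>auto intro!: bdd_aboveI2\<close>)
  have step: "\<exists>y. y \<in> X \<and> R x y \<and> (s x + \<phi> x) / 2 \<le> \<phi> y" if x: "x \<in> X" for x
  proof (cases "s x = \<phi> x")
    case True
    then show ?thesis using x refl by auto
  next
    case False
    then have "(s x + \<phi> x) / 2 < s x" using s_ge[OF x x refl[OF x]] by simp
    moreover have "{y\<in>X. R x y} \<noteq> {}" using x refl by auto
    moreover have "bdd_above (\<phi> ` {y\<in>X. R x y})" using bdd by (auto intro!: bdd_aboveI2)
    ultimately obtain y where "y \<in> X" "R x y" "(s x + \<phi> x) / 2 < \<phi> y"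
      unfolding s_def using less_cSUP_iff by (smt (verit) mem_Collect_eq)
    then show ?thesis by (auto intro: less_imp_le)
  qed
  have "\<exists>f. \<forall>n. f n \<in> X \<and> (R (f n) (f (Suc n)) \<and> (s (f n) + \<phi> (f n)) / 2 \<le> \<phi> (f (Suc n)))"
    using x0 step by (intro dependent_nat_choice) auto
  then obtain f where f: "\<And>n. f n \<in> X" "\<And>n. R (f n) (f (Suc n))"
    "\<And>n. (s (f n) + \<phi> (f n)) / 2 \<le> \<phi> (f (Suc n))"
    by blast
  obtain u where u: "u \<in> X" "\<And>n. R (f n) u" using chain[of f] f by blast
  have "incseq (\<lambda>n. \<phi> (f n))" using f mono by (simp add: incseq_Suc_iff)
  then obtain L where L: "(\<lambda>n. \<phi> (f n)) \<longlonglongrightarrow> L" using incseq_convergent[of "\<lambda>n. \<phi> (f n)" C] bdd f(1) by metis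
  have "L \<le> \<phi> u" by (rule LIMSEQ_le_const2[OF L]) (use mono[OF f(1) u(1) u(2)] in auto)
  moreover have "\<phi> y \<le> L" if y: "y \<in> X" "R u y" for y
  proof (rule LIMSEQ_le_const)
    show "(\<lambda>n. 2 * \<phi> (f (Suc n)) - \<phi> (f n)) \<longlonglongrightarrow> L"
      using tendsto_diff[OF tendsto_mult[OF tendsto_const[of 2] LIMSEQ_Suc[OF L]] L] by simp
    have "\<phi> y \<le> 2 * \<phi> (f (Suc n)) - \<phi> (f n)" for n
    proof -
      have "R (f n) y" using trans[OF f(1) u(1) y(1) u(2) y(2)] .
      then have "\<phi> y \<le> s (f n)" using s_ge f(1) y(1) by blast
      then show ?thesis using f(3)[of n] by simp
    qed
    then show "\<exists>N. \<forall>n\<ge>N. \<phi> y \<le> 2 * \<phi> (f (Suc n)) - \<phi> (f n)" by blast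
  qed
  moreover have "\<phi> u \<le> \<phi> y" if "y \<in> X" "R u y" for y using mono u(1) that by blast
  ultimately have "\<forall>y\<in>X. R u y \<longrightarrow> \<phi> y = \<phi> u" by (meson order_antisym order_trans)
  then show ?thesis using u(1) by blast
qed

lemma convergent_if_increments_dominated:
  fixes X :: "nat \<Rightarrow> 'a :: banach" and a :: "nat \<Rightarrow> real"
  assumes a: "convergent a" and d: "\<And>m n. n \<le> m \<Longrightarrow> (norm (X m - X n))\<^sup>2 \<le> a m - a n"
  shows "convergent X"
proof -
  have "Cauchy X"
  proof (rule CauchyI')
    fix e :: real assume e: "0 < e"
    have "Cauchy a" using a by (simp add: Cauchy_convergent_iff)
    then obtain k where k: "\<And>m n. m \<ge> k \<Longrightarrow> n \<ge> k \<Longrightarrow> norm (a m - a n) < e\<^sup>2"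
      using e CauchyD[of a "e\<^sup>2"] by auto
    show "\<exists>M. \<forall>m\<ge>M. \<forall>n>m. dist (X m) (X n) < e"
    proof (intro exI[of _ k] allI impI)
      fix m n assume mn: "k \<le> m" "m < n"
      then have "(norm (X n - X m))\<^sup>2 < e\<^sup>2" using d[of m n] k[of n m] by simp
      then have "norm (X n - X m) < e" using e by (simp add: power2_less_imp_less)
      then show "dist (X m) (X n) < e" by (simp add: dist_norm norm_minus_commute)
    qed
  qed
  then show ?thesis by (simp add: Cauchy_convergent_iff)
qed

lemma proj_chain_le:
  assumes inc: "\<And>n. e (Suc n) \<cdot> e n = e n" and "\<And>n. is_proj (e n)" and "n \<le> m"
  shows "e m \<cdot> e n = e n"
  using \<open>n \<le> m\<close>
proof (induction m rule: dec_induct)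
  case base
  then show ?case using assms(2) by (simp add: is_projD)
next
  case (step k)
  then show ?case using inc[of k] by (metis blinfun_compose_assoc)
qed

lemma proj_diff_norm:
  assumes "is_proj p" "is_proj q" "p \<cdot> q = q"
  shows "(norm (p x - q x))\<^sup>2 = (norm (p x))\<^sup>2 - (norm (q x))\<^sup>2"
  using proj_inner[OF is_proj_diff[OF assms], of x] proj_inner[OF assms(1), of x] proj_inner[OF assms(2), of x]
  by (simp add: blinfun.diff_left inner_diff_left)

lemma increasing_projections_increments:
  assumes e: "\<And>n. is_proj (e n)" and inc: "\<And>n. e (Suc n) \<cdot> e n = e n"
  shows "n \<le> m \<Longrightarrow> (norm (e m x - e n x))\<^sup>2 = (norm (e m x))\<^sup>2 - (norm (e n x))\<^sup>2"
    and "convergent (\<lambda>n. (norm (e n x))\<^sup>2)"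
proof -
  show sq: "(norm (e m x - e n x))\<^sup>2 = (norm (e m x))\<^sup>2 - (norm (e n x))\<^sup>2" if "n \<le> m" for m n
    by (intro proj_diff_norm e proj_chain_le[of e, OF inc e] that)
  have "incseq (\<lambda>n. (norm (e n x))\<^sup>2)"
    unfolding incseq_def using sq by (metis diff_ge_0_iff_ge zero_le_power2)
  moreover have "\<forall>n. (norm (e n x))\<^sup>2 \<le> (norm x)\<^sup>2" using e by (simp add: proj_norm_le power_mono)
  ultimately obtain L where "(\<lambda>n. (norm (e n x))\<^sup>2) \<longlonglongrightarrow> L" by (rule incseq_convergent)
  then show "convergent (\<lambda>n. (norm (e n x))\<^sup>2)" by (auto simp: convergent_def)
qed

lemma (in strongly_closed_algebra) increasing_projections:
  assumes e: "\<And>n. e n \<in> N" "\<And>n. is_proj (e n)" and inc: "\<And>n. e (Suc n) \<cdot> e n = e n"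
  obtains E where "E \<in> N" "is_proj E" "\<And>n. E \<cdot> e n = e n" "\<And>x. (\<lambda>n. blinfun_apply (e n) x) \<longlonglongrightarrow> blinfun_apply E x"
proof -
  note le = proj_chain_le[of e, OF inc e(2)]
  have n1: "norm (e n) \<le> 1" for n by (rule norm_proj_le[OF e(2)])
  have "convergent (\<lambda>n. e n x)" for x
    by (rule convergent_if_increments_dominated[OF increasing_projections_increments(2)[of e x, OF e(2) inc]])
      (simp add: increasing_projections_increments(1)[of e, OF e(2) inc])
  then obtain E where E: "\<And>x. (\<lambda>n. e n x) \<longlonglongrightarrow> blinfun_apply E x"
    using strong_limit_blinfun[of e 1] n1 by metis
  show thesis
  proof (rule that[OF _ _ _ E])
    show "E \<in> N" by (rule strong_limit_mem[OF e(1) E])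
    have "hadj E = E" using strong_limit_hadj[of e E E] E e(2) by (simp add: is_projD)
    moreover have "E \<cdot> E = E"
    proof (rule strong_limit_unique)
      show "(\<lambda>n. (e n \<cdot> e n) x) \<longlonglongrightarrow> (E \<cdot> E) x" for x by (rule strong_limit_compose[OF E E n1])
      show "(\<lambda>n. (e n \<cdot> e n) x) \<longlonglongrightarrow> E x" for x using E e(2) by (simp add: is_projD)
    qed
    ultimately show "is_proj E" by (simp add: is_proj_def)
    show "E \<cdot> e n = e n" for n
    proof (rule blinfun_eqI)
      fix x
      have "(\<lambda>m. e m (e n x)) \<longlonglongrightarrow> E (e n x)" by (rule E)
      moreover have "e m (e n x) = e n x" if "n \<le> m" for m
        using arg_cong[OF le[OF that], of "\<lambda>a. a x"] by simp
      then have "(\<lambda>m. e m (e n x)) \<longlonglongrightarrow> e n x"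
        by (intro tendsto_eventually) (auto simp: eventually_sequentially)
      ultimately show "(E \<cdot> e n) x = e n x" using LIMSEQ_unique by fastforce
    qed
  qed
qed

section \<open>Factors with a faithful trace\<close>

text \<open>
  A \<open>II\<^sub>1\<close> factor seen through its real trace, with the axioms in the form in which the comparison of
  projections uses them.
\<close>

locale diffuse_tracial_factor = strongly_closed_algebra M
  for M :: "('a :: {real_inner, banach} \<Rightarrow>\<^sub>L 'a) set" +
  fixes tr :: "('a \<Rightarrow>\<^sub>L 'a) \<Rightarrow> real"
  assumes hadj_mem: "x \<in> M \<Longrightarrow> hadj x \<in> M"
    and tr_add: "x \<in> M \<Longrightarrow> y \<in> M \<Longrightarrow> tr (x + y) = tr x + tr y"
    and tr_scaleR: "x \<in> M \<Longrightarrow> tr (c *\<^sub>R x) = c * tr x"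
    and tr_id: "tr id_blinfun = 1"
    and tr_commute: "x \<in> M \<Longrightarrow> y \<in> M \<Longrightarrow> tr (x \<cdot> y) = tr (y \<cdot> x)"
    and tr_nonneg: "x \<in> M \<Longrightarrow> psd x \<Longrightarrow> 0 \<le> tr x"
    and tr_faithful: "x \<in> M \<Longrightarrow> tr (hadj x \<cdot> x) = 0 \<Longrightarrow> x = 0"
    and tr_normal: "(\<And>n :: nat. e n \<in> M) \<Longrightarrow> (\<And>n. is_proj (e n)) \<Longrightarrow> (\<And>n. e (Suc n) \<cdot> e n = e n) \<Longrightarrow>
      E \<in> M \<Longrightarrow> is_proj E \<Longrightarrow>
      (\<And>x. (\<lambda>n. blinfun_apply (e n) x) \<longlonglongrightarrow> blinfun_apply E x) \<Longrightarrow> (\<And>n. tr (e n) \<le> t) \<Longrightarrow> tr E \<le> t"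
    and central_projection: "z \<in> M \<Longrightarrow> is_proj z \<Longrightarrow> (\<And>x. x \<in> M \<Longrightarrow> z \<cdot> x = x \<cdot> z) \<Longrightarrow> z = 0 \<or> z = id_blinfun"
    and no_minimal: "p \<in> M \<Longrightarrow> is_proj p \<Longrightarrow> p \<noteq> 0 \<Longrightarrow> \<exists>q\<in>M. is_proj q \<and> q \<noteq> 0 \<and> q \<noteq> p \<and> p \<cdot> q = q"
begin

lemma tr_zero: "tr 0 = 0"
  using tr_scaleR[OF zero_mem, of 0] by simp

lemma tr_diff: "x \<in> M \<Longrightarrow> y \<in> M \<Longrightarrow> tr (x - y) = tr x - tr y"
  using tr_add[of "x - y" y] by (simp add: mem)

lemma tr_sum: "(\<And>i. i \<in> I \<Longrightarrow> f i \<in> M) \<Longrightarrow> tr (\<Sum>i\<in>I. f i) = (\<Sum>i\<in>I. tr (f i))"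
  by (induction I rule: infinite_finite_induct) (auto simp: tr_zero tr_add mem)

lemma tr_proj_nonneg: "p \<in> M \<Longrightarrow> is_proj p \<Longrightarrow> 0 \<le> tr p"
  by (intro tr_nonneg psd_proj)

lemma tr_proj_eq_0: "p \<in> M \<Longrightarrow> is_proj p \<Longrightarrow> tr p = 0 \<Longrightarrow> p = 0"
  using tr_faithful[of p] by (simp add: is_projD)

lemma tr_proj_pos: "p \<in> M \<Longrightarrow> is_proj p \<Longrightarrow> p \<noteq> 0 \<Longrightarrow> 0 < tr p"
  using tr_proj_nonneg tr_proj_eq_0 by (metis order_le_less)

lemma tr_sub_le:
  assumes "p \<in> M" "is_proj p" "q \<in> M" "is_proj q" "p \<cdot> q = q"
  shows "tr q \<le> tr p"
  using tr_proj_nonneg[of "p - q"] is_proj_diff[of p q] assms by (simp add: tr_diff mem)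

lemma tr_sub_eq:
  assumes "p \<in> M" "is_proj p" "q \<in> M" "is_proj q" "p \<cdot> q = q" "tr q = tr p"
  shows "q = p"
  using tr_proj_eq_0[of "p - q"] is_proj_diff[of p q] assms by (simp add: tr_diff mem)

lemma tr_proj_le_1: "p \<in> M \<Longrightarrow> is_proj p \<Longrightarrow> tr p \<le> 1"
  using tr_sub_le[of id_blinfun p] by (simp add: tr_id mem)

text \<open>
  If \<open>q\<close> is a proper nonzero subprojection of \<open>p\<close>, one of \<open>q\<close> and \<open>p - q\<close> has at most half the trace of \<open>p\<close>.
\<close>

lemma small_subprojection:
  assumes p: "p \<in> M" "is_proj p" "p \<noteq> 0" and "0 < \<epsilon>"
  obtains q where "q \<in> M" "is_proj q" "q \<noteq> 0" "p \<cdot> q = q" "tr q < \<epsilon>"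
proof -
  have halve: "\<exists>q\<in>M. is_proj q \<and> q \<noteq> 0 \<and> p \<cdot> q = q \<and> tr q \<le> tr p / 2"
    if p: "p \<in> M" "is_proj p" "p \<noteq> 0" for p
  proof -
    obtain q where q: "q \<in> M" "is_proj q" "q \<noteq> 0" "q \<noteq> p" "p \<cdot> q = q" using no_minimal[OF p] by blast
    have pq: "p - q \<in> M" "is_proj (p - q)" "p - q \<noteq> 0" "p \<cdot> (p - q) = p - q"
      using p q by (auto simp: mem is_proj_diff compose_algebra is_projD)
    show ?thesis
    proof (cases "tr q \<le> tr p / 2")
      case False
      then have "tr (p - q) \<le> tr p / 2" using p q by (simp add: tr_diff)
      then show ?thesis using pq by blast
    qed (use q in blast)
  qed
  have "\<exists>q\<in>M. is_proj q \<and> q \<noteq> 0 \<and> p \<cdot> q = q \<and> tr q \<le> (1/2) ^ n" for n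
  proof (induction n)
    case 0
    show ?case using p by (intro bexI[of _ p]) (auto simp: is_projD tr_proj_le_1)
  next
    case (Suc n)
    then obtain q where q: "q \<in> M" "is_proj q" "q \<noteq> 0" "p \<cdot> q = q" "tr q \<le> (1/2) ^ n" by blast
    obtain r where r: "r \<in> M" "is_proj r" "r \<noteq> 0" "q \<cdot> r = r" "tr r \<le> tr q / 2" using halve q by blast
    have "p \<cdot> r = r" using q(4) r(4) by (metis blinfun_compose_assoc)
    then show ?case using r q(5) by (intro bexI[of _ r]) auto
  qed
  moreover obtain n where "(1/2 :: real) ^ n < \<epsilon>"
    using real_arch_pow_inv[OF \<open>0 < \<epsilon>\<close>, of "1/2"] by auto
  ultimately show thesis using that by (meson order_le_less_trans)
qed

lemma proj_orth_sub:
  assumes "is_proj p" "is_proj e" "p \<cdot> e = e" "(p - e) \<cdot> q = q"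
  shows "e \<cdot> q = 0"
proof -
  have "e \<cdot> q = (e \<cdot> (p - e)) \<cdot> q" by (simp only: blinfun_compose_assoc assms(4))
  then show ?thesis using proj_sub_commute[OF assms(1-3)] assms(2) by (simp add: compose_algebra is_projD)
qed

text \<open>
  A maximal subprojection of trace at most \<open>t\<close> has trace \<open>t\<close>; otherwise a small subprojection of its
  complement in \<open>p\<close> could be added.
\<close>

lemma subprojection_of_trace:
  assumes p: "p \<in> M" "is_proj p" and t: "0 \<le> t" "t \<le> tr p"
  obtains e where "e \<in> M" "is_proj e" "p \<cdot> e = e" "tr e = t"
proof -
  define X where "X = {e \<in> M. is_proj e \<and> p \<cdot> e = e \<and> tr e \<le> t}"
  have "\<exists>x\<in>X. \<forall>y\<in>X. y \<cdot> x = x \<longrightarrow> tr y = tr x"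
  proof (rule maximal_element_countable_chains[of 0 X "\<lambda>x y. y \<cdot> x = x" tr 1])
    show "0 \<in> X" using t by (auto simp: X_def tr_zero mem)
    show "z \<cdot> x = x" if "y \<cdot> x = x" "z \<cdot> y = y" for x y z using that by (metis blinfun_compose_assoc)
    show "\<exists>u\<in>X. \<forall>n. u \<cdot> f n = f n" if f: "\<And>n. f n \<in> X" "\<And>n. f (Suc n) \<cdot> f n = f n" for f
    proof -
      obtain E where E: "E \<in> M" "is_proj E" "\<And>n. E \<cdot> f n = f n" "\<And>x. (\<lambda>n. blinfun_apply (f n) x) \<longlonglongrightarrow> blinfun_apply E x"
        using increasing_projections[of f] f by (auto simp: X_def)
      have "tr E \<le> t" by (rule tr_normal[of f E]) (use f E in \<open>auto simp: X_def\<close>)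
      moreover have "p \<cdot> E = E"
      proof (rule strong_limit_unique)
        show "(\<lambda>n. (p \<cdot> f n) x) \<longlonglongrightarrow> (p \<cdot> E) x" for x by (rule strong_limit_compose[OF tendsto_const E(4) order_refl])
        show "(\<lambda>n. (p \<cdot> f n) x) \<longlonglongrightarrow> E x" for x using E(4) f by (simp add: X_def)
      qed
      ultimately show ?thesis using E by (auto simp: X_def)
    qed
  qed (auto simp: X_def is_projD tr_proj_le_1 intro: tr_sub_le)
  then obtain e where e: "e \<in> X" "\<And>y. y \<in> X \<Longrightarrow> y \<cdot> e = e \<Longrightarrow> tr y = tr e" by blast
  have eM: "e \<in> M" "is_proj e" "p \<cdot> e = e" "tr e \<le> t" using e(1) by (auto simp: X_def)
  have "tr e = t"
  proof (rule ccontr)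
    assume "tr e \<noteq> t"
    then have lt: "tr e < t" using eM by simp
    then have "p - e \<noteq> 0" using t by auto
    then obtain q where q: "q \<in> M" "is_proj q" "q \<noteq> 0" "(p - e) \<cdot> q = q" "tr q < t - tr e"
      using small_subprojection[of "p - e" "t - tr e"] p eM lt by (auto simp: mem is_proj_diff)
    have eq: "e \<cdot> q = 0" by (rule proj_orth_sub[OF p(2) eM(2,3) q(4)])
    have "p \<cdot> q = p \<cdot> ((p - e) \<cdot> q)" using q by simp
    also have "\<dots> = q" using q eM p by (simp add: compose_algebra is_projD is_proj_assoc eq)
    finally have "e + q \<in> X" using q eM eq by (auto simp: X_def mem is_proj_add compose_algebra tr_add)
    moreover have "(e + q) \<cdot> e = e" using eM q proj_orth_commute[OF eM(2) q(2) eq] by (simp add: compose_algebra is_projD)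
    ultimately have "tr (e + q) = tr e" by (rule e(2))
    then have "tr q = 0" using eM q by (simp add: tr_add)
    then show False using tr_proj_pos q by fastforce
  qed
  then show thesis using that eM by blast
qed

lemma orthogonal_subprojections:
  assumes "finite I" "p \<in> M" "is_proj p" "\<And>i. i \<in> I \<Longrightarrow> 0 \<le> t i" "(\<Sum>i\<in>I. t i) \<le> tr p"
  shows "\<exists>g. (\<forall>i\<in>I. g i \<in> M \<and> is_proj (g i) \<and> p \<cdot> g i = g i \<and> tr (g i) = t i) \<and>
    (\<forall>i\<in>I. \<forall>j\<in>I. i \<noteq> j \<longrightarrow> g i \<cdot> g j = 0)"
  using assms
proof (induction I arbitrary: p)
  case (insert k I)
  have "0 \<le> (\<Sum>i\<in>I. t i)" using insert by (intro sum_nonneg) auto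
  then have "0 \<le> t k" "t k \<le> tr p" using insert by auto
  then obtain e where e: "e \<in> M" "is_proj e" "p \<cdot> e = e" "tr e = t k"
    using subprojection_of_trace insert.prems by metis
  have pe: "p - e \<in> M" "is_proj (p - e)" using e insert.prems by (auto simp: mem is_proj_diff)
  moreover have "(\<Sum>i\<in>I. t i) \<le> tr (p - e)" using insert e by (simp add: tr_diff)
  ultimately obtain g where g: "\<And>i. i \<in> I \<Longrightarrow> g i \<in> M \<and> is_proj (g i) \<and> (p - e) \<cdot> g i = g i \<and> tr (g i) = t i"
      "\<And>i j. i \<in> I \<Longrightarrow> j \<in> I \<Longrightarrow> i \<noteq> j \<Longrightarrow> g i \<cdot> g j = 0"
    using insert.IH[of "p - e"] insert.prems by (metis insertCI)
  have eg: "e \<cdot> g i = 0" if "i \<in> I" for i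
    using proj_orth_sub[of p e "g i"] insert.prems e g(1)[OF that] by blast
  then have ge: "g i \<cdot> e = 0" if "i \<in> I" for i
    using that g e proj_orth_commute by blast
  have pg: "p \<cdot> g i = g i" if "i \<in> I" for i
  proof -
    have "(p - e) \<cdot> g i = g i" using g(1)[OF that] by blast
    then show ?thesis using eg[OF that] by (simp add: compose_algebra)
  qed
  define h where "h = g(k := e)"
  have hk: "h k = e" and hI: "\<And>i. i \<in> I \<Longrightarrow> h i = g i" using insert.hyps by (auto simp: h_def)
  have "\<forall>i\<in>insert k I. h i \<in> M \<and> is_proj (h i) \<and> p \<cdot> h i = h i \<and> tr (h i) = t i"
    using e g(1) pg by (simp add: hk hI)
  moreover have "\<forall>i\<in>insert k I. \<forall>j\<in>insert k I. i \<noteq> j \<longrightarrow> h i \<cdot> h j = 0"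
    using eg ge g(2) by (simp add: hk hI)
  ultimately show ?case by blast
next
  case empty
  show ?case by simp
qed

end

section \<open>Partial isometries and comparison of projections\<close>

definition partial_isometry :: "('a :: {real_inner, banach} \<Rightarrow>\<^sub>L 'a) \<Rightarrow> bool" where
  "partial_isometry v \<longleftrightarrow> v \<cdot> (hadj v \<cdot> v) = v"

text \<open>
  The operator \<open>w\<close> agrees with \<open>v\<close> on the initial space of \<open>v\<close>, and the adjoints agree on the final space of \<open>v\<close>.
  Requiring both makes the relation invariant under taking adjoints.
\<close>

definition pi_extends :: "('a :: {real_inner, banach} \<Rightarrow>\<^sub>L 'a) \<Rightarrow> ('a \<Rightarrow>\<^sub>L 'a) \<Rightarrow> bool" where
  "pi_extends v w \<longleftrightarrow> w \<cdot> (hadj v \<cdot> v) = v \<and> (v \<cdot> hadj v) \<cdot> w = v"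

lemma partial_isometryD:
  assumes "partial_isometry v"
  shows "v \<cdot> (hadj v \<cdot> v) = v" "hadj v \<cdot> (v \<cdot> hadj v) = hadj v"
    "is_proj (hadj v \<cdot> v)" "is_proj (v \<cdot> hadj v)" "partial_isometry (hadj v)"
proof -
  show a: "v \<cdot> (hadj v \<cdot> v) = v" using assms by (simp add: partial_isometry_def)
  from arg_cong[OF this, of hadj] show b: "hadj v \<cdot> (v \<cdot> hadj v) = hadj v"
    by (simp add: blinfun_compose_assoc)
  show "is_proj (hadj v \<cdot> v)" "is_proj (v \<cdot> hadj v)" using a b by (simp_all add: is_proj_def blinfun_compose_assoc)
  show "partial_isometry (hadj v)" using b by (simp add: partial_isometry_def)
qed

lemma partial_isometry_norm:
  assumes "partial_isometry v"
  shows "norm (blinfun_apply v x) \<le> norm x"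
proof -
  have "(norm (v x))\<^sup>2 = (norm ((hadj v \<cdot> v) x))\<^sup>2"
    by (simp only: norm_hadj_sq[of v] proj_inner[OF partial_isometryD(3)[OF assms]])
  then have "norm (v x) = norm ((hadj v \<cdot> v) x)" by simp
  then show ?thesis using proj_norm_le[OF partial_isometryD(3)[OF assms], of x] by simp
qed

lemma pi_extends_hadj: "pi_extends v w \<Longrightarrow> pi_extends (hadj v) (hadj w)"
  unfolding pi_extends_def by (metis blinfun_compose_assoc hadj_simps(1,2))

lemma pi_extends_support:
  assumes v: "partial_isometry v" and vw: "pi_extends v w"
  shows "(hadj w \<cdot> w) \<cdot> (hadj v \<cdot> v) = hadj v \<cdot> v"
proof -
  have "hadj ((v \<cdot> hadj v) \<cdot> w) = hadj v" using vw by (simp add: pi_extends_def)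
  then have "hadj w \<cdot> (v \<cdot> hadj v) = hadj v" by simp
  then have "(hadj w \<cdot> (v \<cdot> hadj v)) \<cdot> v = hadj v \<cdot> v" by simp
  then have "hadj w \<cdot> v = hadj v \<cdot> v" using partial_isometryD(1)[OF v] by (simp add: blinfun_compose_assoc)
  moreover have "(hadj w \<cdot> w) \<cdot> (hadj v \<cdot> v) = hadj w \<cdot> v"
    using vw by (simp add: pi_extends_def blinfun_compose_assoc)
  ultimately show ?thesis by simp
qed

lemma pi_extends_support':
  assumes v: "partial_isometry v" and vw: "pi_extends v w"
  shows "(v \<cdot> hadj v) \<cdot> (w \<cdot> hadj w) = v \<cdot> hadj v"
  using arg_cong[OF pi_extends_support[OF partial_isometryD(5)[OF v] pi_extends_hadj[OF vw]], of hadj]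
  by simp

lemma pi_extends_trans:
  assumes x: "partial_isometry x" and xy: "pi_extends x y" and yz: "pi_extends y z"
  shows "pi_extends x z"
proof -
  have "z \<cdot> (hadj x \<cdot> x) = z \<cdot> ((hadj y \<cdot> y) \<cdot> (hadj x \<cdot> x))" by (simp only: pi_extends_support[OF x xy])
  also have "\<dots> = x" using yz xy by (metis blinfun_compose_assoc pi_extends_def)
  finally have 1: "z \<cdot> (hadj x \<cdot> x) = x" .
  have "(x \<cdot> hadj x) \<cdot> z = ((x \<cdot> hadj x) \<cdot> (y \<cdot> hadj y)) \<cdot> z" by (simp only: pi_extends_support'[OF x xy])
  also have "\<dots> = x" using yz xy by (metis blinfun_compose_assoc pi_extends_def)
  finally show ?thesis using 1 by (simp add: pi_extends_def)
qed

lemma pi_extends_refl: "partial_isometry v \<Longrightarrow> pi_extends v v"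
  using partial_isometryD(1)[of v] by (simp add: pi_extends_def blinfun_compose_assoc)

lemma pi_chain_extends:
  assumes v: "\<And>n. partial_isometry (v n)" and ext: "\<And>n. pi_extends (v n) (v (Suc n))" and "n \<le> m"
  shows "pi_extends (v n) (v m)"
  using \<open>n \<le> m\<close> by (induction m rule: dec_induct) (auto intro: pi_extends_refl pi_extends_trans v ext)

text \<open>
  With the initial projections \<open>E n\<close> of \<open>v n\<close>, the increment \<open>v m - v n\<close> equals \<open>v m \<cdot> (E m - E n)\<close>.
\<close>

lemma pi_chain_convergent:
  assumes v: "\<And>n. partial_isometry (v n)" and ext: "\<And>n. pi_extends (v n) (v (Suc n))"
  shows "convergent (\<lambda>n. blinfun_apply (v n) x)"
proof -
  define E where "E n = hadj (v n) \<cdot> v n" for n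
  have E: "is_proj (E n)" for n unfolding E_def by (rule partial_isometryD(3)[OF v])
  have vE: "v m \<cdot> E n = v n" and EE: "E m \<cdot> E n = E n" if "n \<le> m" for m n
    using pi_chain_extends[of v, OF v ext that] pi_extends_support[OF v pi_chain_extends[of v, OF v ext that]]
    by (simp_all add: E_def pi_extends_def)
  have Einc: "E (Suc n) \<cdot> E n = E n" for n by (rule EE) simp
  show ?thesis
  proof (rule convergent_if_increments_dominated)
    show "(norm (v m x - v n x))\<^sup>2 \<le> (norm (E m x))\<^sup>2 - (norm (E n x))\<^sup>2" if "n \<le> m" for m n
    proof -
      have "v m x - v n x = (v m \<cdot> E m) x - (v m \<cdot> E n) x" using vE[of m m] vE[OF that] by simp
      also have "\<dots> = v m (E m x - E n x)" by (simp add: blinfun.diff_right)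
      finally have "norm (v m x - v n x) \<le> norm (E m x - E n x)"
        using partial_isometry_norm[OF v, of m "E m x - E n x"] by simp
      then have "(norm (v m x - v n x))\<^sup>2 \<le> (norm (E m x - E n x))\<^sup>2" by (simp add: power_mono)
      then show ?thesis using increasing_projections_increments(1)[of E, OF E Einc that] by simp
    qed
    show "convergent (\<lambda>n. (norm (E n x))\<^sup>2)" by (rule increasing_projections_increments(2)[of E, OF E Einc])
  qed
qed

lemma pi_chain_limit:
  assumes v: "\<And>n. partial_isometry (v n)" and ext: "\<And>n. pi_extends (v n) (v (Suc n))"
  obtains u where "partial_isometry u" "\<And>n. pi_extends (v n) u"
    "\<And>x. (\<lambda>n. blinfun_apply (v n) x) \<longlonglongrightarrow> blinfun_apply u x"
proof -
  have n1: "norm (v n) \<le> 1" for n by (rule norm_blinfun_bound) (auto simp: partial_isometry_norm v)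
  have n2: "norm (hadj (v n)) \<le> 1" for n using order_trans[OF norm_hadj_le n1] .
  obtain u where u: "\<And>x. (\<lambda>n. v n x) \<longlonglongrightarrow> blinfun_apply u x"
    using strong_limit_blinfun[of v 1, OF n1 pi_chain_convergent[of v, OF v ext]] by blast
  obtain u' where "\<And>x. (\<lambda>n. hadj (v n) x) \<longlonglongrightarrow> blinfun_apply u' x"
    using strong_limit_blinfun[of "\<lambda>n. hadj (v n)" 1, OF n2
        pi_chain_convergent[of "\<lambda>n. hadj (v n)", OF partial_isometryD(5)[OF v] pi_extends_hadj[OF ext]]] by blast
  then have hu: "(\<lambda>n. hadj (v n) x) \<longlonglongrightarrow> blinfun_apply (hadj u) x" for x
    using strong_limit_hadj[of v u u', OF u] by simp
  show thesis
  proof (rule that[OF _ _ u])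
    have "u \<cdot> (hadj u \<cdot> u) = u"
    proof (rule strong_limit_unique[OF _ u])
      show "(\<lambda>n. v n x) \<longlonglongrightarrow> (u \<cdot> (hadj u \<cdot> u)) x" for x
        using strong_limit_compose[of v u "\<lambda>n. hadj (v n) \<cdot> v n", OF u strong_limit_compose[OF hu u n2] n1]
        by (simp only: partial_isometryD(1)[OF v])
    qed
    then show "partial_isometry u" by (simp add: partial_isometry_def)
    fix n
    have ev: "\<forall>\<^sub>F m in sequentially. pi_extends (v n) (v m)"
      using pi_chain_extends[of v, OF v ext] by (auto simp: eventually_sequentially)
    have "u \<cdot> (hadj (v n) \<cdot> v n) = v n"
    proof (rule strong_limit_unique)
      show "(\<lambda>m. (v m \<cdot> (hadj (v n) \<cdot> v n)) x) \<longlonglongrightarrow> (u \<cdot> (hadj (v n) \<cdot> v n)) x" for x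
        by (rule strong_limit_compose[OF u tendsto_const n1])
      show "(\<lambda>m. (v m \<cdot> (hadj (v n) \<cdot> v n)) x) \<longlonglongrightarrow> v n x" for x
        by (rule tendsto_eventually, rule eventually_mono[OF ev]) (simp add: pi_extends_def)
    qed
    moreover have "(v n \<cdot> hadj (v n)) \<cdot> u = v n"
    proof (rule strong_limit_unique)
      show "(\<lambda>m. ((v n \<cdot> hadj (v n)) \<cdot> v m) x) \<longlonglongrightarrow> ((v n \<cdot> hadj (v n)) \<cdot> u) x" for x
        by (rule strong_limit_compose[OF tendsto_const u order_refl])
      show "(\<lambda>m. ((v n \<cdot> hadj (v n)) \<cdot> v m) x) \<longlonglongrightarrow> v n x" for x
        by (rule tendsto_eventually, rule eventually_mono[OF ev]) (simp add: pi_extends_def)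
    qed
    ultimately show "pi_extends (v n) u" by (simp add: pi_extends_def)
  qed
qed

context diffuse_tracial_factor
begin

text \<open>
  Otherwise \<open>p\<close> lies in the strongly closed two-sided ideal \<open>J\<close> of all \<open>z\<close> with \<open>q M z = 0\<close>.  A maximal projection \<open>e\<close>
  of \<open>J\<close> is a left unit of \<open>J\<close>, since \<open>e\<close> and the range of any \<open>z\<close> in \<open>J\<close> lie below the support of \<open>e + z z\<^sup>*\<close>.
  As \<open>J\<close> absorbs multiplication by \<open>M\<close>, \<open>e\<close> commutes with \<open>M\<close>; it is not \<open>0\<close> because \<open>e p = p\<close>, so \<open>e = 1\<close> and \<open>q = 0\<close>.
\<close>

lemma corner_nonzero:
  assumes p: "p \<in> M" "is_proj p" "p \<noteq> 0" and q: "q \<in> M" "is_proj q" "q \<noteq> 0"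
  obtains x where "x \<in> M" "q \<cdot> (x \<cdot> p) \<noteq> 0"
proof (rule ccontr)
  assume neg: "\<not> thesis"
  note witness = that
  have p0: "q \<cdot> (x \<cdot> p) = 0" if "x \<in> M" for x using witness[OF that] neg by blast
  define J where "J = {z \<in> M. \<forall>x\<in>M. q \<cdot> (x \<cdot> z) = 0}"
  define X where "X = {e \<in> J. is_proj e}"
  have "\<exists>x\<in>X. \<forall>y\<in>X. y \<cdot> x = x \<longrightarrow> tr y = tr x"
  proof (rule maximal_element_countable_chains[of 0 X "\<lambda>x y. y \<cdot> x = x" tr 1])
    show "0 \<in> X" by (auto simp: X_def J_def mem)
    show "z \<cdot> x = x" if "y \<cdot> x = x" "z \<cdot> y = y" for x y z using that by (metis blinfun_compose_assoc)
    show "\<exists>u\<in>X. \<forall>n. u \<cdot> f n = f n" if f: "\<And>n. f n \<in> X" "\<And>n. f (Suc n) \<cdot> f n = f n" for f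
    proof -
      obtain E where E: "E \<in> M" "is_proj E" "\<And>n. E \<cdot> f n = f n" "\<And>x. (\<lambda>n. blinfun_apply (f n) x) \<longlonglongrightarrow> blinfun_apply E x"
        using increasing_projections[of f] f by (auto simp: X_def J_def)
      have "q \<cdot> (x \<cdot> E) = 0" if "x \<in> M" for x
      proof (rule strong_limit_unique)
        show "(\<lambda>n. ((q \<cdot> x) \<cdot> f n) h) \<longlonglongrightarrow> (q \<cdot> (x \<cdot> E)) h" for h
          using strong_limit_compose[of "\<lambda>_. q \<cdot> x", OF tendsto_const E(4) order_refl]
          by (simp add: blinfun_compose_assoc)
        show "(\<lambda>n. ((q \<cdot> x) \<cdot> f n) h) \<longlonglongrightarrow> blinfun_apply 0 h" for h
          using f(1) that by (simp add: X_def J_def blinfun_compose_assoc del: blinfun_apply_blinfun_compose)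
      qed
      then show ?thesis using E by (auto simp: X_def J_def)
    qed
  qed (auto simp: X_def J_def is_projD tr_proj_le_1 intro: tr_sub_le)
  then obtain e where e: "e \<in> X" and max: "\<And>y. y \<in> X \<Longrightarrow> y \<cdot> e = e \<Longrightarrow> tr y = tr e" by blast
  have eM: "e \<in> M" "is_proj e" and eJ: "e \<in> J" using e by (auto simp: X_def J_def)
  have unit: "e \<cdot> z = z" if z: "z \<in> J" for z
  proof -
    \<comment> \<open>The support of \<open>w\<close> lies in \<open>J\<close> and dominates both \<open>e\<close> and the range of \<open>z\<close>.\<close>
    define w where "w = e + z \<cdot> hadj z"
    have zM: "z \<in> M" using z by (simp add: J_def)
    have wM: "w \<in> M" "hadj w = w" using eM zM by (auto simp: w_def mem hadj_mem is_projD)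
    have wJ: "q \<cdot> (x \<cdot> (w \<cdot> y)) = 0" if "x \<in> M" for x y
    proof -
      have "q \<cdot> (x \<cdot> e) = 0" "q \<cdot> (x \<cdot> z) = 0" using eJ z that by (auto simp: J_def)
      then have "(q \<cdot> (x \<cdot> e)) \<cdot> y = 0" "(q \<cdot> (x \<cdot> z)) \<cdot> (hadj z \<cdot> y) = 0" by simp_all
      then show ?thesis by (simp add: w_def compose_algebra)
    qed
    obtain k y where k: "k \<in> M" "is_proj k" "w \<cdot> k = 0"
      and y: "\<And>h. (\<lambda>n. (w \<cdot> y n) h) \<longlonglongrightarrow> h - blinfun_apply k h"
      using kernel_projection[OF wM] by metis
    have ker: "e (k h) = 0 \<and> hadj z (k h) = 0" for h
    proof -
      have "w (k h) = 0" using k(3) by (metis blinfun_apply_blinfun_compose blinfun.zero_left)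
      then have "inner (e (k h)) (k h) + inner (z (hadj z (k h))) (k h) = 0"
        by (simp add: w_def blinfun.add_left inner_add_left[symmetric])
      then have "(norm (e (k h)))\<^sup>2 + (norm (hadj z (k h)))\<^sup>2 = 0"
        by (simp add: proj_inner[OF eM(2)] hadj_inner[of z] power2_norm_eq_inner)
      then show ?thesis by (simp add: add_nonneg_eq_0_iff)
    qed
    have ek: "e \<cdot> k = 0" and zk: "hadj z \<cdot> k = 0" by (rule blinfun_eqI, simp add: ker)+
    have kz: "k \<cdot> z = 0" using arg_cong[OF zk, of hadj] k(2) by (simp add: is_projD)
    define f where "f = id_blinfun - k"
    have f: "f \<in> M" "is_proj f" using k by (auto simp: f_def mem is_proj_minus_id)
    have "q \<cdot> (x \<cdot> f) = 0" if "x \<in> M" for x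
    proof (rule strong_limit_unique)
      have "(\<lambda>n. (q \<cdot> x) ((w \<cdot> y n) h)) \<longlonglongrightarrow> (q \<cdot> x) (h - k h)" for h by (intro tendsto_intros y)
      then show "(\<lambda>n. (q \<cdot> (x \<cdot> (w \<cdot> y n))) h) \<longlonglongrightarrow> (q \<cdot> (x \<cdot> f)) h" for h
        by (simp add: f_def blinfun.diff_left)
      show "(\<lambda>n. (q \<cdot> (x \<cdot> (w \<cdot> y n))) h) \<longlonglongrightarrow> blinfun_apply 0 h" for h
        by (simp only: wJ[OF that]) simp
    qed
    then have fX: "f \<in> X" using f by (simp add: X_def J_def)
    have fe: "f \<cdot> e = e"
      using proj_orth_commute[OF eM(2) k(2) ek] by (simp add: f_def compose_algebra)
    have "f = e" using tr_sub_eq[OF f eM fe] max[OF fX fe] by simp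
    moreover have "f \<cdot> z = z" by (simp add: f_def compose_algebra kz)
    ultimately show ?thesis by simp
  qed
  have half: "e \<cdot> (x \<cdot> e) = x \<cdot> e" if x: "x \<in> M" for x
  proof (rule unit)
    have "q \<cdot> ((y \<cdot> x) \<cdot> e) = 0" if "y \<in> M" for y using eJ that x by (auto simp: J_def mem)
    then show "x \<cdot> e \<in> J" using x eM by (auto simp: J_def mem blinfun_compose_assoc)
  qed
  have "e \<cdot> x = x \<cdot> e" if x: "x \<in> M" for x
    using arg_cong[OF half[OF hadj_mem[OF x]], of hadj] half[OF x] eM by (simp add: is_projD blinfun_compose_assoc)
  then have "e = 0 \<or> e = id_blinfun" using eM by (intro central_projection)
  moreover have "p \<in> J" using p p0 by (simp add: J_def)
  then have "e \<cdot> p = p" by (rule unit)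
  then have "e \<noteq> 0" using p by auto
  ultimately have "id_blinfun \<in> J" using eJ by simp
  then have "q \<cdot> (id_blinfun \<cdot> id_blinfun) = 0" using id_mem by (auto simp: J_def)
  then show False using q by simp
qed

text \<open>
  Let \<open>h = y\<^sup>* y\<close> and let \<open>e\<close> be a nonzero spectral projection on which \<open>h \<ge> \<mu> > 0\<close>.  On \<open>e\<close> the inverse square root \<open>g\<close>
  of \<open>h\<close> exists, and \<open>y g\<close> is a partial isometry with initial projection \<open>e\<close>.  The last conclusion says that \<open>g\<close>
  inherits the right supports of \<open>h\<close>.
\<close>

lemma polar_partial_isometry:
  assumes y: "y \<in> M" "y \<noteq> 0" "norm y \<le> 1"
  obtains g where "g \<in> M" "partial_isometry (y \<cdot> g)" "y \<cdot> g \<noteq> 0"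
    "\<And>p. (hadj y \<cdot> y) \<cdot> p = hadj y \<cdot> y \<Longrightarrow> g \<cdot> p = g"
proof -
  define h where "h = hadj y \<cdot> y"
  have h: "h \<in> M" "hadj h = h" "psd h" using y by (auto simp: h_def mem hadj_mem intro: psd_hadj_self)
  have h_sq: "inner (h x) x = (norm (y x))\<^sup>2" for x by (simp add: h_def norm_hadj_sq)
  have "h \<noteq> 0" using y hadj_compose_self_eq_0 unfolding h_def by blast
  define N where "N = bicommutant_in M {h}"
  interpret N: abelian_algebra N
    unfolding N_def using h by (intro abelian_bicommutant_in) auto
  have NM: "N \<subseteq> M" unfolding N_def by (rule bicommutant_in_sub)
  have hN: "h \<in> N" using sub_bicommutant_in[of "{h}"] h by (auto simp: N_def)
  \<comment> \<open>Any positive level below \<open>\<parallel>h\<parallel>\<close> cuts out a nonzero \<open>e\<close>; \<open>\<mu> \<le> 1\<close> keeps \<open>k\<close> between \<open>\<mu>\<close> and \<open>1\<close>.\<close>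
  define \<mu> where "\<mu> = min 1 (norm h / 2)"
  have \<mu>: "0 < \<mu>" "\<mu> \<le> 1" "\<mu> < norm h" using \<open>h \<noteq> 0\<close> by (auto simp: \<mu>_def min_def)
  obtain e where e: "e \<in> N" "is_proj e" "psd (h \<cdot> e - \<mu> *\<^sub>R e)"
     "psd (\<mu> *\<^sub>R (id_blinfun - e) - h \<cdot> (id_blinfun - e))"
    using N.spectral_projection[OF hN h(2)] by metis
  have "e \<noteq> 0"
  proof
    assume "e = 0"
    then have "norm h \<le> \<mu>"
      using e(4) psd_add[OF psd_scaleR[OF _ psd_proj[OF is_proj_id]] h(3), of \<mu>] \<mu>
      by (intro norm_hermitian_le_psd) auto
    then show False using \<mu> by simp
  qed
  define k where "k = h \<cdot> e + (id_blinfun - e)"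
  have kN: "k \<in> N" using hN e by (auto simp: k_def intro: N.mem)
  have k_sym: "hadj k = k" using N.commute[OF hN e(1)] h e by (simp add: k_def is_projD)
  have norm_k: "norm (id_blinfun - k) \<le> 1 - \<mu>"
  proof (rule norm_hermitian_le)
    show "hadj (id_blinfun - k) = id_blinfun - k" by (simp add: k_sym)
    fix x
    have eq: "id_blinfun - k = e - h \<cdot> e" by (simp add: k_def)
    have ehe: "h \<cdot> e = e \<cdot> (h \<cdot> e)"
      using N.left_commute[OF e(1) hN, of e] e(2) by (simp add: is_projD)
    then have "inner ((h \<cdot> e) x) x = inner ((e \<cdot> (h \<cdot> e)) x) x" by simp
    also have "\<dots> = inner (h (e x)) (e x)" using e by (simp add: hadj_inner[of e] is_projD)
    also have "\<dots> = (norm (y (e x)))\<^sup>2" by (rule h_sq)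
    finally have he: "inner ((h \<cdot> e) x) x = (norm (y (e x)))\<^sup>2" .
    have "norm (y (e x)) \<le> norm (e x)"
      using order_trans[OF norm_blinfun mult_right_mono[OF y(3)]] by simp
    then have "(norm (y (e x)))\<^sup>2 \<le> (norm (e x))\<^sup>2" by (simp add: power_mono)
    moreover have "\<mu> * (norm (e x))\<^sup>2 \<le> (norm (y (e x)))\<^sup>2"
      using psdD(1)[OF e(3), of x] he by (simp add: blinfun.bilinear_simps inner_diff_left proj_inner[OF e(2)])
    moreover have "(1 - \<mu>) * (norm (e x))\<^sup>2 \<le> (1 - \<mu>) * (norm x)\<^sup>2"
      using \<mu> e by (intro mult_left_mono power_mono proj_norm_le) auto
    ultimately show "\<bar>inner ((id_blinfun - k) x) x\<bar> \<le> (1 - \<mu>) * (norm x)\<^sup>2"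
      unfolding eq using he by (simp add: blinfun.bilinear_simps inner_diff_left proj_inner[OF e(2)] algebra_simps)
  qed (use \<mu> in auto)
  obtain s where s: "s \<in> N" "hadj s = s" "s \<cdot> s = k"
    using N.sqrt_near_id[OF kN k_sym norm_k] \<mu> by auto
  \<comment> \<open>The inverse of \<open>k\<close> is the fixed point of the contraction \<open>z \<mapsto> 1 + (1 - k) z\<close>.\<close>
  have "\<exists>!z\<in>N. id_blinfun + (id_blinfun - k) \<cdot> z = z"
  proof (rule Banach_fix[of _ "1 - \<mu>"])
    show "complete N" using N.closed_N by (simp add: complete_eq_closed)
    show "(\<lambda>z. id_blinfun + (id_blinfun - k) \<cdot> z) ` N \<subseteq> N" using kN by (auto intro!: N.mem)
    show "dist (id_blinfun + (id_blinfun - k) \<cdot> x) (id_blinfun + (id_blinfun - k) \<cdot> z) \<le> (1 - \<mu>) * dist x z" for x z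
    proof -
      have "id_blinfun + (id_blinfun - k) \<cdot> x - (id_blinfun + (id_blinfun - k) \<cdot> z) = (id_blinfun - k) \<cdot> (x - z)"
        by (simp add: compose_algebra)
      then show ?thesis
        using order_trans[OF norm_blinfun_compose mult_right_mono[OF norm_k]] by (simp add: dist_norm)
    qed
  qed (use \<mu> N.zero_mem in auto)
  then obtain z where z: "z \<in> N" "id_blinfun + (id_blinfun - k) \<cdot> z = z" by blast
  have kz: "k \<cdot> z = id_blinfun" using z(2) by (simp add: compose_algebra algebra_simps)
  have zk: "z \<cdot> k = id_blinfun" using kz N.commute[OF z(1) kN] by simp
  have z_sym: "hadj z = z"
  proof -
    have "hadj z \<cdot> k = id_blinfun" using arg_cong[OF kz, of hadj] k_sym by simp
    then have "hadj z \<cdot> (k \<cdot> z) = z" by (metis blinfun_compose_assoc blinfun_compose_id(1))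
    then show ?thesis by (simp add: kz)
  qed
  define g where "g = s \<cdot> (z \<cdot> e)"
  have gN: "g \<in> N" using s z e by (auto simp: g_def intro: N.mem)
  have g_sym: "hadj g = g"
    using s z_sym e N.commute[OF s(1) z(1)] N.commute[OF s(1) e(1)] N.commute[OF z(1) e(1)]
      N.left_commute[OF e(1) z(1), of s] N.left_commute[OF z(1) s(1), of e]
    by (simp add: g_def is_projD blinfun_compose_assoc)
  have ke: "k \<cdot> e = h \<cdot> e" using e by (simp add: k_def compose_algebra is_projD)
  have ghg: "g \<cdot> (h \<cdot> g) = e"
  proof -
    have "g \<cdot> (h \<cdot> g) = s \<cdot> (s \<cdot> (z \<cdot> (z \<cdot> (h \<cdot> e))))"
      by (simp only: g_def blinfun_compose_assoc N.left_commute[OF hN s(1)] N.left_commute[OF hN z(1)]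
        N.left_commute[OF e(1) s(1)] N.left_commute[OF e(1) z(1)] N.left_commute[OF e(1) hN]
        N.left_commute[OF z(1) s(1)] is_projD(1)[OF e(2)])
    also have "\<dots> = (s \<cdot> s) \<cdot> (z \<cdot> ((z \<cdot> k) \<cdot> e))" by (simp add: ke[symmetric] blinfun_compose_assoc)
    also have "\<dots> = (k \<cdot> z) \<cdot> e" by (simp add: s(3) zk blinfun_compose_assoc)
    finally show ?thesis by (simp add: kz)
  qed
  have vv: "hadj (y \<cdot> g) \<cdot> (y \<cdot> g) = e" using ghg by (simp add: g_sym h_def blinfun_compose_assoc)
  have ge: "g \<cdot> e = g" using e by (simp add: g_def blinfun_compose_assoc is_projD)
  show thesis
  proof (rule that)
    show "g \<in> M" using gN NM by blast
    show "partial_isometry (y \<cdot> g)" using vv ge by (simp add: partial_isometry_def blinfun_compose_assoc)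
    show "y \<cdot> g \<noteq> 0" using vv \<open>e \<noteq> 0\<close> by auto
    fix p assume "(hadj y \<cdot> y) \<cdot> p = hadj y \<cdot> y"
    then have hp: "h \<cdot> p = h" by (simp add: h_def)
    have "e = z \<cdot> (e \<cdot> h)" using zk ke N.commute[OF hN e(1)] by (metis blinfun_compose_assoc blinfun_compose_id(1))
    then have "e \<cdot> p = e" using hp by (metis blinfun_compose_assoc)
    then show "g \<cdot> p = g" by (simp add: g_def blinfun_compose_assoc)
  qed
qed

lemma nonzero_partial_isometry:
  assumes p: "p \<in> M" "is_proj p" "p \<noteq> 0" and q: "q \<in> M" "is_proj q" "q \<noteq> 0"
  obtains v where "v \<in> M" "partial_isometry v" "v \<noteq> 0" "v \<cdot> p = v" "q \<cdot> v = v"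
proof -
  obtain x where x: "x \<in> M" "q \<cdot> (x \<cdot> p) \<noteq> 0" using corner_nonzero[OF p q] by blast
  define y where "y = (1 / norm (q \<cdot> (x \<cdot> p))) *\<^sub>R (q \<cdot> (x \<cdot> p))"
  have y: "y \<in> M" "y \<noteq> 0" "norm y \<le> 1" using x p q by (auto simp: y_def mem)
  have yp: "y \<cdot> p = y" and qy: "q \<cdot> y = y" using p q by (simp_all add: y_def compose_algebra is_projD is_proj_assoc)
  obtain g where g: "g \<in> M" "partial_isometry (y \<cdot> g)" "y \<cdot> g \<noteq> 0"
    "\<And>p. (hadj y \<cdot> y) \<cdot> p = hadj y \<cdot> y \<Longrightarrow> g \<cdot> p = g"
    using polar_partial_isometry[OF y] by metis
  have "g \<cdot> p = g" using yp by (intro g(4)) (simp add: blinfun_compose_assoc)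
  then show thesis
    using that[of "y \<cdot> g"] g y qy by (metis blinfun_compose_assoc compose_mem)
qed

end

lemma partial_isometry_supports:
  assumes "is_proj p" "hadj v \<cdot> v = p" "v \<cdot> hadj v = q"
  shows "v \<cdot> p = v" "p \<cdot> hadj v = hadj v" "q \<cdot> v = v" "hadj v \<cdot> q = hadj v"
proof -
  have "hadj v \<cdot> (v \<cdot> p) = p"
    using assms(2) is_projD(1)[OF assms(1)] by (simp add: blinfun_compose_assoc[symmetric])
  then have "hadj (v - v \<cdot> p) \<cdot> (v - v \<cdot> p) = 0"
    using assms(2) by (simp add: compose_algebra is_projD[OF assms(1)])
  then have "v - v \<cdot> p = 0" by (rule hadj_compose_self_eq_0)
  then show vp: "v \<cdot> p = v" by simp
  from arg_cong[OF this, of hadj] show pv: "p \<cdot> hadj v = hadj v" using is_projD[OF assms(1)] by simp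
  show "q \<cdot> v = v" unfolding assms(3)[symmetric] blinfun_compose_assoc assms(2) by (rule vp)
  show "hadj v \<cdot> q = hadj v" unfolding assms(3)[symmetric] blinfun_compose_assoc[symmetric] assms(2) by (rule pv)
qed

lemma orthogonal_sum_supports:
  assumes "w \<cdot> hadj v = 0" "hadj v \<cdot> w = 0"
  shows "hadj (v + w) \<cdot> (v + w) = hadj v \<cdot> v + hadj w \<cdot> w"
    "(v + w) \<cdot> hadj (v + w) = v \<cdot> hadj v + w \<cdot> hadj w"
proof -
  have "v \<cdot> hadj w = 0" "hadj w \<cdot> v = 0"
    using arg_cong[OF assms(1), of hadj] arg_cong[OF assms(2), of hadj] by simp_all
  then show "hadj (v + w) \<cdot> (v + w) = hadj v \<cdot> v + hadj w \<cdot> w"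
    "(v + w) \<cdot> hadj (v + w) = v \<cdot> hadj v + w \<cdot> hadj w"
    using assms by (simp_all add: compose_algebra)
qed

context diffuse_tracial_factor
begin

text \<open>
  Let \<open>v\<close> be a maximal partial isometry from a part of \<open>e\<close> to a part of \<open>f\<close>.  The two remainders have equal traces; if
  they were nonzero, a nonzero partial isometry between them would extend \<open>v\<close>.
\<close>

lemma equal_trace_equivalent:
  assumes e: "e \<in> M" "is_proj e" and f: "f \<in> M" "is_proj f" and tr: "tr e = tr f"
  obtains v where "v \<in> M" "hadj v \<cdot> v = e" "v \<cdot> hadj v = f"
proof -
  define X where "X = {v \<in> M. partial_isometry v \<and> v \<cdot> e = v \<and> f \<cdot> v = v}"
  have "\<exists>x\<in>X. \<forall>y\<in>X. pi_extends x y \<longrightarrow> tr (hadj y \<cdot> y) = tr (hadj x \<cdot> x)"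
  proof (rule maximal_element_countable_chains[of 0 X pi_extends "\<lambda>v. tr (hadj v \<cdot> v)" 1])
    show "0 \<in> X" by (auto simp: X_def mem partial_isometry_def)
    show "pi_extends x x" if "x \<in> X" for x using that by (auto simp: X_def intro: pi_extends_refl)
    show "pi_extends x z" if "x \<in> X" "pi_extends x y" "pi_extends y z" for x y z
      using that by (auto simp: X_def intro: pi_extends_trans)
    show "tr (hadj x \<cdot> x) \<le> tr (hadj y \<cdot> y)" if "x \<in> X" "y \<in> X" "pi_extends x y" for x y
      by (rule tr_sub_le) (use that in \<open>auto simp: X_def mem hadj_mem intro: partial_isometryD pi_extends_support\<close>)
    show "tr (hadj x \<cdot> x) \<le> 1" if "x \<in> X" for x
      by (rule tr_proj_le_1) (use that in \<open>auto simp: X_def mem hadj_mem intro: partial_isometryD\<close>)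
    show "\<exists>u\<in>X. \<forall>n. pi_extends (v n) u" if v: "\<And>n. v n \<in> X" "\<And>n. pi_extends (v n) (v (Suc n))" for v
    proof -
      have vX: "v n \<in> M" "partial_isometry (v n)" "v n \<cdot> e = v n" "f \<cdot> v n = v n" for n
        using v(1)[of n] by (auto simp: X_def)
      obtain u where u: "partial_isometry u" "\<And>n. pi_extends (v n) u"
        "\<And>x. (\<lambda>n. blinfun_apply (v n) x) \<longlonglongrightarrow> blinfun_apply u x"
        using pi_chain_limit[of v, OF vX(2) v(2)] by metis
      have "u \<in> M" by (rule strong_limit_mem[OF vX(1) u(3)])
      moreover have "u \<cdot> e = u"
      proof (rule strong_limit_unique[OF _ u(3)])
        have "v n x = v n (e x)" for n x using arg_cong[OF vX(3)[of n], of "\<lambda>a. a x"] by simp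
        then show "(\<lambda>n. v n x) \<longlonglongrightarrow> (u \<cdot> e) x" for x using u(3)[of "e x"] by simp
      qed
      moreover have "f \<cdot> u = u"
      proof (rule strong_limit_unique[OF _ u(3)])
        have "v n x = f (v n x)" for n x using arg_cong[OF vX(4)[of n], of "\<lambda>a. a x"] by simp
        moreover have "(\<lambda>n. f (v n x)) \<longlonglongrightarrow> f (u x)" for x by (intro tendsto_intros u(3))
        ultimately show "(\<lambda>n. v n x) \<longlonglongrightarrow> (f \<cdot> u) x" for x by simp
      qed
      ultimately show ?thesis using u(1,2) by (auto simp: X_def)
    qed
  qed
  then obtain v where v: "v \<in> X" and max: "\<And>w. w \<in> X \<Longrightarrow> pi_extends v w \<Longrightarrow> tr (hadj w \<cdot> w) = tr (hadj v \<cdot> v)" by blast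
  have vM: "v \<in> M" and pi: "partial_isometry v" and ve: "v \<cdot> e = v" and fv: "f \<cdot> v = v" using v by (auto simp: X_def)
  have ev: "e \<cdot> hadj v = hadj v" using arg_cong[OF ve, of hadj] e by (simp add: is_projD)
  have vf: "hadj v \<cdot> f = hadj v" using arg_cong[OF fv, of hadj] f by (simp add: is_projD)
  note piD = partial_isometryD[OF pi]
  define e' f' where "e' = e - hadj v \<cdot> v" and "f' = f - v \<cdot> hadj v"
  have evv: "e \<cdot> (hadj v \<cdot> v) = hadj v \<cdot> v" and fvv: "f \<cdot> (v \<cdot> hadj v) = v \<cdot> hadj v"
    using ev fv by (simp_all add: blinfun_compose_assoc[symmetric])
  have e': "e' \<in> M" "is_proj e'" and f': "f' \<in> M" "is_proj f'"
    using e f vM piD evv fvv by (auto simp: e'_def f'_def mem hadj_mem is_proj_diff)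
  have tr': "tr f' = tr e'"
    using tr tr_commute[of v "hadj v"] e f vM by (simp add: e'_def f'_def tr_diff mem hadj_mem)
  have "e' = 0"
  proof (rule ccontr)
    assume "e' \<noteq> 0"
    then have "f' \<noteq> 0" using tr_proj_pos[OF e'] tr' tr_zero by auto
    obtain w where w: "w \<in> M" "partial_isometry w" "w \<noteq> 0" "w \<cdot> e' = w" "f' \<cdot> w = w"
      using nonzero_partial_isometry[OF e' \<open>e' \<noteq> 0\<close> f' \<open>f' \<noteq> 0\<close>] by blast
    have "e' \<cdot> hadj v = 0" using piD by (simp add: e'_def compose_algebra ev)
    then have wv: "w \<cdot> hadj v = 0" using w(4) by (metis blinfun_compose_assoc blinfun_compose_zero(2))
    have "hadj v \<cdot> f' = 0" using piD by (simp add: f'_def compose_algebra vf)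
    then have vw: "hadj v \<cdot> w = 0" using w(5) by (metis blinfun_compose_assoc blinfun_compose_zero(1))
    have vw': "v \<cdot> hadj w = 0" using arg_cong[OF wv, of hadj] by simp
    note supp = orthogonal_sum_supports[OF wv vw]
    have "partial_isometry (v + w)"
      unfolding partial_isometry_def supp(1)
      using piD(1) partial_isometryD(1)[OF w(2)] wv vw'
      by (simp add: compose_algebra blinfun_compose_assoc[symmetric, of w "hadj v" v]
          blinfun_compose_assoc[symmetric, of v "hadj w" w])
    moreover have "w \<cdot> e = w"
    proof -
      have "e' \<cdot> e = e'" using e ve by (simp add: e'_def compose_algebra is_projD)
      then show ?thesis using w(4) by (metis blinfun_compose_assoc)
    qed
    moreover have "f \<cdot> w = w"
    proof -
      have "f \<cdot> f' = f'" using f fvv by (simp add: f'_def compose_algebra is_projD)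
      then show ?thesis using w(5) by (metis blinfun_compose_assoc)
    qed
    ultimately have "v + w \<in> X" using vM w ve fv by (auto simp: X_def mem compose_algebra)
    moreover have "pi_extends v (v + w)"
      using piD(1) wv vw by (simp add: pi_extends_def compose_algebra blinfun_compose_assoc[symmetric, of w "hadj v" v])
    ultimately have "tr (hadj (v + w) \<cdot> (v + w)) = tr (hadj v \<cdot> v)" by (rule max)
    then have "tr (hadj w \<cdot> w) = 0" using vM w by (simp add: supp(1) tr_add mem hadj_mem del: hadj_simps)
    then show False using tr_faithful w by blast
  qed
  then have "f' = 0" using tr' f' by (intro tr_proj_eq_0) (simp_all add: tr_zero)
  show thesis using \<open>e' = 0\<close> \<open>f' = 0\<close> by (intro that[OF vM]) (simp_all add: e'_def f'_def)
qed

lemma carry_orthogonal_families: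
  assumes "finite I"
    and g: "\<And>i. i \<in> I \<Longrightarrow> g i \<in> M" "\<And>i. i \<in> I \<Longrightarrow> is_proj (g i)" "\<And>i j. i \<in> I \<Longrightarrow> j \<in> I \<Longrightarrow> i \<noteq> j \<Longrightarrow> g i \<cdot> g j = 0"
    and e: "\<And>i. i \<in> I \<Longrightarrow> e i \<in> M" "\<And>i. i \<in> I \<Longrightarrow> is_proj (e i)" "\<And>i j. i \<in> I \<Longrightarrow> j \<in> I \<Longrightarrow> i \<noteq> j \<Longrightarrow> e i \<cdot> e j = 0"
    and tr: "\<And>i. i \<in> I \<Longrightarrow> tr (g i) = tr (e i)"
  shows "\<exists>w\<in>M. hadj w \<cdot> w = (\<Sum>i\<in>I. g i) \<and> w \<cdot> hadj w = (\<Sum>i\<in>I. e i) \<and> (\<forall>i\<in>I. w \<cdot> g i \<cdot> hadj w = e i)"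
  using assms
proof (induction I)
  case empty
  show ?case by (auto intro!: bexI[of _ 0] mem)
next
  case (insert k I)
  define G E where "G = (\<Sum>i\<in>I. g i)" and "E = (\<Sum>i\<in>I. e i)"
  obtain w where w: "w \<in> M" "hadj w \<cdot> w = G" "w \<cdot> hadj w = E" "\<And>i. i \<in> I \<Longrightarrow> w \<cdot> g i \<cdot> hadj w = e i"
    using insert by (auto simp: G_def E_def)
  obtain v where v: "v \<in> M" "hadj v \<cdot> v = g k" "v \<cdot> hadj v = e k"
    using equal_trace_equivalent[of "g k" "e k"] insert.prems by (metis insertI1)
  have G: "is_proj G" unfolding G_def using insert by (intro is_proj_sum) auto
  have gk: "is_proj (g k)" using insert.prems by simp
  have Gk: "G \<cdot> g k = 0" and Ek: "E \<cdot> e k = 0"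
  proof -
    have "g i \<cdot> g k = 0" "e i \<cdot> e k = 0" if "i \<in> I" for i
      using insert.prems(3)[of i k] insert.prems(6)[of i k] insert.hyps that by auto
    then show "G \<cdot> g k = 0" "E \<cdot> e k = 0" by (simp_all add: G_def E_def compose_sum_left)
  qed
  note ws = partial_isometry_supports[OF G w(2,3)] and vs = partial_isometry_supports[OF gk v(2,3)]
  have wg: "w \<cdot> g k = 0" using ws(1) Gk by (metis blinfun_compose_assoc blinfun_compose_zero(2))
  have wv: "w \<cdot> hadj v = 0" using wg vs(2) by (metis blinfun_compose_assoc blinfun_compose_zero(1))
  have we: "hadj w \<cdot> e k = 0" using ws(4) Ek by (metis blinfun_compose_assoc blinfun_compose_zero(2))
  have wv': "hadj w \<cdot> v = 0" using we vs(3) by (metis blinfun_compose_assoc blinfun_compose_zero(1))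
  have vw: "v \<cdot> hadj w = 0" "hadj v \<cdot> w = 0"
    using arg_cong[OF wv, of hadj] arg_cong[OF wv', of hadj] by simp_all
  note supp = orthogonal_sum_supports[OF wv vw(2)]
  have "hadj (v + w) \<cdot> (v + w) = (\<Sum>i\<in>insert k I. g i)" "(v + w) \<cdot> hadj (v + w) = (\<Sum>i\<in>insert k I. e i)"
    using insert.hyps v w by (simp_all add: supp G_def E_def del: hadj_simps)
  moreover have "(v + w) \<cdot> g i \<cdot> hadj (v + w) = e i" if i: "i \<in> insert k I" for i
  proof (cases "i = k")
    case True
    have "(v + w) \<cdot> g k = v" by (simp add: compose_algebra vs(1) wg)
    then show ?thesis using True by (simp add: compose_algebra vw(1) v(3))
  next
    case False
    then have iI: "i \<in> I" using i by simp
    have "g k \<cdot> g i = 0" "g i \<cdot> g k = 0" using insert.prems(3) insert.hyps iI by auto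
    then have vg: "v \<cdot> g i = 0" and gv: "g i \<cdot> hadj v = 0"
      using vs(1,2) by (metis blinfun_compose_assoc blinfun_compose_zero)+
    have "(v + w) \<cdot> g i \<cdot> hadj (v + w) = w \<cdot> (g i \<cdot> hadj v) + w \<cdot> g i \<cdot> hadj w"
      by (simp add: compose_algebra vg gv)
    then show ?thesis by (simp only: gv w(4)[OF iI]) simp
  qed
  ultimately show ?case using v w by (intro bexI[of _ "v + w"]) (auto simp: mem simp del: hadj_simps)
qed

lemma unitary_carrying:
  assumes "finite I"
    and g: "\<And>i. i \<in> I \<Longrightarrow> g i \<in> M" "\<And>i. i \<in> I \<Longrightarrow> is_proj (g i)" "\<And>i j. i \<in> I \<Longrightarrow> j \<in> I \<Longrightarrow> i \<noteq> j \<Longrightarrow> g i \<cdot> g j = 0"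
    and e: "\<And>i. i \<in> I \<Longrightarrow> e i \<in> M" "\<And>i. i \<in> I \<Longrightarrow> is_proj (e i)" "\<And>i j. i \<in> I \<Longrightarrow> j \<in> I \<Longrightarrow> i \<noteq> j \<Longrightarrow> e i \<cdot> e j = 0"
    and tr: "\<And>i. i \<in> I \<Longrightarrow> tr (g i) = tr (e i)"
  shows "\<exists>u\<in>M. is_unitary u \<and> (\<forall>i\<in>I. u \<cdot> g i \<cdot> hadj u = e i)"
proof -
  \<comment> \<open>One more pair of projections, the complements, makes the two families exhaust the unit.\<close>
  define G E where "G = (\<Sum>i\<in>I. g i)" and "E = (\<Sum>i\<in>I. e i)"
  have G: "G \<in> M" "is_proj G" and E: "E \<in> M" "is_proj E"
    unfolding G_def E_def using assms by (auto intro!: mem is_proj_sum)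
  define g' e' where "g' = case_option (id_blinfun - G) g" and "e' = case_option (id_blinfun - E) e"
  have trGE: "tr G = tr E" unfolding G_def E_def using assms by (simp add: tr_sum)
  have Gg: "G \<cdot> g i = g i" if "i \<in> I" for i
  proof -
    have "G \<cdot> g i = (\<Sum>j\<in>I. if j = i then g i else 0)"
      unfolding G_def compose_sum_left using g that by (intro sum.cong) (auto simp: is_projD)
    then show ?thesis using that \<open>finite I\<close> by simp
  qed
  have Ee: "E \<cdot> e i = e i" if "i \<in> I" for i
  proof -
    have "E \<cdot> e i = (\<Sum>j\<in>I. if j = i then e i else 0)"
      unfolding E_def compose_sum_left using e that by (intro sum.cong) (auto simp: is_projD)
    then show ?thesis using that \<open>finite I\<close> by simp
  qed
  have gG: "g i \<cdot> G = g i" "e i \<cdot> E = e i" if "i \<in> I" for i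
    using proj_sub_commute[OF G(2) g(2)[OF that] Gg[OF that]] proj_sub_commute[OF E(2) e(2)[OF that] Ee[OF that]] by simp_all
  define I' where "I' = insert None (Some ` I)"
  have "\<exists>w\<in>M. hadj w \<cdot> w = (\<Sum>i\<in>I'. g' i) \<and> w \<cdot> hadj w = (\<Sum>i\<in>I'. e' i) \<and> (\<forall>i\<in>I'. w \<cdot> g' i \<cdot> hadj w = e' i)"
  proof (rule carry_orthogonal_families)
    show "finite I'" using \<open>finite I\<close> by (simp add: I'_def)
    show "g' i \<in> M" "is_proj (g' i)" "e' i \<in> M" "is_proj (e' i)" "tr (g' i) = tr (e' i)" if "i \<in> I'" for i
      using that G E g e tr trGE by (auto simp: I'_def g'_def e'_def mem is_proj_minus_id tr_diff)
    show "g' i \<cdot> g' j = 0" if "i \<in> I'" "j \<in> I'" "i \<noteq> j" for i j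
      using that by (cases i; cases j) (auto simp: I'_def g'_def compose_algebra Gg gG(1) g(3))
    show "e' i \<cdot> e' j = 0" if "i \<in> I'" "j \<in> I'" "i \<noteq> j" for i j
      using that by (cases i; cases j) (auto simp: I'_def e'_def compose_algebra Ee gG(2) e(3))
  qed
  moreover have "(\<Sum>i\<in>I'. g' i) = id_blinfun" "(\<Sum>i\<in>I'. e' i) = id_blinfun"
    using \<open>finite I\<close> by (simp_all add: I'_def g'_def e'_def sum.reindex G_def E_def)
  ultimately obtain u where "u \<in> M" "hadj u \<cdot> u = id_blinfun" "u \<cdot> hadj u = id_blinfun"
     and u: "\<forall>i\<in>I'. u \<cdot> g' i \<cdot> hadj u = e' i" by auto
  moreover have "u \<cdot> g i \<cdot> hadj u = e i" if "i \<in> I" for i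
    using bspec[OF u, of "Some i"] that by (simp add: I'_def g'_def e'_def)
  ultimately show ?thesis by blast
qed

end

section \<open>Averaging over unitaries\<close>

lemma disjoint_subsets_of_card:
  assumes "finite K" "finite X" "(\<Sum>k\<in>K. c k) \<le> card X"
  shows "\<exists>Y. (\<forall>k\<in>K. Y k \<subseteq> X \<and> card (Y k) = c k) \<and> (\<forall>k\<in>K. \<forall>l\<in>K. k \<noteq> l \<longrightarrow> Y k \<inter> Y l = {})"
  using assms
proof (induction K arbitrary: X)
  case (insert k K)
  have le: "c k + (\<Sum>k\<in>K. c k) \<le> card X" using insert.prems(2) insert.hyps by simp
  then have "c k \<le> card X" by simp
  then obtain Z where Z: "Z \<subseteq> X" "card Z = c k" "finite Z" by (rule obtain_subset_with_card_n)
  have fin: "finite (X - Z)" using insert.prems(1) by simp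
  have "(\<Sum>k\<in>K. c k) \<le> card (X - Z)" using le Z by (simp add: card_Diff_subset)
  from insert.IH[OF fin this]
  obtain Y where Y: "\<forall>k\<in>K. Y k \<subseteq> X - Z \<and> card (Y k) = c k" "\<forall>k\<in>K. \<forall>l\<in>K. k \<noteq> l \<longrightarrow> Y k \<inter> Y l = {}"
    by (elim exE conjE)
  define Y' where "Y' = Y(k := Z)"
  have k: "Y' k = Z" and K: "\<And>l. l \<in> K \<Longrightarrow> Y' l = Y l" using insert.hyps by (auto simp: Y'_def)
  have ZY: "Z \<inter> Y l = {}" "Y l \<inter> Z = {}" if "l \<in> K" for l using Y(1) that by blast+
  have "Y' l \<subseteq> X \<and> card (Y' l) = c l" if "l \<in> insert k K" for l
    using Y(1) Z K k that by (cases "l = k") auto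
  moreover have "Y' a \<inter> Y' b = {}" if "a \<in> insert k K" "b \<in> insert k K" "a \<noteq> b" for a b
    using Y(2) that by (cases "a = k"; cases "b = k") (simp_all add: k K ZY)
  ultimately show ?case by blast
qed simp

lemma add_mod_inj:
  fixes n :: nat
  assumes "(i + s) mod n = (i + s') mod n" "s < n" "s' < n"
  shows "s = s'"
  using assms
proof (induction s s' rule: linorder_wlog)
  case (le a b)
  then have "n dvd (i + b) - (i + a)" using mod_eq_dvd_iff_nat[of "i + a" "i + b" n] by simp
  then have "n dvd b - a" by simp
  moreover have "b - a < n" using le.prems by simp
  ultimately have "b - a = 0" using nat_dvd_not_less[of "b - a" n] by auto
  then show ?case using le.hyps by simp
qed simp

lemma sum_shift_mod:
  fixes f :: "nat \<Rightarrow> 'b :: comm_monoid_add"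
  shows "(\<Sum>s<n. f ((i + s) mod n)) = (\<Sum>j<n. f j)"
proof (cases "n = 0")
  case False
  have inj: "inj_on (\<lambda>s. (i + s) mod n) {..<n}" by (rule inj_onI) (auto dest: add_mod_inj)
  moreover have "(\<lambda>s. (i + s) mod n) ` {..<n} \<subseteq> {..<n}" using False by auto
  ultimately have "bij_betw (\<lambda>s. (i + s) mod n) {..<n} {..<n}"
    by (simp add: bij_betw_def endo_inj_surj)
  then show ?thesis by (rule sum.reindex_bij_betw)
qed simp

lemma proj_sum_absorb:
  assumes "finite I" "\<And>i. i \<in> I \<Longrightarrow> is_proj (f i)" "\<And>i j. i \<in> I \<Longrightarrow> j \<in> I \<Longrightarrow> i \<noteq> j \<Longrightarrow> f i \<cdot> f j = 0" "i \<in> I"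
  shows "f i \<cdot> (\<Sum>j\<in>I. f j) = f i"
proof -
  have "f i \<cdot> (\<Sum>j\<in>I. f j) = (\<Sum>j\<in>I. if j = i then f i else 0)"
    unfolding compose_sum_right using assms by (intro sum.cong) (auto simp: is_projD)
  then show ?thesis using assms by simp
qed

lemma orth_below:
  assumes "is_proj p" "is_proj p'" "p \<cdot> p' = 0" "is_proj a" "p \<cdot> a = a" "p' \<cdot> b = b"
  shows "a \<cdot> b = 0"
proof -
  have "a \<cdot> b = (a \<cdot> p) \<cdot> (p' \<cdot> b)" using proj_sub_commute[OF assms(1,4,5)] assms(6) by simp
  also have "\<dots> = a \<cdot> ((p \<cdot> p') \<cdot> b)" by (simp only: blinfun_compose_assoc)
  finally show ?thesis using assms(3) by simp
qed

context diffuse_tracial_factor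
begin

lemma equal_division:
  assumes q: "q \<in> M" "is_proj q" and n: "0 < (n :: nat)"
  shows "\<exists>e. (\<forall>i<n. e i \<in> M \<and> is_proj (e i) \<and> q \<cdot> e i = e i \<and> tr (e i) = tr q / n) \<and>
    (\<forall>i<n. \<forall>j<n. i \<noteq> j \<longrightarrow> e i \<cdot> e j = 0) \<and> (\<Sum>i<n. e i) = q"
proof -
  have "\<exists>e. (\<forall>i\<in>{..<n}. e i \<in> M \<and> is_proj (e i) \<and> q \<cdot> e i = e i \<and> tr (e i) = tr q / n) \<and>
      (\<forall>i\<in>{..<n}. \<forall>j\<in>{..<n}. i \<noteq> j \<longrightarrow> e i \<cdot> e j = 0)"
    by (rule orthogonal_subprojections) (use q n tr_proj_nonneg[OF q] in auto)
  then obtain e where e: "\<And>i. i < n \<Longrightarrow> e i \<in> M \<and> is_proj (e i) \<and> q \<cdot> e i = e i \<and> tr (e i) = tr q / n"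
      "\<And>i j. i < n \<Longrightarrow> j < n \<Longrightarrow> i \<noteq> j \<Longrightarrow> e i \<cdot> e j = 0"
    by auto
  have "(\<Sum>i<n. e i) = q"
  proof (rule tr_sub_eq[OF q])
    show "(\<Sum>i<n. e i) \<in> M" using e by (intro sum_mem) auto
    show "is_proj (\<Sum>i<n. e i)" using e by (intro is_proj_sum) auto
    show "q \<cdot> (\<Sum>i<n. e i) = (\<Sum>i<n. e i)" using e by (simp add: compose_sum_right)
    show "tr (\<Sum>i<n. e i) = tr q" proof -
      have "tr (\<Sum>i<n. e i) = (\<Sum>i<n. tr q / n)"
        using e by (subst tr_sum) (auto intro: sum.cong)
      then show ?thesis using n by simp
    qed
  qed
  with e show ?thesis by (intro exI[of _ e]) simp
qed

text \<open>
  The combinatorial core.  The bound does not depend on how the pieces are chosen: each entry of \<open>d\<close> is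
  rounded by less than \<open>1/n\<close>, and each \<open>q\<close> has at most \<open>card P\<close> pieces that are not reserved.
\<close>

lemma averaging:
  assumes P: "proj_partition M P" and Q: "proj_partition M Q"
    and d0: "\<And>q p. q \<in> Q \<Longrightarrow> p \<in> P \<Longrightarrow> 0 \<le> d q p"
    and d1: "\<And>q. q \<in> Q \<Longrightarrow> (\<Sum>p\<in>P. d q p) = 1"
    and dt: "\<And>p. p \<in> P \<Longrightarrow> (\<Sum>q\<in>Q. tr q * d q p) = tr p"
    and n: "0 < (n :: nat)"
  shows "\<exists>U. (\<forall>s<n. U s \<in> M \<and> is_unitary (U s)) \<and>
    (\<forall>p\<in>P. norm ((1 / n) *\<^sub>R (\<Sum>s<n. U s \<cdot> p \<cdot> hadj (U s)) - (\<Sum>q\<in>Q. d q p *\<^sub>R q)) \<le> (card P + 1) / n)"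
proof -
  note PD = proj_partitionD[OF P] and QD = proj_partitionD[OF Q]
  have "\<exists>e. (\<forall>i<n. e i \<in> M \<and> is_proj (e i) \<and> q \<cdot> e i = e i \<and> tr (e i) = tr q / n) \<and>
      (\<forall>i<n. \<forall>j<n. i \<noteq> j \<longrightarrow> e i \<cdot> e j = 0) \<and> (\<Sum>i<n. e i) = q" if "q \<in> Q" for q
    by (intro equal_division QD that n)
  then obtain e where e: "\<And>q i. q \<in> Q \<Longrightarrow> i < n \<Longrightarrow> e q i \<in> M \<and> is_proj (e q i) \<and> q \<cdot> e q i = e q i \<and> tr (e q i) = tr q / n"
    and e_orth: "\<And>q i j. q \<in> Q \<Longrightarrow> i < n \<Longrightarrow> j < n \<Longrightarrow> i \<noteq> j \<Longrightarrow> e q i \<cdot> e q j = 0"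
    and e_sum: "\<And>q. q \<in> Q \<Longrightarrow> (\<Sum>i<n. e q i) = q"
    by metis
  have e_orth': "e q i \<cdot> e q' j = 0" if "q \<in> Q" "q' \<in> Q" "q \<noteq> q'" "i < n" "j < n" for q q' i j
    by (rule orth_below[OF QD(3)[of q] QD(3)[of q'] QD(5)[of q q']]) (use that e in auto)
  \<comment> \<open>About \<open>n * d q p\<close> of the pieces of \<open>q\<close> are reserved for \<open>p\<close>.\<close>
  define c where "c q p = nat \<lfloor>n * d q p\<rfloor>" for q p
  have c_le: "c q p \<le> n * d q p" and c_ge: "n * d q p - 1 \<le> c q p" if "q \<in> Q" "p \<in> P" for q p
  proof -
    have "0 \<le> n * d q p" using d0[OF that] by simp
    then show "c q p \<le> n * d q p" "n * d q p - 1 \<le> c q p" unfolding c_def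
      by (rule of_nat_floor) linarith
  qed
  have "\<exists>Y. (\<forall>p\<in>P. Y p \<subseteq> {..<n} \<and> card (Y p) = c q p) \<and> (\<forall>p\<in>P. \<forall>p'\<in>P. p \<noteq> p' \<longrightarrow> Y p \<inter> Y p' = {})"
    if q: "q \<in> Q" for q
  proof (rule disjoint_subsets_of_card[OF PD(1)])
    have "real (\<Sum>p\<in>P. c q p) \<le> (\<Sum>p\<in>P. n * d q p)" using c_le[OF q] by (simp add: sum_mono)
    also have "\<dots> = real n" using d1[OF q] by (simp add: sum_distrib_left[symmetric])
    finally show "(\<Sum>p\<in>P. c q p) \<le> card {..<n}" by (simp only: of_nat_le_iff card_lessThan)
  qed simp
  then obtain Y where Y: "\<And>q p. q \<in> Q \<Longrightarrow> p \<in> P \<Longrightarrow> Y q p \<subseteq> {..<n} \<and> card (Y q p) = c q p"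
    and Y_disj: "\<And>q p p'. q \<in> Q \<Longrightarrow> p \<in> P \<Longrightarrow> p' \<in> P \<Longrightarrow> p \<noteq> p' \<Longrightarrow> Y q p \<inter> Y q p' = {}"
    by metis
  define A where "A p = (SIGMA q:Q. Y q p)" for p
  have A_fin: "finite (A p)" if "p \<in> P" for p
    unfolding A_def using QD(1) Y that by (intro finite_SigmaI) (auto intro: finite_subset)
  have A_D: "q \<in> Q \<and> i \<in> Y q p \<and> i < n" if "(q, i) \<in> A p" "p \<in> P" for q i p
    using that Y by (auto simp: A_def)
  have A_sum: "(\<Sum>(q, i)\<in>A p. f q) = (\<Sum>q\<in>Q. real (c q p) *\<^sub>R f q)" if "p \<in> P" for p and f :: "_ \<Rightarrow> 'b :: real_vector"
  proof -
    have "finite (Y q p)" if "q \<in> Q" for q using Y that \<open>p \<in> P\<close> by (meson finite_lessThan finite_subset)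
    then have "(\<Sum>(q, i)\<in>A p. f q) = (\<Sum>q\<in>Q. \<Sum>i\<in>Y q p. f q)"
      unfolding A_def using QD(1) by (intro sum.Sigma[symmetric]) auto
    also have "\<dots> = (\<Sum>q\<in>Q. real (c q p) *\<^sub>R f q)" using Y that by (simp add: sum_constant_scaleR)
    finally show ?thesis .
  qed
  \<comment> \<open>Subprojections of \<open>p\<close> with the traces of the pieces reserved for \<open>p\<close>, which fit by \<open>dt\<close>.\<close>
  have "\<exists>g. (\<forall>a\<in>A p. g a \<in> M \<and> is_proj (g a) \<and> p \<cdot> g a = g a \<and> tr (g a) = tr (fst a) / n) \<and>
     (\<forall>a\<in>A p. \<forall>b\<in>A p. a \<noteq> b \<longrightarrow> g a \<cdot> g b = 0)" if p: "p \<in> P" for p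
  proof -
    have "(\<Sum>a\<in>A p. tr (fst a) / n) = (\<Sum>(q, i)\<in>A p. tr q / n)" by (simp add: case_prod_beta)
    also have "\<dots> = (\<Sum>q\<in>Q. real (c q p) *\<^sub>R (tr q / n))" by (rule A_sum[OF p])
    also have "\<dots> \<le> (\<Sum>q\<in>Q. tr q * d q p)"
    proof (rule sum_mono)
      fix q assume q: "q \<in> Q"
      have "real (c q p) * (tr q / n) \<le> (n * d q p) * (tr q / n)"
        using c_le[OF q p] tr_proj_nonneg QD q by (intro mult_right_mono) auto
      then show "real (c q p) *\<^sub>R (tr q / n) \<le> tr q * d q p" using n by (simp add: mult.commute)
    qed
    finally have "(\<Sum>a\<in>A p. tr (fst a) / n) \<le> tr p" using dt[OF p] by simp
    moreover have "0 \<le> tr (fst a) / n" if "a \<in> A p" for a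
      using that tr_proj_nonneg QD by (auto simp: A_def)
    ultimately show ?thesis
      by (intro orthogonal_subprojections A_fin p PD)
  qed
  then obtain g where g: "\<And>p a. p \<in> P \<Longrightarrow> a \<in> A p \<Longrightarrow> g p a \<in> M \<and> is_proj (g p a) \<and> p \<cdot> g p a = g p a \<and> tr (g p a) = tr (fst a) / n"
    and g_orth: "\<And>p a b. p \<in> P \<Longrightarrow> a \<in> A p \<Longrightarrow> b \<in> A p \<Longrightarrow> a \<noteq> b \<Longrightarrow> g p a \<cdot> g p b = 0"
    by metis
  have g_orth': "g p a \<cdot> x = 0" if "p \<in> P" "p' \<in> P" "p \<noteq> p'" "a \<in> A p" "p' \<cdot> x = x" for p p' a x
    by (rule orth_below[OF PD(3)[of p] PD(3)[of p'] PD(5)[of p p']]) (use that g in auto)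
  define I where "I = (SIGMA p:P. A p)"
  define G where "G = (\<lambda>(p, a). g p a)"
  define E where "E s = (\<lambda>(p :: 'a \<Rightarrow>\<^sub>L 'a, q, i). e q ((i + s) mod n))" for s
  have I_fin: "finite I" unfolding I_def using PD(1) A_fin by (intro finite_SigmaI) auto
  have G1: "G x \<in> M \<and> is_proj (G x)" if "x \<in> I" for x
  proof -
    obtain p a where x: "p \<in> P" "a \<in> A p" "x = (p, a)" using \<open>x \<in> I\<close> unfolding I_def by (rule SigmaE)
    show ?thesis using g[OF x(1,2)] by (simp add: x(3) G_def)
  qed
  have G2: "G x \<cdot> G y = 0" if "x \<in> I" "y \<in> I" "x \<noteq> y" for x y
  proof -
    obtain p a where x: "p \<in> P" "a \<in> A p" "x = (p, a)" using \<open>x \<in> I\<close> unfolding I_def by (rule SigmaE)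
    obtain p' b where y: "p' \<in> P" "b \<in> A p'" "y = (p', b)" using \<open>y \<in> I\<close> unfolding I_def by (rule SigmaE)
    note xy = x y
    show ?thesis
    proof (cases "p = p'")
      case True
      then show ?thesis using xy g_orth[of p a b] that(3) by (simp add: G_def)
    next
      case False
      then show ?thesis using xy g_orth'[of p p' a "g p' b"] g[of p' b] by (simp add: G_def)
    qed
  qed
  have E1: "E s x \<in> M \<and> is_proj (E s x) \<and> tr (E s x) = tr (G x)" if "x \<in> I" for x s
  proof -
    obtain p q i where x: "x = (p, q, i)" "p \<in> P" "(q, i) \<in> A p" using \<open>x \<in> I\<close> by (auto simp: I_def)
    have "q \<in> Q" using A_D x by blast
    moreover have "(i + s) mod n < n" using n by simp
    ultimately show ?thesis using e[of q "(i + s) mod n"] g[OF x(2,3)] by (simp add: x(1) E_def G_def)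
  qed
  have E2: "E s x \<cdot> E s y = 0" if "x \<in> I" "y \<in> I" "x \<noteq> y" for x y s
  proof -
    obtain p q i where x: "x = (p, q, i)" "p \<in> P" "(q, i) \<in> A p" using \<open>x \<in> I\<close> by (auto simp: I_def)
    obtain p' q' j where y: "y = (p', q', j)" "p' \<in> P" "(q', j) \<in> A p'" using \<open>y \<in> I\<close> by (auto simp: I_def)
    have q: "q \<in> Q" "i \<in> Y q p" "i < n" "q' \<in> Q" "j \<in> Y q' p'" "j < n" using A_D x y by blast+
    have m: "(i + s) mod n < n" "(j + s) mod n < n" using n by simp_all
    show ?thesis
    proof (cases "q = q'")
      case True
      have "i \<noteq> j"
      proof
        assume "i = j"
        then have "p \<noteq> p'" using that(3) x y True by auto
        then show False using Y_disj[of q p p'] q x y True \<open>i = j\<close> by blast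
      qed
      then have "(i + s) mod n \<noteq> (j + s) mod n" using add_mod_inj[of s i n j] q by (auto simp: add.commute)
      then show ?thesis using e_orth[OF q(1) m] True by (simp add: x(1) y(1) E_def)
    next
      case False
      then show ?thesis using e_orth'[OF q(1,4) _ m] by (simp add: x(1) y(1) E_def)
    qed
  qed
  have "\<exists>u\<in>M. is_unitary u \<and> (\<forall>x\<in>I. u \<cdot> G x \<cdot> hadj u = E s x)" for s
    using I_fin G1 G2 E1 E2 by (intro unitary_carrying) auto
  then obtain U where U: "\<And>s. U s \<in> M" "\<And>s. hadj (U s) \<cdot> U s = id_blinfun" "\<And>s. U s \<cdot> hadj (U s) = id_blinfun"
    and UG: "\<And>s x. x \<in> I \<Longrightarrow> U s \<cdot> G x \<cdot> hadj (U s) = E s x" by metis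
  \<comment> \<open>The unitary \<open>U s\<close> places the unmatched part \<open>r p\<close> of \<open>p\<close> below the sum \<open>R s\<close> of the unreserved pieces.\<close>
  define r where "r p = p - (\<Sum>a\<in>A p. g p a)" for p
  define R where "R s = id_blinfun - (\<Sum>x\<in>I. E s x)" for s
  have sum_g: "is_proj (\<Sum>a\<in>A p. g p a)" if "p \<in> P" for p
    using that A_fin g g_orth by (intro is_proj_sum) auto
  have r: "is_proj (r p)" if "p \<in> P" for p
    unfolding r_def using that PD g sum_g by (intro is_proj_diff) (auto simp: compose_sum_right)
  have Gr: "G x \<cdot> r p = 0" if x: "x \<in> I" and p: "p \<in> P" for x p
  proof -
    obtain p' a where xa: "p' \<in> P" "a \<in> A p'" "x = (p', a)" using x unfolding I_def by (rule SigmaE)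
    show ?thesis
    proof (cases "p' = p")
      case True
      have "g p a \<cdot> p = g p a" using g[OF p, of a] xa True by (intro proj_sub_commute[OF PD(3)[OF p]]) auto
      moreover have "g p a \<cdot> (\<Sum>a\<in>A p. g p a) = g p a"
        using xa True A_fin g g_orth by (intro proj_sum_absorb) auto
      ultimately show ?thesis using xa True by (simp add: G_def r_def compose_algebra)
    next
      case False
      have "p \<cdot> r p = r p" unfolding r_def using g p PD(3)[OF p] by (simp add: compose_algebra compose_sum_right is_projD)
      then show ?thesis using g_orth'[of p' p a "r p"] xa p False by (simp add: G_def)
    qed
  qed
  define C where "C = id_blinfun - (\<Sum>x\<in>I. G x)"
  have C: "is_proj C" unfolding C_def using I_fin G1 G2 by (intro is_proj_minus_id is_proj_sum) auto
  have Cr: "psd (C - r p)" if "p \<in> P" for p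
  proof -
    have "(\<Sum>x\<in>I. G x) \<cdot> r p = 0"
      unfolding compose_sum_left using Gr that by (intro sum.neutral) auto
    then have "C \<cdot> r p = r p" by (simp add: C_def compose_algebra)
    with that show ?thesis by (intro psd_proj is_proj_diff C r)
  qed
  have UC: "U s \<cdot> C \<cdot> hadj (U s) = R s" for s
    using UG[of _ s] U(3)[of s] by (simp add: C_def R_def compose_algebra compose_sum_left compose_sum_right)
  have Up: "U s \<cdot> p \<cdot> hadj (U s) = (\<Sum>(q, i)\<in>A p. e q ((i + s) mod n)) + U s \<cdot> r p \<cdot> hadj (U s)"
    if p: "p \<in> P" for s p
  proof -
    have "U s \<cdot> g p a \<cdot> hadj (U s) = (case a of (q, i) \<Rightarrow> e q ((i + s) mod n))" if "a \<in> A p" for a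
      using UG[of "(p, a)" s] that p by (cases a) (simp add: I_def G_def E_def)
    then have "U s \<cdot> (\<Sum>a\<in>A p. g p a) \<cdot> hadj (U s) = (\<Sum>(q, i)\<in>A p. e q ((i + s) mod n))"
      by (simp add: compose_sum_left compose_sum_right)
    moreover have "p = (\<Sum>a\<in>A p. g p a) + r p" by (simp add: r_def)
    then have "U s \<cdot> p \<cdot> hadj (U s) = U s \<cdot> (\<Sum>a\<in>A p. g p a) \<cdot> hadj (U s) + U s \<cdot> r p \<cdot> hadj (U s)"
      by (metis compose_algebra(2,3))
    ultimately show ?thesis by simp
  qed
  have shift: "(\<Sum>s<n. \<Sum>(q, i)\<in>A p. e q ((i + s) mod n)) = (\<Sum>q\<in>Q. real (c q p) *\<^sub>R q)" if p: "p \<in> P" for p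
  proof -
    have "(\<Sum>s<n. \<Sum>(q, i)\<in>A p. e q ((i + s) mod n)) = (\<Sum>(q, i)\<in>A p. \<Sum>s<n. e q ((i + s) mod n))"
      by (subst sum.swap) (simp add: case_prod_beta)
    also have "\<dots> = (\<Sum>(q, i)\<in>A p. q)"
      unfolding sum_shift_mod using A_D p e_sum by (intro sum.cong) auto
    also have "\<dots> = (\<Sum>q\<in>Q. real (c q p) *\<^sub>R q)" by (rule A_sum[OF p])
    finally show ?thesis .
  qed
  define W where "W p = (1 / n) *\<^sub>R (\<Sum>s<n. U s \<cdot> r p \<cdot> hadj (U s))" for p
  define V where "V = (1 / n) *\<^sub>R (\<Sum>s<n. R s)"
  have W_psd: "psd (W p)" if "p \<in> P" for p
    unfolding W_def by (intro psd_scaleR psd_sum psd_conj psd_proj r that) simp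
  have VW_psd: "psd (V - W p)" if p: "p \<in> P" for p
  proof -
    have "V - W p = (1 / n) *\<^sub>R (\<Sum>s<n. U s \<cdot> (C - r p) \<cdot> hadj (U s))"
      by (simp add: V_def W_def UC[symmetric] compose_algebra sum_subtractf scaleR_diff_right)
    also have "psd \<dots>" by (intro psd_scaleR psd_sum psd_conj Cr p) simp
    finally show ?thesis .
  qed
  have idQ: "k *\<^sub>R id_blinfun = (\<Sum>q\<in>Q. k *\<^sub>R q)" for k
    using QD(6) by (simp add: scaleR_right.sum[symmetric])
  have V_eq: "V = (\<Sum>q\<in>Q. (1 - (\<Sum>p\<in>P. c q p) / n) *\<^sub>R q)"
  proof -
    have "(\<Sum>x\<in>I. E s x) = (\<Sum>p\<in>P. \<Sum>(q, i)\<in>A p. e q ((i + s) mod n))" for s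
    proof -
      have "(\<Sum>p\<in>P. \<Sum>a\<in>A p. E s (p, a)) = (\<Sum>(p, a)\<in>Sigma P A. E s (p, a))"
        using PD(1) A_fin by (intro sum.Sigma) auto
      then show ?thesis by (simp add: I_def E_def case_prod_beta)
    qed
    then have "(\<Sum>s<n. R s) = real n *\<^sub>R id_blinfun - (\<Sum>s<n. \<Sum>p\<in>P. \<Sum>(q, i)\<in>A p. e q ((i + s) mod n))"
      by (simp add: R_def sum_subtractf sum_constant_scaleR)
    also have "(\<Sum>s<n. \<Sum>p\<in>P. \<Sum>(q, i)\<in>A p. e q ((i + s) mod n)) = (\<Sum>p\<in>P. \<Sum>q\<in>Q. real (c q p) *\<^sub>R q)"
      by (subst sum.swap) (simp add: shift)
    also have "\<dots> = (\<Sum>q\<in>Q. real (\<Sum>p\<in>P. c q p) *\<^sub>R q)"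
      by (subst sum.swap) (simp add: scaleR_left.sum)
    finally show ?thesis using n
      by (simp add: V_def idQ sum_subtractf[symmetric] scaleR_diff_left[symmetric] scaleR_right.sum diff_divide_distrib)
  qed
  define K where "K = (real (card P) + 1) / n"
  have "norm ((1 / n) *\<^sub>R (\<Sum>s<n. U s \<cdot> p \<cdot> hadj (U s)) - (\<Sum>q\<in>Q. d q p *\<^sub>R q)) \<le> K" if p: "p \<in> P" for p
  proof -
    define \<gamma> where "\<gamma> q = d q p - c q p / n" for q
    define D where "D = (1 / n) *\<^sub>R (\<Sum>s<n. U s \<cdot> p \<cdot> hadj (U s)) - (\<Sum>q\<in>Q. d q p *\<^sub>R q)"
    have D: "D = W p - (\<Sum>q\<in>Q. \<gamma> q *\<^sub>R q)"
      using n by (simp add: D_def Up[OF p] sum.distrib shift[OF p] W_def \<gamma>_def scaleR_add_right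
          scaleR_right.sum scaleR_diff_left sum_subtractf)
    have \<gamma>: "0 \<le> \<gamma> q" "\<gamma> q \<le> 1 / n" if "q \<in> Q" for q
    proof -
      have eq: "\<gamma> q = (n * d q p - c q p) / n" using n by (simp add: \<gamma>_def diff_divide_distrib)
      have "0 \<le> n * d q p - c q p" "n * d q p - c q p \<le> 1" using c_le[OF that p] c_ge[OF that p] by simp_all
      then show "0 \<le> \<gamma> q" "\<gamma> q \<le> 1 / n" unfolding eq by (simp_all add: divide_right_mono)
    qed
    have low: "1 - card P / n \<le> (\<Sum>p\<in>P. c q p) / n" if "q \<in> Q" for q
    proof -
      have "(\<Sum>p\<in>P. n * d q p - 1) \<le> (\<Sum>p\<in>P. real (c q p))" using c_ge[OF that] by (intro sum_mono) auto
      then have "n - real (card P) \<le> (\<Sum>p\<in>P. real (c q p))"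
        using d1[OF that] by (simp add: sum_subtractf sum_distrib_left[symmetric])
      then have "(n - real (card P)) / n \<le> (\<Sum>p\<in>P. real (c q p)) / n" by (rule divide_right_mono) simp
      then show ?thesis using n by (simp add: diff_divide_distrib)
    qed
    have K1: "1 / n \<le> K" "K = card P / n + 1 / n" by (simp_all add: K_def divide_right_mono add_divide_distrib)
    have "K *\<^sub>R id_blinfun + D = W p + (\<Sum>q\<in>Q. (K - \<gamma> q) *\<^sub>R q)"
      by (simp add: D idQ scaleR_diff_left sum_subtractf)
    moreover have "psd (W p + (\<Sum>q\<in>Q. (K - \<gamma> q) *\<^sub>R q))"
    proof (intro psd_add W_psd p psd_sum psd_scaleR psd_proj QD(3))
      show "0 \<le> K - \<gamma> q" if "q \<in> Q" for q using \<gamma>(2)[OF that] K1(1) by simp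
    qed
    ultimately have lo: "psd (K *\<^sub>R id_blinfun + D)" by simp
    have "K *\<^sub>R id_blinfun - D = (V - W p) + (\<Sum>q\<in>Q. (K - (1 - (\<Sum>p\<in>P. c q p) / n) + \<gamma> q) *\<^sub>R q)"
      unfolding D V_eq idQ by (simp add: scaleR_diff_left scaleR_add_left sum_subtractf sum.distrib)
    moreover have "psd ((V - W p) + (\<Sum>q\<in>Q. (K - (1 - (\<Sum>p\<in>P. c q p) / n) + \<gamma> q) *\<^sub>R q))"
    proof (intro psd_add VW_psd p psd_sum psd_scaleR psd_proj QD(3))
      fix q assume q: "q \<in> Q"
      have "0 \<le> 1 / real n" by simp
      then show "0 \<le> K - (1 - (\<Sum>p\<in>P. c q p) / n) + \<gamma> q"
        using low[OF q] \<gamma>(1)[OF q] unfolding K1(2) by linarith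
    qed
    ultimately have "psd (K *\<^sub>R id_blinfun - D)" by simp
    then have "norm D \<le> K" using lo by (rule norm_hermitian_le_psd) (simp add: K_def)
    then show ?thesis by (simp add: D_def)
  qed
  then show ?thesis using U by (intro exI[of _ U]) (auto simp: K_def add.commute)
qed

end

section \<open>Doubly stochastic maps\<close>

lemma norm_conj_unitary_le:
  assumes "hadj u \<cdot> u = id_blinfun"
  shows "norm (u \<cdot> x \<cdot> hadj u) \<le> norm x"
proof -
  have "(norm (u h))\<^sup>2 = (norm h)\<^sup>2" for h
    by (simp only: norm_hadj_sq assms) (simp add: power2_norm_eq_inner)
  then have "norm (u h) = norm h" for h by simp
  then have u: "norm u \<le> 1" by (intro norm_blinfun_bound) auto
  have "norm (u \<cdot> x \<cdot> hadj u) \<le> norm (u \<cdot> x) * norm (hadj u)" by (rule norm_blinfun_compose)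
  also have "\<dots> \<le> (norm u * norm x) * norm u"
    by (intro mult_mono norm_blinfun_compose norm_hadj_le) auto
  also have "\<dots> \<le> (1 * norm x) * 1" using u by (intro mult_mono) auto
  finally show ?thesis by simp
qed

lemma norm_unitary_average_le:
  assumes "\<And>s. s < n \<Longrightarrow> hadj (U s) \<cdot> U s = id_blinfun"
  shows "norm ((1 / real n) *\<^sub>R (\<Sum>s<n. U s \<cdot> x \<cdot> hadj (U s))) \<le> norm x"
proof (cases "n = 0")
  case False
  have "norm (\<Sum>s<n. U s \<cdot> x \<cdot> hadj (U s)) \<le> (\<Sum>s<n. norm x)"
    by (rule order_trans[OF norm_sum sum_mono]) (use assms in \<open>auto intro: norm_conj_unitary_le\<close>)
  then show ?thesis using False by (simp add: field_simps)
qed simp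

locale doubly_stochastic_map = diffuse_tracial_factor M tr
  for M :: "('a :: {real_inner, banach} \<Rightarrow>\<^sub>L 'a) set" and tr +
  fixes T :: "('a \<Rightarrow>\<^sub>L 'a) \<Rightarrow> 'a \<Rightarrow>\<^sub>L 'a"
  assumes T_mem: "x \<in> M \<Longrightarrow> T x \<in> M"
    and T_add: "x \<in> M \<Longrightarrow> y \<in> M \<Longrightarrow> T (x + y) = T x + T y"
    and T_scaleR: "x \<in> M \<Longrightarrow> T (c *\<^sub>R x) = c *\<^sub>R T x"
    and T_id: "T id_blinfun = id_blinfun"
    and T_psd: "x \<in> M \<Longrightarrow> psd x \<Longrightarrow> psd (T x)"
    and T_tr: "x \<in> M \<Longrightarrow> tr (T x) = tr x"
begin

lemma T_zero: "T 0 = 0" using T_scaleR[OF zero_mem, of 0] by simp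

lemma T_diff: "x \<in> M \<Longrightarrow> y \<in> M \<Longrightarrow> T (x - y) = T x - T y"
  using T_add[of "x - y" y] by (simp add: mem)

lemma T_sum: "(\<And>i. i \<in> I \<Longrightarrow> f i \<in> M) \<Longrightarrow> T (\<Sum>i\<in>I. f i) = (\<Sum>i\<in>I. T (f i))"
  by (induction I rule: infinite_finite_induct) (auto simp: T_zero T_add mem)

lemma T_bound:
  assumes "x \<in> M" "hadj x = x"
  shows "psd (norm x *\<^sub>R id_blinfun - T x)" "psd (norm x *\<^sub>R id_blinfun + T x)"
  using T_psd[OF _ psd_norm_minus(1)[OF assms(2) order_refl]] T_psd[OF _ psd_norm_minus(2)[OF assms(2) order_refl]] assms(1)
  by (simp_all add: mem T_diff T_add T_scaleR T_id)

lemma T_hermitian: "x \<in> M \<Longrightarrow> hadj x = x \<Longrightarrow> hadj (T x) = T x"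
  using psdD(2)[OF T_bound(2)] by simp

lemma norm_T_le: "x \<in> M \<Longrightarrow> hadj x = x \<Longrightarrow> norm (T x) \<le> norm x"
  by (intro norm_hermitian_le_psd T_bound) auto

end

context diffuse_tracial_factor
begin

text \<open>
  The trace of \<open>q y\<close> is that of the positive operator \<open>q y q\<close>.
\<close>

lemma tr_proj_compose_nonneg:
  assumes q: "q \<in> M" "is_proj q" and y: "y \<in> M" "psd y"
  shows "0 \<le> tr (q \<cdot> y)"
proof -
  have "tr (q \<cdot> y) = tr (q \<cdot> (q \<cdot> y))" using q by (simp add: is_proj_assoc)
  also have "\<dots> = tr (q \<cdot> y \<cdot> hadj q)" using q y tr_commute[of q "q \<cdot> y"] by (simp add: mem is_projD)
  finally show ?thesis using tr_nonneg[OF _ psd_conj[OF y(2), of q]] q y by (simp add: mem hadj_mem)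
qed

lemma tr_proj_compose_le:
  assumes q: "q \<in> M" "is_proj q" and x: "x \<in> M" "hadj x = x" "norm x \<le> c"
  shows "\<bar>tr (q \<cdot> x)\<bar> \<le> c * tr q"
proof -
  have "0 \<le> tr (q \<cdot> (c *\<^sub>R id_blinfun - x))" "0 \<le> tr (q \<cdot> (c *\<^sub>R id_blinfun + x))"
    using q x psd_norm_minus[OF x(2,3)] by (auto intro!: tr_proj_compose_nonneg mem)
  then show ?thesis using q x by (simp add: compose_algebra tr_diff tr_add tr_scaleR mem abs_le_iff)
qed

end

context doubly_stochastic_map
begin

text \<open>
  Compared with \<open>averaging\<close>, the point is that \<open>d\<close> maps the coefficients of \<open>b\<close> to those of \<open>T b\<close> up to
  \<open>2 \<delta>\<close>, because both can be read off from the traces against the projections in \<open>Q\<close>.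
\<close>

lemma finite_approximation:
  assumes N1: "abelian_algebra N1" "N1 \<subseteq> M" and N2: "abelian_algebra N2" "N2 \<subseteq> M"
    and F: "finite F" "\<And>b. b \<in> F \<Longrightarrow> b \<in> N1" "\<And>b. b \<in> F \<Longrightarrow> hadj b = b" "\<And>b. b \<in> F \<Longrightarrow> T b \<in> N2"
    and \<epsilon>: "0 < \<epsilon>"
  shows "\<exists>n>0. \<exists>U. (\<forall>s<n. U s \<in> M \<and> is_unitary (U s)) \<and>
    (\<forall>b\<in>F. norm (T b - (1 / real n) *\<^sub>R (\<Sum>s<n. U s \<cdot> b \<cdot> hadj (U s))) \<le> \<epsilon>)"
proof -
  interpret N1: abelian_algebra N1 by fact
  interpret N2: abelian_algebra N2 by fact
  define \<delta> where "\<delta> = \<epsilon> / 5"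
  have \<delta>: "0 < \<delta>" using \<epsilon> by (simp add: \<delta>_def)
  have FM: "b \<in> M" if "b \<in> F" for b using F(2) that N1(2) by blast
  obtain P where P': "proj_partition N1 P" "\<forall>b\<in>F. \<exists>\<beta>. norm (b - (\<Sum>p\<in>P. \<beta> p *\<^sub>R p)) \<le> \<delta>"
    using N1.simultaneous_approximation[of F \<delta>] F \<delta> by blast
  have "\<And>a. a \<in> T ` F \<Longrightarrow> a \<in> N2" "\<And>a. a \<in> T ` F \<Longrightarrow> hadj a = a" using F FM T_hermitian by auto
  then obtain Q where Q': "proj_partition N2 Q" "\<forall>a\<in>T ` F. \<exists>\<alpha>. norm (a - (\<Sum>q\<in>Q. \<alpha> q *\<^sub>R q)) \<le> \<delta>"
    using N2.simultaneous_approximation[of "T ` F" \<delta>] F(1) \<delta> by blast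
  have P: "proj_partition M P" and Q: "proj_partition M Q"
    using proj_partition_mono[OF P'(1) N1(2)] proj_partition_mono[OF Q'(1) N2(2)] .
  note PD = proj_partitionD[OF P] and QD = proj_partitionD[OF Q]
  obtain \<beta> where \<beta>: "\<And>b. b \<in> F \<Longrightarrow> norm (b - (\<Sum>p\<in>P. \<beta> b p *\<^sub>R p)) \<le> \<delta>" using P'(2) by metis
  obtain \<alpha> where \<alpha>: "\<And>b. b \<in> F \<Longrightarrow> norm (T b - (\<Sum>q\<in>Q. \<alpha> b q *\<^sub>R q)) \<le> \<delta>"
  proof -
    have "\<forall>b\<in>F. \<exists>\<alpha>. norm (T b - (\<Sum>q\<in>Q. \<alpha> q *\<^sub>R q)) \<le> \<delta>" using Q'(2) by simp
    then show thesis using that by metis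
  qed
  have TP: "T p \<in> M" "psd (T p)" if "p \<in> P" for p
    using T_mem[OF PD(2)[OF that]] T_psd[OF PD(2)[OF that] psd_proj[OF PD(3)[OF that]]] .
  have tq: "0 < tr q" if "q \<in> Q" for q using that QD tr_proj_pos by blast
  \<comment> \<open>The matrix of \<open>T\<close> with respect to the two partitions.\<close>
  define d where "d q p = tr (q \<cdot> T p) / tr q" for q p
  have sum_TP: "(\<Sum>p\<in>P. T p) = id_blinfun" using T_sum[of P "\<lambda>p. p"] PD T_id by simp
  have d0: "0 \<le> d q p" if "q \<in> Q" "p \<in> P" for q p
    using tr_proj_compose_nonneg[OF QD(2,3)[OF that(1)] TP[OF that(2)]] tq[OF that(1)] by (simp add: d_def)
  have d1: "(\<Sum>p\<in>P. d q p) = 1" if q: "q \<in> Q" for q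
  proof -
    have "(\<Sum>p\<in>P. tr (q \<cdot> T p)) = tr (\<Sum>p\<in>P. q \<cdot> T p)" using q QD TP by (intro tr_sum[symmetric]) (auto intro: mem)
    also have "\<dots> = tr q" by (simp add: compose_sum_right[symmetric] sum_TP)
    finally show ?thesis using tq[OF q] by (simp add: d_def sum_divide_distrib[symmetric])
  qed
  have dt: "(\<Sum>q\<in>Q. tr q * d q p) = tr p" if p: "p \<in> P" for p
  proof -
    have "(\<Sum>q\<in>Q. tr q * d q p) = (\<Sum>q\<in>Q. tr (q \<cdot> T p))"
    proof (rule sum.cong[OF refl])
      show "tr q * d q p = tr (q \<cdot> T p)" if "q \<in> Q" for q using tq[OF that] by (simp add: d_def)
    qed
    also have "\<dots> = tr (\<Sum>q\<in>Q. q \<cdot> T p)" using p QD TP by (intro tr_sum[symmetric]) (auto intro: mem)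
    also have "\<dots> = tr p" using p PD by (simp add: compose_sum_left[symmetric] QD(6) T_tr)
    finally show ?thesis .
  qed
  define K where "K = (\<Sum>b\<in>F. \<Sum>p\<in>P. \<bar>\<beta> b p\<bar>)"
  have K: "(\<Sum>p\<in>P. \<bar>\<beta> b p\<bar>) \<le> K" if "b \<in> F" for b
    unfolding K_def using F(1) that by (intro member_le_sum[of b F "\<lambda>b. \<Sum>p\<in>P. \<bar>\<beta> b p\<bar>"]) (auto intro: sum_nonneg)
  have K0: "0 \<le> K" unfolding K_def by (intro sum_nonneg) auto
  obtain n :: nat where n: "0 < n" "K * ((card P + 1) / n) \<le> \<delta>"
  proof -
    obtain m :: nat where m: "K * (card P + 1) / \<delta> < m" using reals_Archimedean2 by blast
    moreover have "0 \<le> K * (card P + 1) / \<delta>" using K0 \<delta> by simp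
    ultimately have "0 < m" by (metis of_nat_0_less_iff order_le_less_trans)
    then show thesis using m \<delta> by (intro that[of m]) (auto simp: field_simps)
  qed
  obtain U where U: "\<forall>s<n. U s \<in> M \<and> is_unitary (U s)"
    and avg: "\<forall>p\<in>P. norm ((1 / n) *\<^sub>R (\<Sum>s<n. U s \<cdot> p \<cdot> hadj (U s)) - (\<Sum>q\<in>Q. d q p *\<^sub>R q)) \<le> (card P + 1) / n"
    using averaging[OF P Q d0 d1 dt n(1)] by blast
  define \<rho> where "\<rho> x = (1 / n) *\<^sub>R (\<Sum>s<n. U s \<cdot> x \<cdot> hadj (U s))" for x
  have \<rho>_diff: "\<rho> (x - y) = \<rho> x - \<rho> y" for x y
    by (simp add: \<rho>_def compose_algebra sum_subtractf scaleR_diff_right)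
  have \<rho>_sum: "\<rho> (\<Sum>p\<in>P. c p *\<^sub>R p) = (\<Sum>p\<in>P. c p *\<^sub>R \<rho> p)" for c
  proof -
    have "(\<Sum>s<n. U s \<cdot> (\<Sum>p\<in>P. c p *\<^sub>R p) \<cdot> hadj (U s)) = (\<Sum>s<n. \<Sum>p\<in>P. c p *\<^sub>R (U s \<cdot> p \<cdot> hadj (U s)))"
      by (simp add: compose_sum_left compose_sum_right compose_algebra)
    also have "\<dots> = (\<Sum>p\<in>P. c p *\<^sub>R (\<Sum>s<n. U s \<cdot> p \<cdot> hadj (U s)))"
      by (subst sum.swap) (simp add: scaleR_right.sum)
    finally show ?thesis by (simp add: \<rho>_def scaleR_right.sum mult.commute)
  qed
  have \<rho>_norm: "norm (\<rho> x) \<le> norm x" for x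
    unfolding \<rho>_def by (rule norm_unitary_average_le) (use U in auto)
  (* The five errors come from replacing b by b', then \<rho> p by its approximation, twice from
     comparing the coefficients through T b' and T b, and from replacing a' by T b. *)
  have "norm (T b - \<rho> b) \<le> \<epsilon>" if b: "b \<in> F" for b
  proof -
    define b' where "b' = (\<Sum>p\<in>P. \<beta> b p *\<^sub>R p)"
    define a' where "a' = (\<Sum>q\<in>Q. \<alpha> b q *\<^sub>R q)"
    define c where "c q = (\<Sum>p\<in>P. \<beta> b p * d q p)" for q
    have b'M: "b' \<in> M" and a'M: "a' \<in> M" unfolding b'_def a'_def using PD QD by (auto intro!: mem)
    have b'h: "hadj b' = b'" unfolding b'_def using PD(3) by (simp add: is_projD cong: sum.cong)
    have a'h: "hadj a' = a'" unfolding a'_def using QD(3) by (simp add: is_projD cong: sum.cong)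
    have nb: "norm (b - b') \<le> \<delta>" and na: "norm (T b - a') \<le> \<delta>" using \<beta>[OF b] \<alpha>[OF b] by (simp_all add: b'_def a'_def)
    have 1: "norm (\<rho> b - \<rho> b') \<le> \<delta>" using \<rho>_norm[of "b - b'"] nb by (simp add: \<rho>_diff)
    have 2: "norm (\<rho> b' - (\<Sum>q\<in>Q. c q *\<^sub>R q)) \<le> \<delta>"
    proof -
      have "(\<Sum>q\<in>Q. c q *\<^sub>R q) = (\<Sum>q\<in>Q. \<Sum>p\<in>P. \<beta> b p *\<^sub>R d q p *\<^sub>R q)"
        by (simp add: c_def scaleR_left.sum)
      also have "\<dots> = (\<Sum>p\<in>P. \<beta> b p *\<^sub>R (\<Sum>q\<in>Q. d q p *\<^sub>R q))"
        by (subst sum.swap) (simp add: scaleR_right.sum)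
      finally have "\<rho> b' - (\<Sum>q\<in>Q. c q *\<^sub>R q) = (\<Sum>p\<in>P. \<beta> b p *\<^sub>R (\<rho> p - (\<Sum>q\<in>Q. d q p *\<^sub>R q)))"
        by (simp add: b'_def \<rho>_sum scaleR_diff_right sum_subtractf)
      also have "norm \<dots> \<le> (\<Sum>p\<in>P. \<bar>\<beta> b p\<bar> * ((card P + 1) / n))"
      proof (rule order_trans[OF norm_sum sum_mono])
        fix p assume "p \<in> P"
        then have "norm (\<rho> p - (\<Sum>q\<in>Q. d q p *\<^sub>R q)) \<le> (card P + 1) / n" using avg by (simp add: \<rho>_def)
        then show "norm (\<beta> b p *\<^sub>R (\<rho> p - (\<Sum>q\<in>Q. d q p *\<^sub>R q))) \<le> \<bar>\<beta> b p\<bar> * ((card P + 1) / n)"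
          unfolding norm_scaleR by (intro mult_left_mono) auto
      qed
      also have "\<dots> \<le> K * ((card P + 1) / n)"
        unfolding sum_distrib_right[symmetric] by (intro mult_right_mono K b) auto
      finally show ?thesis using n(2) by simp
    qed
    have 3: "norm ((\<Sum>q\<in>Q. c q *\<^sub>R q) - a') \<le> 2 * \<delta>"
    proof -
      have "\<bar>c q - \<alpha> b q\<bar> \<le> 2 * \<delta>" if q: "q \<in> Q" for q
      proof -
        have qM: "q \<in> M" "is_proj q" using q QD by auto
        have "c q * tr q = (\<Sum>p\<in>P. \<beta> b p * tr (q \<cdot> T p))"
          using tq[OF q] by (simp add: c_def d_def sum_distrib_right)
        also have "\<dots> = tr (q \<cdot> T b')"
        proof -
          have "T b' = (\<Sum>p\<in>P. \<beta> b p *\<^sub>R T p)"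
            unfolding b'_def using PD(2) by (subst T_sum) (auto simp: T_scaleR intro!: mem)
          then have "q \<cdot> T b' = (\<Sum>p\<in>P. \<beta> b p *\<^sub>R (q \<cdot> T p))" by (simp add: compose_sum_right compose_algebra)
          also have "tr \<dots> = (\<Sum>p\<in>P. \<beta> b p * tr (q \<cdot> T p))"
            using qM TP by (subst tr_sum) (auto simp: tr_scaleR mem)
          finally show ?thesis by simp
        qed
        finally have cq: "c q * tr q = tr (q \<cdot> T b')" .
        have "\<alpha> b q * tr q = tr (q \<cdot> a')"
          unfolding a'_def by (simp add: proj_partition_compose_sum[OF Q q] tr_scaleR qM)
        then have "(c q - \<alpha> b q) * tr q = tr (q \<cdot> (T b' - a'))"
          using cq qM a'M T_mem[OF b'M] by (simp add: left_diff_distrib compose_algebra tr_diff mem)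
        moreover have "norm (T b' - a') \<le> 2 * \<delta>"
        proof -
          have "norm (T (b' - b)) \<le> norm (b' - b)" using b'M FM[OF b] b'h F(3)[OF b] by (intro norm_T_le) (auto intro: mem)
          then have "norm (T b' - T b) \<le> \<delta>" using nb b'M FM[OF b] by (simp add: T_diff norm_minus_commute)
          then show ?thesis using na norm_triangle_ineq[of "T b' - T b" "T b - a'"] by simp
        qed
        then have "\<bar>tr (q \<cdot> (T b' - a'))\<bar> \<le> 2 * \<delta> * tr q"
          using qM a'M a'h b'M b'h by (intro tr_proj_compose_le) (auto intro: mem T_mem simp: T_hermitian)
        ultimately have "\<bar>c q - \<alpha> b q\<bar> * tr q \<le> 2 * \<delta> * tr q" using tq[OF q] by (metis abs_mult abs_of_pos)
        then show ?thesis using tq[OF q] by simp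
      qed
      then have "norm (\<Sum>q\<in>Q. (c q - \<alpha> b q) *\<^sub>R q) \<le> 2 * \<delta>" using \<delta> by (intro norm_block_sum_le[OF Q]) auto
      then show ?thesis by (simp add: a'_def scaleR_diff_left sum_subtractf)
    qed
    have "norm (\<rho> b - T b) \<le> 5 * \<delta>"
      using norm_triangle_le[OF add_mono[OF norm_triangle_le[OF add_mono[OF 1 2]]
            norm_triangle_le[OF add_mono[OF 3 na[unfolded norm_minus_commute[of "T b"]]]]]]
      by simp
    then show ?thesis by (simp add: \<delta>_def norm_minus_commute)
  qed
  then show ?thesis using n(1) U unfolding \<rho>_def by blast
qed

end

section \<open>Complex Hilbert spaces\<close>

instance chilbert_space \<subseteq> banach ..

lemma cinner_scaleC_right: "cinner x (c *\<^sub>C y) = cnj c * cinner x y"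
  by (metis cinner_commute cinner_scaleC_left complex_cnj_mult)

lemma Im_cinner: "Im (cinner x y) = - inner (\<i> *\<^sub>C x) y"
  by (simp add: inner_Re_cinner cinner_scaleC_left)

lemma inner_scaleC_left:
  fixes x :: "'a :: complex_inner"
  shows "inner (c *\<^sub>C x) y = inner x (cnj c *\<^sub>C y)"
  by (simp add: inner_Re_cinner cinner_scaleC_left cinner_scaleC_right)

lemma inner_ii_ii:
  fixes x :: "'a :: complex_inner"
  shows "inner (\<i> *\<^sub>C x) (\<i> *\<^sub>C y) = inner x y"
  by (simp add: inner_Re_cinner cinner_scaleC_left cinner_scaleC_right)

lemma apply_scaleC: "A \<in> bounded_operators \<Longrightarrow> blinfun_apply A (c *\<^sub>C x) = c *\<^sub>C A x"
  by (simp add: bounded_operators_def clinear_on_def)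

lemma scaleC_minus_one: "(- 1) *\<^sub>C x = - (x :: 'a :: complex_vector)"
  using scaleR_scaleC[of "-1" x] by simp

lemma ii_ii: "\<i> *\<^sub>C (\<i> *\<^sub>C x) = - (x :: 'a :: complex_vector)"
  by (simp add: scaleC_scaleC scaleC_minus_one)

text \<open>
  The imaginary part of \<open>\<langle>x, y\<rangle>\<close> is \<open>- Re \<langle>\<i> x, y\<rangle>\<close>, so a complex linear operator which satisfies the adjoint
  identity for real parts satisfies it.
\<close>

lemma adj_eq_hadj:
  fixes A :: "'h :: chilbert_space \<Rightarrow>\<^sub>L 'h"
  assumes A: "A \<in> bounded_operators"
  shows "adj A = hadj A"
  unfolding adj_def
proof (rule the_equality)
  show "\<forall>x y. cinner (A x) y = cinner x (hadj A y)"
  proof (intro allI complex_eqI)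
    fix x y
    show "Re (cinner (A x) y) = Re (cinner x (hadj A y))"
      by (simp add: inner_Re_cinner[symmetric] hadj_inner)
    show "Im (cinner (A x) y) = Im (cinner x (hadj A y))"
      by (simp add: Im_cinner apply_scaleC[OF A, symmetric] hadj_inner)
  qed
  fix B assume "\<forall>x y. cinner (A x) y = cinner x (blinfun_apply B y)"
  then show "B = hadj A" by (intro hadj_eqI[symmetric]) (simp add: inner_Re_cinner)
qed

text \<open>
  If \<open>Re \<langle>\<i> A x, x\<rangle> = 0\<close> for all \<open>x\<close>, polarising at \<open>x + \<i> y\<close> shows that \<open>A\<close> is self-adjoint.
\<close>

lemma pos_op_iff_psd:
  fixes A :: "'h :: chilbert_space \<Rightarrow>\<^sub>L 'h"
  shows "pos_op A \<longleftrightarrow> A \<in> bounded_operators \<and> psd A"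
proof (cases "A \<in> bounded_operators")
  case A: True
  have pos: "pos_op A \<longleftrightarrow> (\<forall>x. 0 \<le> inner (A x) x) \<and> (\<forall>x. inner (\<i> *\<^sub>C A x) x = 0)"
    using A by (auto simp: pos_op_def complex_nonneg_Reals_iff inner_Re_cinner[symmetric] Im_cinner)
  have "hadj A = A" if z: "\<And>x. inner (\<i> *\<^sub>C A x) x = 0"
  proof (rule hadj_eqI)
    fix x y
    have "inner (\<i> *\<^sub>C A (x + \<i> *\<^sub>C y)) (x + \<i> *\<^sub>C y) = 0" by (rule z)
    also have "inner (\<i> *\<^sub>C A (x + \<i> *\<^sub>C y)) (x + \<i> *\<^sub>C y) =
        inner (\<i> *\<^sub>C A x) x + inner (\<i> *\<^sub>C A x) (\<i> *\<^sub>C y) + (inner (\<i> *\<^sub>C \<i> *\<^sub>C A y) x + inner (\<i> *\<^sub>C \<i> *\<^sub>C A y) (\<i> *\<^sub>C y))"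
      by (simp add: blinfun.add_right apply_scaleC[OF A] scaleC_add_right inner_add_left inner_add_right inner_diff_left)
    also have "inner (\<i> *\<^sub>C \<i> *\<^sub>C A y) (\<i> *\<^sub>C y) = inner (\<i> *\<^sub>C A y) y" by (rule inner_ii_ii)
    finally have "inner (A x) y - inner (A y) x = 0" by (simp add: z inner_ii_ii ii_ii)
    then show "inner (A x) y = inner x (A y)" by (simp add: inner_commute)
  qed
  moreover have "inner (\<i> *\<^sub>C A x) x = 0" if "hadj A = A" for x
  proof -
    have "inner (\<i> *\<^sub>C A x) x = inner (A (\<i> *\<^sub>C x)) x" by (simp add: apply_scaleC[OF A])
    also have "\<dots> = inner (\<i> *\<^sub>C x) (A x)" using that by (simp add: hadj_inner)
    also have "\<dots> = inner (\<i> *\<^sub>C (\<i> *\<^sub>C x)) (\<i> *\<^sub>C A x)" by (rule inner_ii_ii[symmetric])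
    also have "\<dots> = - inner (\<i> *\<^sub>C A x) x" by (simp only: ii_ii inner_minus_left inner_commute[of x])
    finally show ?thesis by simp
  qed
  ultimately show ?thesis unfolding pos using A by (auto simp: psd_def)
qed (simp add: pos_op_def)

lemma hadj_scaleC:
  fixes A :: "'h :: chilbert_space \<Rightarrow>\<^sub>L 'h"
  assumes "A \<in> bounded_operators" "hadj A \<in> bounded_operators"
  shows "hadj (c *\<^sub>C A) = cnj c *\<^sub>C hadj A"
  by (rule hadj_eqI) (simp add: scaleC_blinfun.rep_eq inner_scaleC_left hadj_inner apply_scaleC[OF assms(2)])

lemma norm_scaleC_blinfun_le:
  fixes A :: "'h :: chilbert_space \<Rightarrow>\<^sub>L 'h"
  shows "norm (c *\<^sub>C A) \<le> cmod c * norm A"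
  by (rule norm_blinfun_bound)
    (auto simp: scaleC_blinfun.rep_eq norm_scaleC mult.assoc intro: mult_left_mono norm_blinfun)

lemma star_subalgebraD:
  assumes "unital_star_subalgebra A"
  shows "A \<subseteq> bounded_operators" "id_blinfun \<in> A" "x \<in> A \<Longrightarrow> y \<in> A \<Longrightarrow> x + y \<in> A" "x \<in> A \<Longrightarrow> c *\<^sub>C x \<in> A"
    "x \<in> A \<Longrightarrow> r *\<^sub>R x \<in> A" "x \<in> A \<Longrightarrow> y \<in> A \<Longrightarrow> x - y \<in> A"
    "x \<in> A \<Longrightarrow> y \<in> A \<Longrightarrow> x \<cdot> y \<in> A" "x \<in> A \<Longrightarrow> hadj x \<in> A" "0 \<in> A"
proof -
  have A: "A \<subseteq> bounded_operators" "csubspace A" using assms by (auto simp: unital_star_subalgebra_def)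
  show "A \<subseteq> bounded_operators" by fact
  show "id_blinfun \<in> A" "x \<in> A \<Longrightarrow> y \<in> A \<Longrightarrow> x \<cdot> y \<in> A" using assms by (auto simp: unital_star_subalgebra_def)
  show "x \<in> A \<Longrightarrow> y \<in> A \<Longrightarrow> x + y \<in> A" using complex_vector.subspace_add[OF A(2)] by blast
  show sc: "x \<in> A \<Longrightarrow> c *\<^sub>C x \<in> A" for c x using complex_vector.subspace_scale[OF A(2)] by blast
  show "x \<in> A \<Longrightarrow> r *\<^sub>R x \<in> A" using sc by (simp add: scaleR_scaleC)
  show "x \<in> A \<Longrightarrow> y \<in> A \<Longrightarrow> x - y \<in> A" using complex_vector.subspace_diff[OF A(2)] by blast
  show "hadj x \<in> A" if "x \<in> A"
  proof -
    have "adj x \<in> A" using assms that by (simp add: unital_star_subalgebra_def)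
    moreover have "x \<in> bounded_operators" using A(1) that by blast
    ultimately show ?thesis by (simp add: adj_eq_hadj)
  qed
  show "0 \<in> A" using complex_vector.subspace_0[OF A(2)] .
qed

lemma strong_operator_closed_sequentially:
  assumes M: "closedin strong_operator_topology M" and f: "\<And>n :: nat. f n \<in> M"
    and lim: "\<And>x. (\<lambda>n. blinfun_apply (f n) x) \<longlonglongrightarrow> blinfun_apply g x"
  shows "g \<in> M"
proof (rule ccontr)
  assume "g \<notin> M"
  have "openin strong_operator_topology (- M)"
    using M by (simp add: closedin_def strong_operator_topology_topspace Compl_eq_Diff_UNIV)
  then obtain U where U: "open U" "- M = blinfun_apply -` U"
    unfolding strong_operator_topology_def openin_pullback_topology by auto
  have "limitin (product_topology (\<lambda>i. euclidean) UNIV) (\<lambda>n. blinfun_apply (f n)) (blinfun_apply g) sequentially"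
    unfolding limitin_componentwise using lim by auto
  then have "limitin euclidean (\<lambda>n. blinfun_apply (f n)) (blinfun_apply g) sequentially"
    by (simp add: euclidean_product_topology)
  then have "(\<lambda>n. blinfun_apply (f n)) \<longlonglongrightarrow> blinfun_apply g" by simp
  moreover have "blinfun_apply g \<in> U" using \<open>g \<notin> M\<close> U(2) by auto
  ultimately have "\<forall>\<^sub>F n in sequentially. blinfun_apply (f n) \<in> U" using U(1) topological_tendstoD by blast
  then obtain n where "blinfun_apply (f n) \<in> U" by (auto simp: eventually_sequentially)
  then have "f n \<in> - M" using U(2) by auto
  then show False using f by blast
qed

lemma von_neumann_algebra_strongly_closed:
  assumes "von_neumann_algebra M"
  shows "strongly_closed_algebra M"
proof
  have "unital_star_subalgebra M" and c: "closedin strong_operator_topology M"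
    using assms by (auto simp: von_neumann_algebra_def)
  note MD = star_subalgebraD[OF this(1)]
  show "id_blinfun \<in> M" "\<And>a b. a \<in> M \<Longrightarrow> b \<in> M \<Longrightarrow> a + b \<in> M" "\<And>a c. a \<in> M \<Longrightarrow> c *\<^sub>R a \<in> M"
    "\<And>a b. a \<in> M \<Longrightarrow> b \<in> M \<Longrightarrow> a \<cdot> b \<in> M"
    using MD by auto
  show "g \<in> M" if "\<And>n. f n \<in> M" "\<And>x. (\<lambda>n. blinfun_apply (f n) x) \<longlonglongrightarrow> blinfun_apply g x" for f g
    by (rule strong_operator_closed_sequentially[OF c that])
qed

lemma in_projections_iff:
  fixes M :: "('h :: chilbert_space \<Rightarrow>\<^sub>L 'h) set"
  assumes "M \<subseteq> bounded_operators"
  shows "p \<in> projections M \<longleftrightarrow> p \<in> M \<and> is_proj p"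
proof (cases "p \<in> M")
  case True
  then have "p \<in> bounded_operators" using assms by blast
  then show ?thesis by (simp add: projections_def is_proj_def adj_eq_hadj)
qed (simp add: projections_def)

lemma II1_factor_star_subalgebra: "II1_factor M \<Longrightarrow> unital_star_subalgebra M"
  by (simp add: II1_factor_def vn_factor_def von_neumann_algebra_def)

lemma II1_factor_diffuse_tracial_factor:
  fixes M :: "('h :: chilbert_space \<Rightarrow>\<^sub>L 'h) set"
  assumes M: "II1_factor M" and \<tau>: "normalized_faithful_normal_trace M \<tau>"
  shows "diffuse_tracial_factor M (\<lambda>x. Re (\<tau> x))"
proof -
  have vN: "von_neumann_algebra M" and id0: "(id_blinfun :: 'h \<Rightarrow>\<^sub>L 'h) \<noteq> 0"
    and center: "M \<inter> commutant M = range (\<lambda>c. c *\<^sub>C id_blinfun)"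
    and nomin: "\<nexists>p. minimal_projection M p"
    using M by (auto simp: II1_factor_def vn_factor_def)
  have star: "unital_star_subalgebra M" using vN by (simp add: von_neumann_algebra_def)
  note MD = star_subalgebraD[OF star]
  have bop: "x \<in> bounded_operators" if "x \<in> M" for x using MD(1) that by blast
  have lin: "clinear_on M \<tau>" and pos: "\<And>x. x \<in> M \<Longrightarrow> pos_op x \<Longrightarrow> \<tau> x \<in> \<real>\<^sub>\<ge>\<^sub>0" and unit: "\<tau> id_blinfun = 1"
    and comm: "\<And>x y. x \<in> M \<Longrightarrow> y \<in> M \<Longrightarrow> \<tau> (x \<cdot> y) = \<tau> (y \<cdot> x)"
    and faithful: "\<And>x. x \<in> M \<Longrightarrow> \<tau> (adj x \<cdot> x) = 0 \<Longrightarrow> x = 0" and normal: "normal_on M \<tau>"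
    using \<tau> by (auto simp: normalized_faithful_normal_trace_def)
  interpret strongly_closed_algebra M by (rule von_neumann_algebra_strongly_closed[OF vN])
  have nonneg: "0 \<le> Re (\<tau> x) \<and> Im (\<tau> x) = 0" if "x \<in> M" "psd x" for x
    using pos[OF that(1)] that bop by (simp add: pos_op_iff_psd complex_nonneg_Reals_iff)
  have op_le: "op_le x y \<longleftrightarrow> psd (y - x)" if "x \<in> M" "y \<in> M" for x y
    using bop[OF MD(6)[OF that(2,1)]] by (simp add: op_le_def pos_op_iff_psd)
  show ?thesis
  proof
    show "hadj x \<in> M" if "x \<in> M" for x using MD(8) that .
    show "Re (\<tau> (x + y)) = Re (\<tau> x) + Re (\<tau> y)" if "x \<in> M" "y \<in> M" for x y
      using lin that by (simp add: clinear_on_def)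
    show "Re (\<tau> (c *\<^sub>R x)) = c * Re (\<tau> x)" if "x \<in> M" for x c
      using lin that by (simp add: clinear_on_def scaleR_scaleC scaleC_complex_def)
    show "Re (\<tau> id_blinfun) = 1" by (simp add: unit)
    show "Re (\<tau> (x \<cdot> y)) = Re (\<tau> (y \<cdot> x))" if "x \<in> M" "y \<in> M" for x y using comm[OF that] by simp
    show "0 \<le> Re (\<tau> x)" if "x \<in> M" "psd x" for x using nonneg[OF that] by simp
    show "x = 0" if x: "x \<in> M" "Re (\<tau> (hadj x \<cdot> x)) = 0" for x
    proof -
      have "hadj x \<cdot> x \<in> M" using MD(7,8) x by blast
      then have "\<tau> (hadj x \<cdot> x) = 0" using nonneg[OF _ psd_hadj_self] x(2) by (simp add: complex_eq_iff)
      then show ?thesis using faithful[OF x(1)] adj_eq_hadj[OF bop[OF x(1)]] by simp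
    qed
    show "Re (\<tau> E) \<le> t" if e: "\<And>n :: nat. e n \<in> M" "\<And>n. is_proj (e n)" "\<And>n. e (Suc n) \<cdot> e n = e n"
      and E: "E \<in> M" "is_proj E" "\<And>x. (\<lambda>n. blinfun_apply (e n) x) \<longlonglongrightarrow> blinfun_apply E x"
      and t: "\<And>n. Re (\<tau> (e n)) \<le> t" for e E t
    proof -
      have le: "psd (e m - e n)" if "n \<le> m" for m n
        by (intro psd_proj is_proj_diff e proj_chain_le that)
      have "psd (E - e n)" for n
      proof -
        have "0 \<le> inner (E x) x - inner (e n x) x" for x
        proof (rule LIMSEQ_le_const)
          show "(\<lambda>m. inner (e m x) x - inner (e n x) x) \<longlonglongrightarrow> inner (E x) x - inner (e n x) x"
            by (intro tendsto_intros E)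
          show "\<exists>N. \<forall>m\<ge>N. 0 \<le> inner (e m x) x - inner (e n x) x"
            using psdD(1)[OF le, of n _ x] by (auto simp: blinfun.diff_left inner_diff_left)
        qed
        then show ?thesis using e(2) E(2) by (simp add: psd_def is_projD blinfun.diff_left inner_diff_left)
      qed
      moreover have "psd (y - E)" if y: "y \<in> M" "\<And>n. psd (y - e n)" for y
      proof -
        have "0 \<le> inner (y x) x - inner (E x) x" for x
        proof (rule LIMSEQ_le_const)
          show "(\<lambda>m. inner (y x) x - inner (e m x) x) \<longlonglongrightarrow> inner (y x) x - inner (E x) x"
            by (intro tendsto_intros E)
          show "\<exists>N. \<forall>m\<ge>N. 0 \<le> inner (y x) x - inner (e m x) x"
            using psdD(1)[OF y(2), of _ x] by (auto simp: blinfun.diff_left inner_diff_left)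
        qed
        moreover have "hadj y = y" using psdD(2)[OF y(2), of 0] e(2) by (simp add: is_projD)
        ultimately show ?thesis using E(2) by (simp add: psd_def is_projD blinfun.diff_left inner_diff_left)
      qed
      ultimately have sup: "is_sup_in M (range e) E"
        using E(1) e(1) by (auto simp: is_sup_in_def op_le)
      have dir: "\<exists>z\<in>range e. op_le x z \<and> op_le y z" if xy: "x \<in> range e" "y \<in> range e" for x y
      proof -
        obtain m n where "x = e m" "y = e n" using xy by auto
        then show ?thesis using le[of m "max m n"] le[of n "max m n"] e(1) by (auto simp: op_le)
      qed
      have sub: "range e \<subseteq> {x \<in> M. pos_op x}" using e(1,2) bop by (auto simp: pos_op_iff_psd psd_proj)
      have "Re (\<tau> E) = (SUP x\<in>range e. Re (\<tau> x))"
        by (rule normal[unfolded normal_on_def, rule_format]) (intro conjI ballI sub sup dir, simp)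
      also have "\<dots> \<le> t" by (rule cSUP_least) (use t in auto)
      finally show ?thesis .
    qed
    show "z = 0 \<or> z = id_blinfun" if z: "z \<in> M" "is_proj z" "\<And>x. x \<in> M \<Longrightarrow> z \<cdot> x = x \<cdot> z" for z
    proof -
      have "z \<in> commutant M" using z bop by (simp add: commutant_def)
      then obtain c where c: "z = c *\<^sub>C id_blinfun" using center z(1) by blast
      have "z \<cdot> z = (c * c) *\<^sub>C id_blinfun"
        by (rule blinfun_eqI) (simp add: c scaleC_blinfun.rep_eq scaleC_scaleC)
      then have "(c * c) *\<^sub>C id_blinfun = c *\<^sub>C (id_blinfun :: 'h \<Rightarrow>\<^sub>L 'h)" using z(2) c by (simp add: is_projD)
      then have "(c * c - c) *\<^sub>C (id_blinfun :: 'h \<Rightarrow>\<^sub>L 'h) = 0" by (simp add: complex_vector.scale_left_diff_distrib)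
      then have "c * c - c = 0" using id0 by simp
      then have "c = 0 \<or> c = 1" by (simp add: algebra_simps)
      then show ?thesis using c by (auto simp: scaleC_one)
    qed
    show "\<exists>q\<in>M. is_proj q \<and> q \<noteq> 0 \<and> q \<noteq> p \<and> p \<cdot> q = q" if p: "p \<in> M" "is_proj p" "p \<noteq> 0" for p
    proof -
      have "\<not> minimal_projection M p" using nomin by simp
      then obtain q where q: "q \<in> M" "is_proj q" "op_le q p" "q \<noteq> 0" "q \<noteq> p"
        using p by (auto simp: minimal_projection_def in_projections_iff[OF MD(1)])
      have "psd (p - q)" using q(3) op_le[OF q(1) p(1)] by simp
      then have "p \<cdot> q = q" by (rule proj_hereditary[OF p(2) q(2)])
      with q show ?thesis by (intro bexI[of _ q] conjI)
    qed
  qed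
qed

lemma doubly_stochastic_doubly_stochastic_map:
  fixes M :: "('h :: chilbert_space \<Rightarrow>\<^sub>L 'h) set"
  assumes M: "II1_factor M" and \<tau>: "normalized_faithful_normal_trace M \<tau>" and T: "doubly_stochastic M \<tau> T"
  shows "doubly_stochastic_map M (\<lambda>x. Re (\<tau> x)) T"
proof -
  interpret diffuse_tracial_factor M "\<lambda>x. Re (\<tau> x)" by (rule II1_factor_diffuse_tracial_factor[OF M \<tau>])
  have bop: "x \<in> bounded_operators" if "x \<in> M" for x
    using star_subalgebraD(1)[OF II1_factor_star_subalgebra[OF M]] that by blast
  have T: "T ` M \<subseteq> M" "clinear_on M T" "T id_blinfun = id_blinfun" "\<And>x. x \<in> M \<Longrightarrow> pos_op x \<Longrightarrow> pos_op (T x)"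
    "\<And>x. x \<in> M \<Longrightarrow> \<tau> (T x) = \<tau> x"
    using T by (auto simp: doubly_stochastic_def)
  show ?thesis
  proof
    show "T x \<in> M" if "x \<in> M" for x using T(1) that by blast
    show "T (x + y) = T x + T y" if "x \<in> M" "y \<in> M" for x y using T(2) that by (simp add: clinear_on_def)
    show "T (c *\<^sub>R x) = c *\<^sub>R T x" if "x \<in> M" for x c
      using T(2) that by (simp add: clinear_on_def scaleR_scaleC)
    show "psd (T x)" if "x \<in> M" "psd x" for x using T(4)[OF that(1)] bop that by (simp add: pos_op_iff_psd)
  qed (simp_all add: T)
qed

definition re_part :: "('h :: chilbert_space \<Rightarrow>\<^sub>L 'h) \<Rightarrow> 'h \<Rightarrow>\<^sub>L 'h" where
  "re_part b = (1/2) *\<^sub>R (b + hadj b)"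

definition im_part :: "('h :: chilbert_space \<Rightarrow>\<^sub>L 'h) \<Rightarrow> 'h \<Rightarrow>\<^sub>L 'h" where
  "im_part b = (1/2) *\<^sub>R ((- \<i>) *\<^sub>C (b - hadj b))"

lemma re_im_decomp: "b = re_part b + \<i> *\<^sub>C im_part b"
proof -
  have "\<i> *\<^sub>C im_part b = (1/2) *\<^sub>R (b - hadj b)"
    by (simp add: im_part_def scaleR_scaleC scaleC_scaleC)
  then have "re_part b + \<i> *\<^sub>C im_part b = (1/2) *\<^sub>R (b + hadj b) + (1/2) *\<^sub>R (b - hadj b)"
    by (simp add: re_part_def)
  also have "\<dots> = (1/2) *\<^sub>R (b + b)" unfolding scaleR_add_right[symmetric] by simp
  finally show ?thesis by simp
qed

lemma re_im_parts:
  assumes A: "unital_star_subalgebra A" and b: "b \<in> A"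
  shows "re_part b \<in> A" "im_part b \<in> A" "hadj (re_part b) = re_part b" "hadj (im_part b) = im_part b"
proof -
  note AD = star_subalgebraD[OF A]
  show "re_part b \<in> A" "im_part b \<in> A" unfolding re_part_def im_part_def by (intro AD(3-8) b)+
  show "hadj (re_part b) = re_part b" by (simp add: re_part_def add.commute)
  have "b - hadj b \<in> A" "hadj (b - hadj b) \<in> A" using b AD by simp_all
  then have "hadj ((- \<i>) *\<^sub>C (b - hadj b)) = cnj (- \<i>) *\<^sub>C hadj (b - hadj b)" using AD(1) by (intro hadj_scaleC) auto
  also have "\<dots> = (- \<i>) *\<^sub>C (b - hadj b)"
    by (simp add: complex_vector.scale_right_diff_distrib)
  finally show "hadj (im_part b) = im_part b" by (simp add: im_part_def)
qed

lemma re_im_norm: "norm (re_part b) \<le> norm b" "norm (im_part b) \<le> norm b"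
proof -
  have "norm (b + hadj b) \<le> 2 * norm b" "norm (b - hadj b) \<le> 2 * norm b"
    using norm_triangle_ineq[of b "hadj b"] norm_triangle_ineq4[of b "hadj b"] norm_hadj_le[of b] by linarith+
  moreover have "norm ((- \<i>) *\<^sub>C (b - hadj b)) \<le> norm (b - hadj b)"
    using norm_scaleC_blinfun_le[of "- \<i>" "b - hadj b"] by simp
  ultimately show "norm (re_part b) \<le> norm b" "norm (im_part b) \<le> norm b" by (simp_all add: re_part_def im_part_def)
qed

lemma re_im_unique:
  assumes A: "unital_star_subalgebra A" and hk: "h \<in> A" "k \<in> A" "hadj h = h" "hadj k = k"
  shows "re_part (h + \<i> *\<^sub>C k) = h" "im_part (h + \<i> *\<^sub>C k) = k"
proof -
  have "k \<in> bounded_operators" using star_subalgebraD(1)[OF A] hk by blast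
  then have "hadj (\<i> *\<^sub>C k) = - \<i> *\<^sub>C k" using hadj_scaleC[of k \<i>] hk by simp
  then have ad: "hadj (h + \<i> *\<^sub>C k) = h - \<i> *\<^sub>C k" using hk by simp
  show "re_part (h + \<i> *\<^sub>C k) = h" unfolding re_part_def ad by simp
  have "(h + \<i> *\<^sub>C k) - (h - \<i> *\<^sub>C k) = 2 *\<^sub>R (\<i> *\<^sub>C k)" by (simp add: scaleR_2)
  then show "im_part (h + \<i> *\<^sub>C k) = k" unfolding im_part_def ad by (simp add: scaleR_scaleC scaleC_scaleC scaleC_one)
qed

lemma dense_sequence_in_subset:
  fixes B :: "'b :: metric_space set"
  assumes B: "separable_space (top_of_set B)" and S: "S \<subseteq> B" "S \<noteq> {}"
  obtains f :: "nat \<Rightarrow> 'b" where "range f \<subseteq> S" "\<And>b e. b \<in> S \<Longrightarrow> 0 < e \<Longrightarrow> \<exists>n. dist b (f n) < e"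
proof -
  obtain C where C: "countable C" "C \<subseteq> B" "top_of_set B closure_of C = B"
    using B by (auto simp: separable_space_def)
  have dense: "\<exists>c\<in>C. dist b c < e" if "b \<in> B" "0 < e" for b e
  proof -
    have "b \<in> top_of_set B closure_of C" using C(3) that by simp
    then have "\<forall>V. b \<in> V \<and> openin (top_of_set B) V \<longrightarrow> (\<exists>y\<in>C. y \<in> V)"
      by (auto simp: in_closure_of)
    moreover have "openin (top_of_set B) (B \<inter> ball b e)" by (simp add: openin_open_Int)
    moreover have "b \<in> B \<inter> ball b e" using that by simp
    ultimately have "\<exists>y\<in>C. y \<in> B \<inter> ball b e" by blast
    then show ?thesis by auto
  qed
  \<comment> \<open>Each ball of radius \<open>1 / (m + 1)\<close> around a point of \<open>C\<close> contributes a point of \<open>S\<close> if it has one.\<close>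
  define s where "s c m = (SOME x. x \<in> S \<and> dist x c < 1 / real (Suc m))" for c m
  have s: "s c m \<in> S \<and> dist (s c m) c < 1 / real (Suc m)" if "x \<in> S" "dist x c < 1 / real (Suc m)" for x c m
    unfolding s_def by (rule someI[of "\<lambda>x. x \<in> S \<and> dist x c < 1 / real (Suc m)" x]) (rule conjI[OF that])
  define D where "D = (\<lambda>(c, m). s c m) ` (C \<times> UNIV) \<inter> S"
  have Dc: "countable D" unfolding D_def using C(1) by (intro countable_Int1) auto
  have D: "\<exists>d\<in>D. dist b d < e" if b: "b \<in> S" and e: "0 < e" for b e
  proof -
    obtain m where m: "1 / real (Suc m) < e / 2" using nat_approx_posE[of "e / 2"] e by auto
    obtain c where c: "c \<in> C" "dist b c < 1 / real (Suc m)" using dense[of b "1 / real (Suc m)"] b S by auto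
    have sc: "s c m \<in> S" "dist (s c m) c < 1 / real (Suc m)" using s[OF b c(2)] by simp_all
    then have "s c m \<in> D" using c by (auto simp: D_def)
    moreover have "dist b (s c m) < e" using dist_triangle2[of b "s c m" c] c(2) sc(2) m by linarith
    ultimately show ?thesis by blast
  qed
  obtain b0 where "b0 \<in> S" using S by blast
  then have "D \<noteq> {}" using D[of b0 1] by auto
  show thesis
  proof (rule that[of "from_nat_into D"])
    show "range (from_nat_into D) \<subseteq> S" using range_from_nat_into[OF \<open>D \<noteq> {}\<close> Dc] by (auto simp: D_def)
    show "\<exists>n. dist b (from_nat_into D n) < e" if "b \<in> S" "0 < e" for b e
    proof -
      obtain d where "d \<in> D" "dist b d < e" using D[OF \<open>b \<in> S\<close> \<open>0 < e\<close>] by blast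
      then show ?thesis using from_nat_into_surj[OF Dc] by blast
    qed
  qed
qed

section \<open>The local form of doubly stochastic maps\<close>

text \<open>
  The real and imaginary parts of \<open>T b\<close> are the images of those of \<open>b\<close>, so they stay in \<open>A\<close>, and the maps \<open>\<rho>\<close> are
  complex linear; it remains to approximate \<open>T\<close> on self-adjoint elements.
\<close>

lemma finite_approximation_in_inner_hull:
  fixes M A B :: "('h :: chilbert_space \<Rightarrow>\<^sub>L 'h) set"
  assumes M: "II1_factor M" and \<tau>: "normalized_faithful_normal_trace M \<tau>"
    and A: "unital_star_subalgebra A" "A \<subseteq> M" "abelian A"
    and B: "unital_star_subalgebra B" "B \<subseteq> M" "abelian B"
    and T: "doubly_stochastic M \<tau> T"
    and F: "finite F" "F \<subseteq> T -` A \<inter> B" and \<epsilon>: "0 < \<epsilon>"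
  shows "\<exists>\<rho> \<in> inner_hull M. (\<forall>x. norm (blinfun_apply \<rho> x) \<le> norm x) \<and>
    (\<forall>b\<in>F. norm (T b - blinfun_apply \<rho> b) \<le> \<epsilon>)"
proof -
  interpret doubly_stochastic_map M "\<lambda>x. Re (\<tau> x)" T
    by (rule doubly_stochastic_doubly_stochastic_map[OF M \<tau> T])
  have Mbop: "x \<in> bounded_operators" if "x \<in> M" for x
    using star_subalgebraD(1)[OF II1_factor_star_subalgebra[OF M]] that by blast
  have T_scaleC: "T (c *\<^sub>C x) = c *\<^sub>C T x" if "x \<in> M" for c x
    using T that by (simp add: doubly_stochastic_def clinear_on_def)
  define N1 where "N1 = bicommutant_in M B"
  define N2 where "N2 = bicommutant_in M A"
  have N1: "abelian_algebra N1" "N1 \<subseteq> M" "B \<subseteq> N1"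
    unfolding N1_def using B abelian_bicommutant_in[of B] bicommutant_in_sub[of B] sub_bicommutant_in[of B]
    by (auto simp: abelian_def)
  have N2: "abelian_algebra N2" "N2 \<subseteq> M" "A \<subseteq> N2"
    unfolding N2_def using A abelian_bicommutant_in[of A] bicommutant_in_sub[of A] sub_bicommutant_in[of A]
    by (auto simp: abelian_def)
  have parts: "re_part b \<in> B" "im_part b \<in> B" "hadj (re_part b) = re_part b" "hadj (im_part b) = im_part b"
    "T (re_part b) \<in> A" "T (im_part b) \<in> A" "T b = T (re_part b) + \<i> *\<^sub>C T (im_part b)"
    if b: "b \<in> T -` A \<inter> B" for b
  proof -
    note P = re_im_parts[OF B(1), of b]
    show P': "re_part b \<in> B" "im_part b \<in> B" "hadj (re_part b) = re_part b" "hadj (im_part b) = im_part b"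
      using P b by auto
    have PM: "re_part b \<in> M" "im_part b \<in> M" using P' B(2) by auto
    have iM: "\<i> *\<^sub>C im_part b \<in> M" using star_subalgebraD(4)[OF B(1) P'(2)] B(2) by blast
    have "T b = T (re_part b + \<i> *\<^sub>C im_part b)" by (simp only: re_im_decomp[symmetric])
    then show Tb: "T b = T (re_part b) + \<i> *\<^sub>C T (im_part b)" by (simp add: T_add[OF PM(1) iM] T_scaleC[OF PM(2)])
    note starM = II1_factor_star_subalgebra[OF M]
    have "re_part (T b) = T (re_part b)" "im_part (T b) = T (im_part b)"
      unfolding Tb using PM P' by (auto intro!: re_im_unique[OF starM] T_mem T_hermitian)
    moreover have "re_part (T b) \<in> A" "im_part (T b) \<in> A" using re_im_parts(1,2)[OF A(1)] b by auto
    ultimately show "T (re_part b) \<in> A" "T (im_part b) \<in> A" by simp_all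
  qed
  define G where "G = re_part ` F \<union> im_part ` F"
  have G: "b \<in> N1 \<and> hadj b = b \<and> T b \<in> N2" if "b \<in> G" for b
  proof -
    obtain c where c: "c \<in> F" "b = re_part c \<or> b = im_part c" using \<open>b \<in> G\<close> by (auto simp: G_def)
    then have "c \<in> T -` A \<inter> B" using F(2) by blast
    note P = parts(1-6)[OF this]
    show ?thesis using c(2) P subsetD[OF N1(3)] subsetD[OF N2(3)] by (elim disjE) simp_all
  qed
  have "finite G" using F by (simp add: G_def)
  have "\<exists>n>0. \<exists>U. (\<forall>s<n. U s \<in> M \<and> is_unitary (U s)) \<and>
      (\<forall>b\<in>G. norm (T b - (1 / real n) *\<^sub>R (\<Sum>s<n. U s \<cdot> b \<cdot> hadj (U s))) \<le> \<epsilon> / 2)"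
    by (rule finite_approximation[OF N1(1,2) N2(1,2) \<open>finite G\<close>]) (simp_all add: G \<epsilon>)
  then obtain n U where n: "0 < n"
    and U: "\<And>s. s < n \<Longrightarrow> U s \<in> M \<and> is_unitary (U s)"
    and approx: "\<And>b. b \<in> G \<Longrightarrow> norm (T b - (1 / real n) *\<^sub>R (\<Sum>s<n. U s \<cdot> b \<cdot> hadj (U s))) \<le> \<epsilon> / 2"
    by blast
  have adjU: "adj (U s) = hadj (U s)" if "s < n" for s using adj_eq_hadj Mbop U that by blast
  define \<rho> where "\<rho> = (\<Sum>s<n. (1 / real n) *\<^sub>R Ad (U s))"
  have \<rho>: "blinfun_apply \<rho> x = (1 / real n) *\<^sub>R (\<Sum>s<n. U s \<cdot> x \<cdot> hadj (U s))" for x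
    by (simp add: \<rho>_def blinfun_apply_sum blinfun.scaleR_left Ad.rep_eq adjU scaleR_right.sum)
  have hull: "\<rho> \<in> inner_hull M"
    unfolding \<rho>_def inner_hull_def
  proof (rule convex_sum)
    show "Ad (U s) \<in> convex hull (Ad ` unitaries M)" if "s \<in> {..<n}" for s
      using U[of s] adjU[of s] that by (intro hull_inc imageI) (simp add: unitaries_def)
  qed (use n in auto)
  have norm_\<rho>: "norm (\<rho> x) \<le> norm x" for x
    unfolding \<rho> by (rule norm_unitary_average_le) (use U in auto)
  have \<rho>_scaleC: "\<rho> (c *\<^sub>C x) = c *\<^sub>C \<rho> x" for c x
  proof -
    have "U s \<cdot> (c *\<^sub>C x) \<cdot> hadj (U s) = c *\<^sub>C (U s \<cdot> x \<cdot> hadj (U s))" if "s < n" for s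
      using Mbop U[OF that] by (intro blinfun_eqI) (simp add: scaleC_blinfun.rep_eq apply_scaleC)
    then show ?thesis
      by (simp add: \<rho> scaleR_scaleC complex_vector.scale_sum_right complex_vector.scale_left_commute)
  qed
  have "norm (T b - \<rho> b) \<le> \<epsilon>" if b: "b \<in> F" for b
  proof -
    have bS: "b \<in> T -` A \<inter> B" using b F(2) by blast
    have "\<rho> b = \<rho> (re_part b + \<i> *\<^sub>C im_part b)" by (simp only: re_im_decomp[symmetric])
    then have "T b - \<rho> b = (T (re_part b) - \<rho> (re_part b)) + \<i> *\<^sub>C (T (im_part b) - \<rho> (im_part b))"
      by (simp add: parts(7)[OF bS] blinfun.add_right \<rho>_scaleC complex_vector.scale_right_diff_distrib)
    also have "norm \<dots> \<le> norm (T (re_part b) - \<rho> (re_part b)) + norm (T (im_part b) - \<rho> (im_part b))"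
      by (rule order_trans[OF norm_triangle_ineq add_left_mono])
        (use norm_scaleC_blinfun_le[of \<i>] in simp)
    also have "\<dots> \<le> \<epsilon> / 2 + \<epsilon> / 2"
      unfolding \<rho> using b by (intro add_mono approx) (auto simp: G_def)
    finally show ?thesis by simp
  qed
  then show ?thesis using hull norm_\<rho> by blast
qed

lemma doubly_stochastic_norm_le:
  fixes M :: "('h :: chilbert_space \<Rightarrow>\<^sub>L 'h) set"
  assumes M: "II1_factor M" and \<tau>: "normalized_faithful_normal_trace M \<tau>" and T: "doubly_stochastic M \<tau> T"
    and x: "x \<in> M"
  shows "norm (T x) \<le> 2 * norm x"
proof -
  interpret doubly_stochastic_map M "\<lambda>x. Re (\<tau> x)" T
    by (rule doubly_stochastic_doubly_stochastic_map[OF M \<tau> T])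
  note starM = II1_factor_star_subalgebra[OF M]
  note P = re_im_parts[OF starM x]
  have "T x = T (re_part x + \<i> *\<^sub>C im_part x)" by (simp only: re_im_decomp[symmetric])
  also have "\<dots> = T (re_part x) + \<i> *\<^sub>C T (im_part x)"
    using T P star_subalgebraD(4)[OF starM P(2)] by (simp add: doubly_stochastic_def clinear_on_def)
  also have "norm \<dots> \<le> norm (T (re_part x)) + norm (T (im_part x))"
    by (rule order_trans[OF norm_triangle_ineq add_left_mono]) (use norm_scaleC_blinfun_le[of \<i>] in simp)
  also have "\<dots> \<le> norm x + norm x"
    by (intro add_mono order_trans[OF norm_T_le re_im_norm(1)] order_trans[OF norm_T_le re_im_norm(2)] P)
  finally show ?thesis by simp
qed

theorem theorem3p6:
  fixes M A B :: "('h :: chilbert_space \<Rightarrow>\<^sub>L 'h) set"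
    and \<tau> :: "('h \<Rightarrow>\<^sub>L 'h) \<Rightarrow> complex"
    and T :: "('h \<Rightarrow>\<^sub>L 'h) \<Rightarrow> ('h \<Rightarrow>\<^sub>L 'h)"
  assumes "II1_factor M"
    and "normalized_faithful_normal_trace M \<tau>"
    and "unital_cstar_algebra A" "A \<subseteq> M" "abelian A" "separable_space (top_of_set A)"
    and "unital_cstar_algebra B" "B \<subseteq> M" "abelian B" "separable_space (top_of_set B)"
    and "doubly_stochastic M \<tau> T"
  shows "\<exists>\<rho> :: nat \<Rightarrow> ('h \<Rightarrow>\<^sub>L 'h) \<Rightarrow>\<^sub>L ('h \<Rightarrow>\<^sub>L 'h).
           (\<forall>r. \<rho> r \<in> inner_hull M) \<and>
           (\<forall>b \<in> T -` A \<inter> B. (\<lambda>r. norm (T b - blinfun_apply (\<rho> r) b)) \<longlonglongrightarrow> 0)"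
proof -
  note M = assms(1) and \<tau> = assms(2) and T = assms(11)
  have A: "unital_star_subalgebra A" and B: "unital_star_subalgebra B"
    using assms by (auto simp: unital_cstar_algebra_def)
  define S where "S = T -` A \<inter> B"
  have S: "S \<subseteq> B" by (auto simp: S_def)
  interpret doubly_stochastic_map M "\<lambda>x. Re (\<tau> x)" T
    by (rule doubly_stochastic_doubly_stochastic_map[OF M \<tau> T])
  have "0 \<in> S" using star_subalgebraD(9)[OF A] star_subalgebraD(9)[OF B] by (simp add: S_def T_zero)
  then obtain f :: "nat \<Rightarrow> 'h \<Rightarrow>\<^sub>L 'h" where f: "range f \<subseteq> S" "\<And>b e. b \<in> S \<Longrightarrow> 0 < e \<Longrightarrow> \<exists>n. dist b (f n) < e"
    using dense_sequence_in_subset[OF assms(10) S] by blast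
  have "\<exists>\<rho> \<in> inner_hull M. (\<forall>x. norm (blinfun_apply \<rho> x) \<le> norm x) \<and>
      (\<forall>b\<in>f ` {..r}. norm (T b - blinfun_apply \<rho> b) \<le> 1 / real (Suc r))" for r
    by (rule finite_approximation_in_inner_hull[OF M \<tau> A assms(4,5) B assms(8,9) T])
      (use f(1) in \<open>auto simp: S_def\<close>)
  then obtain \<rho> where \<rho>: "\<And>r. \<rho> r \<in> inner_hull M" "\<And>r x. norm (blinfun_apply (\<rho> r) x) \<le> norm x"
    "\<And>r b. b \<in> f ` {..r} \<Longrightarrow> norm (T b - blinfun_apply (\<rho> r) b) \<le> 1 / real (Suc r)"
    by metis
  have "(\<lambda>r. norm (T b - blinfun_apply (\<rho> r) b)) \<longlonglongrightarrow> 0" if b: "b \<in> S" for b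
  proof (rule LIMSEQ_I)
    fix e :: real assume e: "0 < e"
    \<comment> \<open>The norm of \<open>T\<close> is at most \<open>2\<close> and that of \<open>\<rho> r\<close> at most \<open>1\<close>, so \<open>b - f n\<close> contributes three times its norm.\<close>
    obtain n where n: "dist b (f n) < e / 6" using f(2)[OF b, of "e / 6"] e by auto
    obtain m where m: "1 / real (Suc m) < e / 2" using nat_approx_posE[of "e / 2"] e by auto
    have "norm (T b - \<rho> r b) < e" if r: "max n m \<le> r" for r
    proof -
      have "f n \<in> M" "b \<in> M" using f(1) b S assms(8) by auto
      then have "norm (T b - T (f n)) \<le> 2 * norm (b - f n)"
        using doubly_stochastic_norm_le[OF M \<tau> T, of "b - f n"] by (simp add: T_diff mem)
      moreover have "norm (T (f n) - \<rho> r (f n)) \<le> 1 / real (Suc r)" using r by (intro \<rho>(3)) auto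
      moreover have "1 / real (Suc r) \<le> 1 / real (Suc m)" using r by (simp add: frac_le)
      moreover have "norm (\<rho> r (f n) - \<rho> r b) \<le> norm (b - f n)"
        using \<rho>(2)[of r "f n - b"] by (simp add: blinfun.diff_right norm_minus_commute)
      moreover have "norm (T b - \<rho> r b) \<le> norm (T b - T (f n)) + norm (T (f n) - \<rho> r (f n)) + norm (\<rho> r (f n) - \<rho> r b)"
        using norm_triangle_ineq[of "T b - T (f n)" "T (f n) - \<rho> r b"]
          norm_triangle_ineq[of "T (f n) - \<rho> r (f n)" "\<rho> r (f n) - \<rho> r b"] by simp
      ultimately show ?thesis using n m by (simp add: dist_norm)
    qed
    then show "\<exists>N. \<forall>r\<ge>N. norm (norm (T b - \<rho> r b) - 0) < e" by (intro exI[of _ "max n m"]) simp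
  qed
  then show ?thesis using \<rho>(1) unfolding S_def by blast
qed

end
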